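(* Let $\mathcal{T}=\{T_t:t\ge 0\}$ be a $C_0$ contraction semigroup on a Hilbert space $\mathcal{H}$ all of whose vectors are flight vectors, let $T$ be its cogenerator, and let $\mathcal{D}=\{T^n:n\ge0\}$. Then the weak stability of $\mathcal{T}$ is equivalent to that of its cogenerator $T$, in the sense that $\mathcal{H}_w(\mathcal{T})=\mathcal{H}_w(\mathcal{D})$, if and only if the unitary parts $\mathcal{U}$ and $\mathcal{C}$ of $\mathcal{T}$ and $\mathcal{D}$ have a common limit algebra, $\mathcal{M}^{\Omega_{\mathcal{U}}}=\mathcal{M}^{\Omega_{\mathcal{C}}}$ (that is, are entangled).
   Context: Flight vectors: $x\in\mathcal{H}$ is a flight (almost weakly stable) vector if $0$ lies in the weak closure of its orbit $\{T_tx:t\ge 0\}$. The flight vectors of $\mathcal{T}$ and of $\mathcal{D}$ form the same subspace $\mathcal{H}_0$; it is assumed throughout that $\mathcal{H}=\mathcal{H}_0$. Cogenerator: if $G$ is the generator of $\mathcal{T}$, then $T=(G+I)(G-I)^{-1}$. Weakly stable subspaces: $\mathcal{H}_w(\mathcal{T})=\{x\in\mathcal{H}:T_tx\to0 \text{ weakly as } t\to\infty\}$ and $\mathcal{H}_w(\mathcal{D})=\{x\in\mathcal{H}:T^nx\to0\text{ weakly as }n\to\infty\}$. Unitary part: $\mathcal{H}_u$ is the largest closed reducing subspace on which every $T_t$ is unitary; equivalently, the largest one on which $T$ is unitary. $P_u$ is the orthogonal projection onto $\mathcal{H}_u$. $\mathcal{U}=\{U_t:t\in\mathbb{R}\}$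 is the unitary group on $\mathcal{H}_u$ with $U_t=T_t|_{\mathcal{H}_u}$ and $U_{-t}=U_t^*$ for $t\ge0$. $\mathcal{C}=\{U^n:n\in\mathbb{Z}\}$, where $U=T|_{\mathcal{H}_u}$ is the cogenerator of $\mathcal{U}$. Limit operators: $\Omega_{\mathcal{U}}$ is the set of all weak operator limits $V=\lim_k U_{t_k}$ over sequences $t_k\uparrow+\infty$, and $\Omega_{\mathcal{C}}$ is the set of all weak operator limits $V=\lim_k U^{n_k}$ over sequences of integers $n_k\uparrow+\infty$. For $x\in\mathcal{H}$ an operator $V$ on $\mathcal{H}_u$ acts by $Vx:=VP_ux$. For $\mathcal{S}=\mathcal{U}$ or $\mathcal{C}$: $\Omega_{\mathcal{S}}\cdot x=\{Vx:V\in\Omega_{\mathcal{S}}\}$, and $M(x,\mathcal{S})$ is the closed linear span of $\Omega_{\mathcal{S}}\cdot x$ in $\mathcal{H}$. Limit algebra: $\mathcal{M}^{\Omega_{\mathcal{S}}}$ is the least $*$-closed, weakly closed subalgebra of $\mathcal{L}(\mathcal{H}_u)$ (bounded operators) containing $\Omega_{\mathcal{S}}$; its unit need not be the identity. Entangled: $\mathcal{U}$ and $\mathcal{C}$ are entangled if for all $x\in\mathcal{H}$, $\Omega_{\mathcal{U}}\cdot x\subset M(x,\mathcal{C})$ and $\Omega_{\mathcal{C}}\cdot x\subset M(x,\mathcal{U})$.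
   Formalization: The Hilbert space is assumed separable; with limit operators defined by sequences, the claim fails on non-separable spaces, e.g. multiplication by exp(its) on the direct sum of L²(μ) over all continuous probability measures μ on the line. *)

theory Defs
  imports "HOL-Analysis.Analysis"
begin

section \<open>Complex Hilbert spaces\<close>

text \<open>
  The norm and the topology come from the underlying real inner product space; the inner product
  is linear in its first argument.
\<close>

class complex_inner = real_inner +
  fixes scaleC :: "complex \<Rightarrow> 'a \<Rightarrow> 'a" (infixr \<open>*\<^sub>C\<close> 75)
    and cinner :: "'a \<Rightarrow> 'a \<Rightarrow> complex"
  assumes scaleC_add_right: "c *\<^sub>C (x + y) = c *\<^sub>C x + c *\<^sub>C y"
    and scaleC_add_left: "(c + d) *\<^sub>C x = c *\<^sub>C x + d *\<^sub>C x"
    and scaleC_scaleC: "c *\<^sub>C d *\<^sub>C x = (c * d) *\<^sub>C x"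
    and scaleC_of_real: "complex_of_real r *\<^sub>C x = r *\<^sub>R x"
    and cinner_commute: "cinner x y = cnj (cinner y x)"
    and cinner_add_left: "cinner (x + y) z = cinner x z + cinner y z"
    and cinner_scaleC_left: "cinner (c *\<^sub>C x) y = c * cinner x y"
    and inner_eq_Re_cinner: "inner x y = Re (cinner x y)"

class chilbert_space = complex_inner + complete_space

definition csubspace :: "'a::complex_inner set \<Rightarrow> bool" where
  "csubspace S \<longleftrightarrow> 0 \<in> S \<and> (\<forall>x\<in>S. \<forall>y\<in>S. x + y \<in> S) \<and> (\<forall>c. \<forall>x\<in>S. c *\<^sub>C x \<in> S)"

definition closed_cspan :: "'a::complex_inner set \<Rightarrow> 'a set" where
  "closed_cspan X = closure (csubspace hull X)"

definition cortho :: "'a::complex_inner set \<Rightarrow> 'a set" where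
  "cortho S = {x. \<forall>y\<in>S. cinner x y = 0}"

definition cproj :: "'a::complex_inner set \<Rightarrow> 'a \<Rightarrow> 'a" where
  "cproj S x = (THE p. p \<in> S \<and> x - p \<in> cortho S)"

definition bounded_clinear :: "('a::complex_inner \<Rightarrow> 'a) \<Rightarrow> bool" where
  "bounded_clinear A \<longleftrightarrow> bounded_linear A \<and> (\<forall>c x. A (c *\<^sub>C x) = c *\<^sub>C A x)"

definition cadjoint :: "('a::complex_inner \<Rightarrow> 'a) \<Rightarrow> 'a \<Rightarrow> 'a" where
  "cadjoint A = (THE B. \<forall>x y. cinner (A x) y = cinner x (B y))"

definition weak_topology :: "'a::complex_inner topology" where
  "weak_topology = pullback_topology UNIV cinner euclidean"


section \<open>Operators on a closed subspace\<close>

text \<open>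
  A bounded operator \<open>V\<close> on a closed subspace \<open>S\<close> is represented by its extension
  \<open>V P\<^sub>S\<close> to the whole space, where \<open>P\<^sub>S\<close> is the orthogonal projection onto \<open>S\<close>.  Linear
  combinations, products, adjoints and weak limits in \<open>\<L>(S)\<close> are those of the extensions; the
  identity of \<open>\<L>(S)\<close> is \<open>P\<^sub>S\<close>.
\<close>

definition operators_on :: "'a::complex_inner set \<Rightarrow> ('a \<Rightarrow> 'a) set" where
  "operators_on S = {V. bounded_clinear V \<and> range V \<subseteq> S \<and> V \<circ> cproj S = V}"

definition weak_operator_topology :: "'a::complex_inner set \<Rightarrow> ('a \<Rightarrow> 'a) topology" where
  "weak_operator_topology S =
     pullback_topology (operators_on S) (\<lambda>V (x, y). cinner (V x) y) euclidean"

lemma limitin_pullback_topology: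
  "limitin (pullback_topology A f X) g l F \<longleftrightarrow>
     l \<in> A \<and> (\<forall>\<^sub>F i in F. g i \<in> A) \<and> limitin X (f \<circ> g) (f l) F"
proof
  assume L: "limitin (pullback_topology A f X) g l F"
  then have l: "l \<in> A" "f l \<in> topspace X"
    by (auto simp: limitin_def topspace_pullback_topology)
  have "openin (pullback_topology A f X) (f -` topspace X \<inter> A)"
    by (auto simp: openin_pullback_topology)
  with L l have "\<forall>\<^sub>F i in F. g i \<in> f -` topspace X \<inter> A"
    by (auto simp: limitin_def)
  then have "\<forall>\<^sub>F i in F. g i \<in> A" by (rule eventually_mono) auto
  moreover have "limitin X (f \<circ> g) (f l) F"
    unfolding limitin_def
  proof (intro conjI allI impI l)
    fix U assume "openin X U \<and> f l \<in> U"
    then have "openin (pullback_topology A f X) (f -` U \<inter> A)" "l \<in> f -` U \<inter> A"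
      using l by (auto simp: openin_pullback_topology)
    with L have "\<forall>\<^sub>F i in F. g i \<in> f -` U \<inter> A" by (auto simp: limitin_def)
    then show "\<forall>\<^sub>F i in F. (f \<circ> g) i \<in> U" by (rule eventually_mono) auto
  qed
  ultimately show "l \<in> A \<and> (\<forall>\<^sub>F i in F. g i \<in> A) \<and> limitin X (f \<circ> g) (f l) F" using l by auto
next
  assume R: "l \<in> A \<and> (\<forall>\<^sub>F i in F. g i \<in> A) \<and> limitin X (f \<circ> g) (f l) F"
  show "limitin (pullback_topology A f X) g l F"
    unfolding limitin_def
  proof (intro conjI allI impI)
    show "l \<in> topspace (pullback_topology A f X)"
      using R by (auto simp: limitin_def topspace_pullback_topology)
  next
    fix U assume "openin (pullback_topology A f X) U \<and> l \<in> U"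
    then obtain W where W: "openin X W" "U = f -` W \<inter> A" "f l \<in> W"
      by (auto simp: openin_pullback_topology)
    with R have "\<forall>\<^sub>F i in F. (f \<circ> g) i \<in> W" by (auto simp: limitin_def)
    with R have "\<forall>\<^sub>F i in F. g i \<in> A \<and> (f \<circ> g) i \<in> W" by (auto intro: eventually_conj)
    then show "\<forall>\<^sub>F i in F. g i \<in> U" by (rule eventually_mono) (auto simp: W)
  qed
qed

lemma limitin_euclidean_fun:
  fixes f :: "'i \<Rightarrow> 'b \<Rightarrow> 'c::topological_space"
  shows "limitin euclidean f l F \<longleftrightarrow> (\<forall>x. ((\<lambda>i. f i x) \<longlongrightarrow> l x) F)"
  unfolding euclidean_product_topology[symmetric] limitin_componentwise
  by simp

lemma limitin_weak_topology:
  "limitin weak_topology f l F \<longleftrightarrow> (\<forall>y. ((\<lambda>i. cinner (f i) y) \<longlongrightarrow> cinner l y) F)"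
  by (simp add: weak_topology_def limitin_pullback_topology limitin_euclidean_fun
      del: limitin_canonical_iff)

lemma limitin_weak_operator_topology:
  "limitin (weak_operator_topology S) A V F \<longleftrightarrow>
     V \<in> operators_on S \<and> (\<forall>\<^sub>F i in F. A i \<in> operators_on S) \<and>
     (\<forall>x y. ((\<lambda>i. cinner (A i x) y) \<longlongrightarrow> cinner (V x) y) F)"
  by (simp add: weak_operator_topology_def limitin_pullback_topology limitin_euclidean_fun
      del: limitin_canonical_iff)

text \<open>Subalgebras of \<open>\<L>(S)\<close> are not required to contain its identity.\<close>

definition star_subalgebra :: "'a::complex_inner set \<Rightarrow> ('a \<Rightarrow> 'a) set \<Rightarrow> bool" where
  "star_subalgebra S M \<longleftrightarrow>
     M \<subseteq> operators_on S \<and> (\<lambda>x. 0) \<in> M \<and>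
     (\<forall>A\<in>M. \<forall>B\<in>M. (\<lambda>x. A x + B x) \<in> M) \<and>
     (\<forall>c. \<forall>A\<in>M. (\<lambda>x. c *\<^sub>C A x) \<in> M) \<and>
     (\<forall>A\<in>M. \<forall>B\<in>M. A \<circ> B \<in> M) \<and>
     (\<forall>A\<in>M. cadjoint A \<in> M)"

definition limit_algebra :: "'a::complex_inner set \<Rightarrow> ('a \<Rightarrow> 'a) set \<Rightarrow> ('a \<Rightarrow> 'a) set" where
  "limit_algebra S \<Omega> =
     (\<lambda>M. star_subalgebra S M \<and> closedin (weak_operator_topology S) M) hull \<Omega>"

text \<open>
  \<open>limit_operators S W\<close> is \<open>\<Omega>\<close> for a family \<open>W\<close> of operators on \<open>S\<close>, indexed by \<^typ>\<open>real\<close> for a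
  one-parameter group and by \<^typ>\<open>int\<close> for the powers of a unitary operator.
\<close>

definition limit_operators ::
    "'a::complex_inner set \<Rightarrow> ('i::linorder \<Rightarrow> 'a \<Rightarrow> 'a) \<Rightarrow> ('a \<Rightarrow> 'a) set" where
  "limit_operators S W =
     {V. \<exists>t::nat \<Rightarrow> 'i. incseq t \<and> filterlim t at_top sequentially \<and>
           limitin (weak_operator_topology S) (\<lambda>k. W (t k)) V sequentially}"

definition limit_orbit :: "('a \<Rightarrow> 'a) set \<Rightarrow> 'a::complex_inner \<Rightarrow> 'a set" where
  "limit_orbit \<Omega> x = {V x | V. V \<in> \<Omega>}"

definition limit_subspace :: "('a \<Rightarrow> 'a) set \<Rightarrow> 'a::complex_inner \<Rightarrow> 'a set" where
  "limit_subspace \<Omega> x = closed_cspan (limit_orbit \<Omega> x)"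

definition entangled :: "('a::complex_inner \<Rightarrow> 'a) set \<Rightarrow> ('a \<Rightarrow> 'a) set \<Rightarrow> bool" where
  "entangled \<Omega> \<Omega>' \<longleftrightarrow>
     (\<forall>x. limit_orbit \<Omega> x \<subseteq> limit_subspace \<Omega>' x \<and> limit_orbit \<Omega>' x \<subseteq> limit_subspace \<Omega> x)"


section \<open>Contraction semigroups and cogenerators\<close>

text \<open>A semigroup is a function on all of \<^typ>\<open>real\<close>; only its values at \<open>t \<ge> 0\<close> matter.\<close>

definition C0_contraction_semigroup :: "(real \<Rightarrow> 'a::complex_inner \<Rightarrow> 'a) \<Rightarrow> bool" where
  "C0_contraction_semigroup T \<longleftrightarrow>
     (\<forall>t\<ge>0. bounded_clinear (T t) \<and> (\<forall>x. norm (T t x) \<le> norm x)) \<and>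
     T 0 = id \<and>
     (\<forall>s\<ge>0. \<forall>t\<ge>0. T (s + t) = T s \<circ> T t) \<and>
     (\<forall>x. ((\<lambda>t. T t x) \<longlongrightarrow> x) (at_right 0))"

definition generator_domain :: "(real \<Rightarrow> 'a::complex_inner \<Rightarrow> 'a) \<Rightarrow> 'a set" where
  "generator_domain T = {x. \<exists>y. ((\<lambda>h. (T h x - x) /\<^sub>R h) \<longlongrightarrow> y) (at_right 0)}"

definition generator :: "(real \<Rightarrow> 'a::complex_inner \<Rightarrow> 'a) \<Rightarrow> 'a \<Rightarrow> 'a" where
  "generator T x = Lim (at_right 0) (\<lambda>h. (T h x - x) /\<^sub>R h)"

definition cogenerator :: "(real \<Rightarrow> 'a::complex_inner \<Rightarrow> 'a) \<Rightarrow> 'a \<Rightarrow> 'a" where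
  "cogenerator T =
     (\<lambda>y. generator T y + y) \<circ> inv_into (generator_domain T) (\<lambda>y. generator T y - y)"

definition flight_vector :: "(real \<Rightarrow> 'a::complex_inner \<Rightarrow> 'a) \<Rightarrow> 'a \<Rightarrow> bool" where
  "flight_vector T x \<longleftrightarrow> 0 \<in> weak_topology closure_of {T t x | t. t \<ge> 0}"

definition weakly_stable_semigroup :: "(real \<Rightarrow> 'a::complex_inner \<Rightarrow> 'a) \<Rightarrow> 'a set" where
  "weakly_stable_semigroup T = {x. limitin weak_topology (\<lambda>t. T t x) 0 at_top}"

definition weakly_stable_powers :: "('a::complex_inner \<Rightarrow> 'a) \<Rightarrow> 'a set" where
  "weakly_stable_powers A = {x. limitin weak_topology (\<lambda>n. (A ^^ n) x) 0 sequentially}"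


section \<open>Unitary parts\<close>

definition reduces :: "'a::complex_inner set \<Rightarrow> ('a \<Rightarrow> 'a) \<Rightarrow> bool" where
  "reduces S A \<longleftrightarrow> A ` S \<subseteq> S \<and> A ` cortho S \<subseteq> cortho S"

definition unitary_on :: "'a::complex_inner set \<Rightarrow> ('a \<Rightarrow> 'a) \<Rightarrow> bool" where
  "unitary_on S A \<longleftrightarrow> A ` S = S \<and> (\<forall>x\<in>S. \<forall>y\<in>S. cinner (A x) (A y) = cinner x y)"

definition unitary_subspace :: "(real \<Rightarrow> 'a::complex_inner \<Rightarrow> 'a) \<Rightarrow> 'a set" where
  "unitary_subspace T =
     (GREATEST S. csubspace S \<and> closed S \<and> (\<forall>t\<ge>0. reduces S (T t) \<and> unitary_on S (T t)))"

definition unitary_group :: "(real \<Rightarrow> 'a::complex_inner \<Rightarrow> 'a) \<Rightarrow> real \<Rightarrow> 'a \<Rightarrow> 'a" where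
  "unitary_group T t =
     (let P = cproj (unitary_subspace T)
      in if t \<ge> 0 then T t \<circ> P else cadjoint (T (- t) \<circ> P))"

definition unitary_powers :: "(real \<Rightarrow> 'a::complex_inner \<Rightarrow> 'a) \<Rightarrow> int \<Rightarrow> 'a \<Rightarrow> 'a" where
  "unitary_powers T n =
     (let P = cproj (unitary_subspace T)
      in if n \<ge> 0 then (cogenerator T ^^ nat n) \<circ> P
         else cadjoint ((cogenerator T ^^ nat (- n)) \<circ> P))"

definition \<Omega>\<^sub>U :: "(real \<Rightarrow> 'a::complex_inner \<Rightarrow> 'a) \<Rightarrow> ('a \<Rightarrow> 'a) set" where
  "\<Omega>\<^sub>U T = limit_operators (unitary_subspace T) (unitary_group T)"

definition \<Omega>\<^sub>C :: "(real \<Rightarrow> 'a::complex_inner \<Rightarrow> 'a) \<Rightarrow> ('a \<Rightarrow> 'a) set" where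
  "\<Omega>\<^sub>C T = limit_operators (unitary_subspace T) (unitary_powers T)"

end

theory Submission
  imports Defs "HOL-Library.Diagonal_Subsequence"
begin

text \<open>
  Both equivalences are reduced to a single condition: the limit operators of the unitary group and
  those of the powers of its cogenerator have the same common kernel.

  Weak stability is expressed by this kernel.  The semigroup and the powers of the cogenerator are
  commutative families of contractions with the same unitary part: a vector is isometric for all
  \<open>T\<^sub>t\<close> iff it is isometric for all powers of the cogenerator (\<open>isometric_iff\<close>), and the adjoint
  semigroup has the adjoint cogenerator (\<open>cogenerator_adjoint\<close>).  By Foguel's argument a weak cluster
  point of an orbit at infinity lies in the unitary part (\<open>weak_cluster_point_in_U\<close>).  Since the unit
  ball of operators on a separable space is weakly sequentially compact, a vector is weakly stable iff
  every limit operator kills it (\<open>K_iff_weakly_stable\<close>).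

  The limit operators form a set of commuting normal operators which is stable under multiplication
  by the family and its adjoints.  Hence the common kernel \<open>K\<close> is also the kernel of the limit algebra
  (\<open>limit_algebra_vanishes_on_K\<close>), and the limit algebra is a module over the family
  (\<open>W_mult_limit_algebra\<close>).  Its unit is the projection onto the orthogonal complement of \<open>K\<close>
  (\<open>limit_algebra_unit\<close>): if \<open>L\<^sub>k\<close> are countably many limit operators with common kernel \<open>K\<close> and
  \<open>A = \<Sum> 2\<^sup>-\<^sup>k\<^sup>-\<^sup>1 L\<^sub>k\<^sup>* L\<^sub>k\<close>, then \<open>1 - (1 - A)\<^sup>2\<^sup>n\<close> converges strongly to it.

  The semigroup and its cogenerator generate the same strongly closed algebra.  The resolvent at \<open>1\<close>,
  and with it the cogenerator, is a strong limit of linear combinations of the \<open>T\<^sub>t\<close>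
  (\<open>cogenerator_in_algebra\<close>).  All resolvents are power series in the cogenerator, and \<open>T\<^sub>t\<close> is the
  strong limit of \<open>(1 - (t/n) G)\<^sup>-\<^sup>n\<close> (\<open>semigroup_in_algebra\<close>).  So each limit algebra is a module over
  both families.  If the kernels agree, a limit operator \<open>L\<close> of one family is
  the weak limit of \<open>W\<^sub>t E\<close>, where \<open>E\<close> is the unit of the limit algebra of the other, so it belongs to
  that algebra; similarly the two families have the same cyclic subspaces \<open>M(x, _)\<close>.  Conversely, the
  limit algebra and the subspaces \<open>M(x, _)\<close> determine the kernel.
\<close>

section \<open>Complex Hilbert spaces\<close>

instance chilbert_space \<subseteq> banach ..

lemma cinner_add_right: "cinner x (y + z) = cinner x y + cinner x z"
  by (metis cinner_add_left cinner_commute complex_cnj_add)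

lemma cinner_scaleC_right: "cinner x (c *\<^sub>C y) = cnj c * cinner x y"
  by (metis cinner_scaleC_left cinner_commute complex_cnj_mult)

lemma scaleR_eq_scaleC: "r *\<^sub>R x = complex_of_real r *\<^sub>C (x::'a::complex_inner)"
  by (simp add: scaleC_of_real)

lemma scaleC_zero_right [simp]: "c *\<^sub>C (0::'a::complex_inner) = 0"
  using scaleC_add_right[of c 0 0] by simp

lemma scaleC_minus_one: "(- 1) *\<^sub>C x = - (x::'a::complex_inner)"
  using scaleC_of_real[of "-1" x] by simp

lemma scaleC_minus_right: "c *\<^sub>C (- x) = - (c *\<^sub>C (x::'a::complex_inner))"
  by (metis scaleC_add_right add.right_inverse add_eq_0_iff scaleC_zero_right)

lemma scaleC_diff_right: "c *\<^sub>C (x - y) = c *\<^sub>C x - c *\<^sub>C (y::'a::complex_inner)"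
  using scaleC_add_right[of c x "- y"] by (simp add: scaleC_minus_right)

lemma scaleC_scaleR: "c *\<^sub>C (r *\<^sub>R x) = r *\<^sub>R (c *\<^sub>C (x::'a::complex_inner))"
  by (simp add: scaleR_eq_scaleC scaleC_scaleC mult.commute)

lemma cinner_zero_left [simp]: "cinner 0 y = 0"
  using cinner_scaleC_left[of 0 0 y] by simp

lemma cinner_zero_right [simp]: "cinner x 0 = 0"
  using cinner_scaleC_right[of x 0 0] by simp

lemma cinner_minus_left: "cinner (- x) y = - cinner x y"
  by (metis cinner_scaleC_left mult_minus1 scaleC_minus_one)

lemma cinner_minus_right: "cinner x (- y) = - cinner x y"
  by (metis cinner_commute cinner_minus_left complex_cnj_minus)

lemma cinner_diff_left: "cinner (x - y) z = cinner x z - cinner y z"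
  using cinner_add_left[of x "- y" z] by (simp add: cinner_minus_left)

lemma cinner_diff_right: "cinner z (x - y) = cinner z x - cinner z y"
  using cinner_add_right[of z x "- y"] by (simp add: cinner_minus_right)

lemma cinner_scaleR_left: "cinner (r *\<^sub>R x) y = r *\<^sub>R cinner x y"
  by (simp add: scaleR_eq_scaleC cinner_scaleC_left scaleR_conv_of_real)

lemma cinner_scaleR_right: "cinner x (r *\<^sub>R y) = r *\<^sub>R cinner x y"
  by (simp add: scaleR_eq_scaleC cinner_scaleC_right scaleR_conv_of_real)

lemmas cinner_simps = cinner_add_left cinner_add_right cinner_diff_left cinner_diff_right
  cinner_scaleC_left cinner_scaleC_right cinner_scaleR_left cinner_scaleR_right

lemma cinner_self: "cinner x x = complex_of_real ((norm x)\<^sup>2)"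
proof (rule complex_eqI)
  show "Re (cinner x x) = Re (complex_of_real ((norm x)\<^sup>2))"
    by (simp add: inner_eq_Re_cinner[symmetric] power2_norm_eq_inner)
  have "Im (cinner x x) = - Im (cinner x x)"
    by (subst cinner_commute) simp
  then show "Im (cinner x x) = Im (complex_of_real ((norm x)\<^sup>2))" by simp
qed

lemma norm_scaleC: "norm (c *\<^sub>C x) = cmod c * norm (x::'a::complex_inner)"
proof -
  have "cinner (c *\<^sub>C x) (c *\<^sub>C x) = (c * cnj c) * cinner x x"
    by (simp add: cinner_scaleC_left cinner_scaleC_right)
  then have "complex_of_real ((norm (c *\<^sub>C x))\<^sup>2) = complex_of_real ((cmod c)\<^sup>2 * (norm x)\<^sup>2)"
    unfolding cinner_self complex_norm_square[symmetric] by (simp only: of_real_mult)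
  then have "(norm (c *\<^sub>C x))\<^sup>2 = (cmod c * norm x)\<^sup>2"
    unfolding of_real_eq_iff by (simp only: power_mult_distrib)
  then show ?thesis by (simp add: power2_eq_iff_nonneg)
qed

lemma norm_cinner_le: "cmod (cinner x y) \<le> norm x * norm (y::'a::complex_inner)"
proof (cases "cinner x y = 0")
  case False
  define c where "c = cnj (cinner x y) / cmod (cinner x y)"
  have c: "cmod c = 1" using False by (simp add: c_def norm_divide)
  have "c * cinner x y = complex_of_real (cmod (cinner x y))"
    using False by (simp add: c_def complex_norm_square[symmetric] power2_eq_square mult.commute
        field_simps)
  then have "cmod (cinner x y) = inner (c *\<^sub>C x) y"
    by (simp add: inner_eq_Re_cinner cinner_scaleC_left)
  also have "\<dots> \<le> norm (c *\<^sub>C x) * norm y" by (rule norm_cauchy_schwarz)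
  finally show ?thesis by (simp add: norm_scaleC c)
qed simp

lemma bounded_bilinear_cinner: "bounded_bilinear (cinner :: 'a::complex_inner \<Rightarrow> _)"
  by unfold_locales
    (auto simp: cinner_simps intro!: exI[of _ 1] norm_cinner_le)

lemmas tendsto_cinner = bounded_bilinear.tendsto[OF bounded_bilinear_cinner]

lemma tendsto_scaleC: "(f \<longlongrightarrow> x) F \<Longrightarrow> ((\<lambda>i. c *\<^sub>C f i) \<longlongrightarrow> c *\<^sub>C (x::'a::complex_inner)) F"
proof -
  have "bounded_linear (\<lambda>x. c *\<^sub>C (x::'a))"
    by (rule bounded_linear_intro[of _ "cmod c"])
      (auto simp: scaleC_add_right scaleC_scaleR norm_scaleC mult.commute)
  then show "(f \<longlongrightarrow> x) F \<Longrightarrow> ((\<lambda>i. c *\<^sub>C f i) \<longlongrightarrow> c *\<^sub>C x) F"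
    by (rule bounded_linear.tendsto)
qed

lemma cinner_eqI: "(\<And>z. cinner x z = cinner y z) \<Longrightarrow> x = y"
  using cinner_self[of "x - y"] by (simp add: cinner_diff_left)

lemma cinner_eq_zeroI: "(\<And>z. cinner x z = 0) \<Longrightarrow> x = 0"
  by (rule cinner_eqI) simp

lemma norm_add_sqr: "(norm (x + y))\<^sup>2 = (norm x)\<^sup>2 + 2 * Re (cinner x y) + (norm (y::'a::complex_inner))\<^sup>2"
  by (simp add: inner_eq_Re_cinner[symmetric] power2_norm_eq_inner inner_add_left inner_add_right
      inner_commute)

lemma norm_diff_sqr: "(norm (x - y))\<^sup>2 = (norm x)\<^sup>2 - 2 * Re (cinner x y) + (norm (y::'a::complex_inner))\<^sup>2"
  by (simp add: inner_eq_Re_cinner[symmetric] power2_norm_eq_inner inner_diff_left inner_diff_right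
      inner_commute)

section \<open>Closed subspaces and orthogonal projections\<close>

lemma csubspace_0: "csubspace S \<Longrightarrow> 0 \<in> S"
  and csubspace_add: "csubspace S \<Longrightarrow> x \<in> S \<Longrightarrow> y \<in> S \<Longrightarrow> x + y \<in> S"
  and csubspace_scaleC: "csubspace S \<Longrightarrow> x \<in> S \<Longrightarrow> c *\<^sub>C x \<in> S"
  by (auto simp: csubspace_def)

lemma csubspace_scaleR: "csubspace S \<Longrightarrow> x \<in> S \<Longrightarrow> r *\<^sub>R x \<in> S"
  by (simp add: scaleR_eq_scaleC csubspace_scaleC)

lemma csubspace_diff: "csubspace S \<Longrightarrow> x \<in> S \<Longrightarrow> y \<in> S \<Longrightarrow> x - y \<in> S"
  using csubspace_add[of S x "(-1) *\<^sub>C y"] csubspace_scaleC[of S y "-1"]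
  by (simp add: scaleC_minus_one)

lemma csubspace_cortho: "csubspace (cortho S)"
  by (auto simp: csubspace_def cortho_def cinner_simps)

lemma closest_point_exists:
  fixes S :: "'a::chilbert_space set"
  assumes S: "csubspace S" "closed S"
  shows "\<exists>p\<in>S. \<forall>q\<in>S. norm (x - p) \<le> norm (x - q)"
proof -
  define d where "d = infdist x S"
  have ne: "S \<noteq> {}" using csubspace_0[OF S(1)] by auto
  have d0: "d \<ge> 0" by (simp add: d_def infdist_nonneg)
  have dle: "d \<le> norm (x - q)" if "q \<in> S" for q
    using infdist_le[OF that, of x] by (simp add: d_def dist_norm)
  have "\<exists>q\<in>S. norm (x - q) < d + 1 / Suc n" for n
  proof (rule ccontr)
    assume "\<not> (\<exists>q\<in>S. norm (x - q) < d + 1 / Suc n)"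
    then have "d + 1 / Suc n \<le> infdist x S"
      unfolding infdist_notempty[OF ne] by (intro cINF_greatest ne) (auto simp: dist_norm not_less)
    then show False by (simp add: d_def field_simps)
  qed
  then obtain q where q: "\<And>n. q n \<in> S" "\<And>n. norm (x - q n) < d + 1 / Suc n" by metis
  have lim: "(\<lambda>n. norm (x - q n)) \<longlonglongrightarrow> d"
  proof (rule tendsto_sandwich[of "\<lambda>_. d" _ _ "\<lambda>n. d + 1 / Suc n"])
    show "(\<lambda>n. d + 1 / Suc n) \<longlonglongrightarrow> d"
      using tendsto_add[OF tendsto_const LIMSEQ_Suc[OF lim_1_over_n]] by simp
  qed (use dle q less_imp_le in \<open>auto simp del: of_nat_Suc intro!: eventuallyI less_imp_le\<close>)
  \<comment> \<open>By the parallelogram law, a minimizing sequence is a Cauchy sequence.\<close>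
  have par: "(norm (q m - q n))\<^sup>2 \<le> 2 * (norm (x - q m))\<^sup>2 + 2 * (norm (x - q n))\<^sup>2 - 4 * d\<^sup>2" for m n
  proof -
    let ?h = "(1/2) *\<^sub>R (q m + q n)"
    have "?h \<in> S" by (intro csubspace_scaleR csubspace_add S q)
    then have "d\<^sup>2 \<le> (norm (x - ?h))\<^sup>2" using dle d0 by (intro power_mono) auto
    moreover have "(norm (q m - q n))\<^sup>2 + 4 * (norm (x - ?h))\<^sup>2
        = 2 * (norm (x - q m))\<^sup>2 + 2 * (norm (x - q n))\<^sup>2"
      by (simp add: power2_norm_eq_inner inner_simps inner_commute algebra_simps)
    ultimately show ?thesis by linarith
  qed
  have "Cauchy q"
  proof (rule metric_CauchyI)
    fix e :: real assume e: "e > 0"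
    have "(\<lambda>n. (norm (x - q n))\<^sup>2) \<longlonglongrightarrow> d\<^sup>2" by (intro tendsto_power lim)
    then have "\<forall>\<^sub>F n in sequentially. (norm (x - q n))\<^sup>2 < d\<^sup>2 + e\<^sup>2 / 4"
      using e by (intro order_tendstoD) auto
    then obtain N where N: "\<And>n. n \<ge> N \<Longrightarrow> (norm (x - q n))\<^sup>2 < d\<^sup>2 + e\<^sup>2 / 4"
      by (auto simp: eventually_sequentially)
    show "\<exists>N. \<forall>m\<ge>N. \<forall>n\<ge>N. dist (q m) (q n) < e"
    proof (intro exI allI impI)
      fix m n assume "m \<ge> N" "n \<ge> N"
      then have "(norm (q m - q n))\<^sup>2 < e\<^sup>2" using par[of m n] N[of m] N[of n] by linarith
      then show "dist (q m) (q n) < e" using e by (simp add: dist_norm power2_less_imp_less)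
    qed
  qed
  then obtain p where p: "q \<longlonglongrightarrow> p" by (auto simp: Cauchy_convergent_iff convergent_def)
  have "p \<in> S" using closed_sequentially[OF S(2) _ p] q by blast
  moreover have "(\<lambda>n. norm (x - q n)) \<longlonglongrightarrow> norm (x - p)" by (intro tendsto_intros p)
  then have "norm (x - p) = d" using lim LIMSEQ_unique by blast
  ultimately show ?thesis using dle by auto
qed

lemma orthogonal_decomposition:
  fixes S :: "'a::chilbert_space set"
  assumes S: "csubspace S" "closed S"
  shows "\<exists>p\<in>S. x - p \<in> cortho S"
proof -
  obtain p where p: "p \<in> S" "\<And>q. q \<in> S \<Longrightarrow> norm (x - p) \<le> norm (x - q)"
    using closest_point_exists[OF S] by blast
  have "cinner (x - p) y = 0" if y: "y \<in> S" for y
  proof (cases "y = 0")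
    case False
    define c where "c = cinner (x - p) y / (norm y)\<^sup>2"
    have "p + c *\<^sub>C y \<in> S" by (intro csubspace_add csubspace_scaleC S p y)
    from p(2)[OF this] have "(norm (x - p))\<^sup>2 \<le> (norm ((x - p) - c *\<^sub>C y))\<^sup>2"
      by (intro power_mono) (auto simp: algebra_simps)
    also have "\<dots> = (norm (x - p))\<^sup>2 - 2 * Re (cnj c * cinner (x - p) y) + (cmod c * norm y)\<^sup>2"
      by (simp add: norm_diff_sqr[of "x - p"] cinner_scaleC_right norm_scaleC)
    also have "cinner (x - p) y = c * (norm y)\<^sup>2" using False by (simp add: c_def)
    also have "Re (cnj c * (c * (norm y)\<^sup>2)) = (cmod c)\<^sup>2 * (norm y)\<^sup>2"
      by (metis Re_complex_of_real complex_norm_square mult.commute mult.left_commute of_real_mult)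
    finally have "(cmod c)\<^sup>2 * (norm y)\<^sup>2 \<le> 0" by (simp add: power_mult_distrib mult.commute)
    moreover have "0 < (norm y)\<^sup>2" using False by simp
    ultimately have "(cmod c)\<^sup>2 \<le> 0" using mult_le_0_iff by (metis not_le)
    then have "c = 0" by simp
    then show ?thesis using False by (simp add: c_def)
  qed simp
  then show ?thesis using p(1) by (auto simp: cortho_def)
qed

lemma cproj_eqI:
  assumes S: "csubspace S" and p: "p \<in> S" "x - p \<in> cortho S"
  shows "cproj S x = p"
  unfolding cproj_def
proof (rule the_equality)
  fix q assume q: "q \<in> S \<and> x - q \<in> cortho S"
  have "p - q \<in> S" using csubspace_diff S p q by blast
  moreover have "p - q \<in> cortho S"
    using csubspace_diff[OF csubspace_cortho, of "x - q" S "x - p"] p q by simp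
  ultimately have "cinner (p - q) (p - q) = 0" by (auto simp: cortho_def)
  then show "q = p" by (simp add: cinner_self)
qed (use p in auto)

context
  fixes S :: "'a::chilbert_space set"
  assumes S: "csubspace S" "closed S"
begin

lemma cproj_in: "cproj S x \<in> S" and cproj_ortho: "x - cproj S x \<in> cortho S"
  using orthogonal_decomposition[OF S, of x] cproj_eqI[OF S(1)] by auto

lemma cproj_ident: "x \<in> S \<Longrightarrow> cproj S x = x"
  by (rule cproj_eqI[OF S(1)]) (simp_all add: cortho_def)

lemma cproj_add: "cproj S (x + y) = cproj S x + cproj S y"
proof (rule cproj_eqI[OF S(1)])
  show "cproj S x + cproj S y \<in> S" by (intro csubspace_add S cproj_in)
  show "x + y - (cproj S x + cproj S y) \<in> cortho S"
    using csubspace_add[OF csubspace_cortho cproj_ortho cproj_ortho, of x y]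
    by (simp add: algebra_simps)
qed

lemma cproj_scaleC: "cproj S (c *\<^sub>C x) = c *\<^sub>C cproj S x"
proof (rule cproj_eqI[OF S(1)])
  show "c *\<^sub>C cproj S x \<in> S" by (intro csubspace_scaleC S cproj_in)
  show "c *\<^sub>C x - c *\<^sub>C cproj S x \<in> cortho S"
    using csubspace_scaleC[OF csubspace_cortho cproj_ortho, of c x] by (simp add: scaleC_diff_right)
qed

lemma cinner_cproj_left: "cinner (cproj S x) y = cinner (cproj S x) (cproj S y)"
  using cproj_ortho[of y] cproj_in[of x]
  by (simp add: cortho_def cinner_diff_left cinner_diff_right)
    (metis cinner_commute)

lemma cinner_cproj: "cinner (cproj S x) y = cinner x (cproj S y)"
  by (metis cinner_cproj_left cinner_commute)

lemma norm_cproj_le: "norm (cproj S x) \<le> norm x"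
proof -
  have "(norm (cproj S x))\<^sup>2 = Re (cinner x (cproj S x))"
    by (metis Re_complex_of_real cinner_cproj cinner_self cproj_ident cproj_in)
  also have "\<dots> \<le> norm x * norm (cproj S x)"
    using complex_Re_le_cmod norm_cinner_le order_trans by blast
  finally show ?thesis
    by (metis mult_right_le_imp_le norm_ge_zero not_le order_le_less power2_eq_square)
qed

end

section \<open>Bounded operators and adjoints\<close>

lemma bclinI:
  assumes "\<And>x y. A (x + y) = A x + A y" "\<And>c x. A (c *\<^sub>C x) = c *\<^sub>C A x"
    "\<And>x. norm (A x) \<le> norm x * K"
  shows "bounded_clinear A"
  unfolding bounded_clinear_def
  using assms by (auto intro!: bounded_linear_intro[of _ K] simp: scaleR_eq_scaleC)

lemma bclin_cproj:
  "csubspace S \<Longrightarrow> closed S \<Longrightarrow> bounded_clinear (cproj (S::'a::chilbert_space set))"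
  by (rule bclinI[where K = 1]) (auto simp: cproj_add cproj_scaleC norm_cproj_le)

lemma bclin_D:
  assumes "bounded_clinear A"
  shows "bounded_linear A" "A (x + y) = A x + A y" "A (x - y) = A x - A y"
    "A (c *\<^sub>C x) = c *\<^sub>C A x" "A (r *\<^sub>R x) = r *\<^sub>R A x" "A 0 = 0"
  using assms unfolding bounded_clinear_def
  by (auto simp: linear_simps bounded_linear.linear)

lemma bclin_ident: "bounded_clinear (\<lambda>x. x)" and bclin_id: "bounded_clinear id"
  and bclin_zero: "bounded_clinear (\<lambda>x. 0)"
  by (auto intro!: bclinI[where K = 1])

lemma bclin_compose:
  "bounded_clinear A \<Longrightarrow> bounded_clinear B \<Longrightarrow> bounded_clinear (A \<circ> B)"
  unfolding bounded_clinear_def by (auto simp: o_def intro: bounded_linear_compose)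

lemma bclin_funpow: "bounded_clinear A \<Longrightarrow> bounded_clinear (A ^^ n)"
proof (induction n)
  case (Suc n)
  then show ?case unfolding funpow.simps by (blast intro: bclin_compose)
qed (simp only: funpow.simps bclin_id)

lemma norm_funpow_le:
  fixes A :: "'a::real_normed_vector \<Rightarrow> 'a"
  shows "(\<And>x. norm (A x) \<le> norm x) \<Longrightarrow> norm ((A ^^ n) x) \<le> norm x"
  by (induction n) (auto intro: order_trans)

lemma bclin_add:
  "bounded_clinear A \<Longrightarrow> bounded_clinear B \<Longrightarrow> bounded_clinear (\<lambda>x. A x + B x)"
  unfolding bounded_clinear_def by (auto simp: scaleC_add_right intro: bounded_linear_add)

lemma bclin_diff:
  "bounded_clinear A \<Longrightarrow> bounded_clinear B \<Longrightarrow> bounded_clinear (\<lambda>x. A x - B x)"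
  unfolding bounded_clinear_def by (auto simp: scaleC_diff_right intro: bounded_linear_sub)

lemma bclin_scaleC:
  assumes "bounded_clinear A" shows "bounded_clinear (\<lambda>x. c *\<^sub>C A x)"
proof -
  obtain K where K: "\<And>x. norm (A x) \<le> norm x * K"
    using assms bounded_linear.bounded unfolding bounded_clinear_def by blast
  have "norm (c *\<^sub>C A x) \<le> norm x * (cmod c * K)" for x
    using mult_left_mono[OF K[of x], of "cmod c"] by (simp add: norm_scaleC mult_ac)
  then show ?thesis using bclin_D[OF assms]
    by (intro bclinI[where K = "cmod c * K"])
      (simp_all add: scaleC_add_right scaleC_scaleC mult.commute)
qed

lemma riesz_representation:
  fixes f :: "'a::chilbert_space \<Rightarrow> complex"
  assumes f: "bounded_linear f" "\<And>c x. f (c *\<^sub>C x) = c * f x"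
  shows "\<exists>z. \<forall>x. f x = cinner x z"
proof (cases "\<forall>x. f x = 0")
  case True then show ?thesis by (intro exI[of _ 0]) simp
next
  case False
  then obtain u where u: "f u \<noteq> 0" by blast
  interpret bounded_linear f by fact
  define K where "K = {x. f x = 0}"
  have K: "csubspace K" "closed K"
    using closed_Collect_eq[of f "\<lambda>_. 0"] continuous_on by (auto simp: K_def csubspace_def zero add f(2)
        intro!: closed_Collect_eq linear_continuous_on f(1))
  define w where "w = u - cproj K u"
  have w: "w \<in> cortho K" by (simp add: w_def cproj_ortho K)
  have fw: "f w \<noteq> 0" using u cproj_in[OF K, of u] by (simp add: w_def diff K_def)
  then have w0: "w \<noteq> 0" using zero by auto
  have "f x = cinner x (cnj (f w / (norm w)\<^sup>2) *\<^sub>C w)" for x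
  proof -
    have "x - (f x / f w) *\<^sub>C w \<in> K" using fw by (simp add: K_def diff f(2))
    then have "cinner w (x - (f x / f w) *\<^sub>C w) = 0" using w by (auto simp: cortho_def)
    then have "cinner (x - (f x / f w) *\<^sub>C w) w = 0" by (metis cinner_commute complex_cnj_zero)
    then have "cinner x w = f x / f w * (norm w)\<^sup>2" by (simp add: cinner_simps cinner_self)
    then show ?thesis using fw w0 by (simp add: cinner_scaleC_right)
  qed
  then show ?thesis by blast
qed

text \<open>A bounded sesquilinear form is given by a bounded operator.\<close>

lemma operator_of_sesquilinear:
  fixes b :: "'a::chilbert_space \<Rightarrow> 'a \<Rightarrow> complex"
  assumes add1: "\<And>x x' y. b (x + x') y = b x y + b x' y" and sc1: "\<And>c x y. b (c *\<^sub>C x) y = c * b x y"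
    and add2: "\<And>x y y'. b x (y + y') = b x y + b x y'" and sc2: "\<And>c x y. b x (c *\<^sub>C y) = cnj c * b x y"
    and bd: "\<And>x y. cmod (b x y) \<le> norm x * K * norm y" and K: "K \<ge> 0"
  shows "\<exists>B. bounded_clinear B \<and> (\<forall>x. norm (B x) \<le> norm x * K) \<and> (\<forall>x y. cinner (B x) y = b x y)"
proof -
  have "\<exists>z. \<forall>y. cnj (b x y) = cinner y z" for x
  proof (rule riesz_representation)
    show "bounded_linear (\<lambda>y. cnj (b x y))"
      by (rule bounded_linear_intro[of _ "norm x * K"])
        (use bd[of x] in \<open>simp_all add: add2 sc2 scaleR_eq_scaleC scaleR_conv_of_real mult.commute\<close>)
  qed (simp add: sc2)
  then obtain B where B': "\<And>x y. cnj (b x y) = cinner y (B x)" by metis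
  have B: "cinner (B x) y = b x y" for x y by (metis B' cinner_commute complex_cnj_cnj)
  have nB: "norm (B x) \<le> norm x * K" for x
  proof -
    have "(norm (B x))\<^sup>2 = cmod (b x (B x))" by (simp add: B[symmetric] cinner_self norm_power)
    also have "\<dots> \<le> norm x * K * norm (B x)" by (rule bd)
    finally show ?thesis
      by (metis K mult_nonneg_nonneg mult_right_le_imp_le norm_ge_zero order_le_less power2_eq_square)
  qed
  have "B (x + x') = B x + B x'" for x x'
    by (rule cinner_eqI) (simp add: B add1 cinner_add_left)
  moreover have "B (c *\<^sub>C x) = c *\<^sub>C B x" for c x
    by (rule cinner_eqI) (simp add: B sc1 cinner_scaleC_left)
  ultimately have "bounded_clinear B" by (intro bclinI[where K = K] nB)
  then show ?thesis using B nB by blast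
qed

lemma bclin_pos_bound:
  assumes "bounded_clinear A" obtains K where "K > 0" "\<And>x. norm (A x) \<le> norm x * K"
  by (meson assms bounded_linear.pos_bounded bounded_clinear_def)

lemma cadjoint_exists:
  fixes A :: "'a::chilbert_space \<Rightarrow> 'a"
  assumes A: "bounded_clinear A"
  shows "\<exists>B. bounded_clinear B \<and> (\<forall>x y. cinner (A x) y = cinner x (B y))"
proof -
  obtain K where K: "K > 0" "\<And>x. norm (A x) \<le> norm x * K" using bclin_pos_bound[OF A] by blast
  have bd: "cmod (cinner y (A x)) \<le> norm y * K * norm x" for x y
    using norm_cinner_le[of y "A x"] mult_left_mono[OF K(2)[of x], of "norm y"]
    by (simp add: mult_ac)
  obtain B where B: "bounded_clinear B" "\<And>x y. cinner (B y) x = cinner y (A x)"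
    using operator_of_sesquilinear[of "\<lambda>y x. cinner y (A x)" K] K(1) bd
    by (auto simp: cinner_simps bclin_D[OF A])
  then show ?thesis by (metis cinner_commute)
qed

lemma cadjoint_eqI:
  assumes "\<And>x y. cinner (A x) y = cinner x (B y)" shows "cadjoint A = B"
  unfolding cadjoint_def
proof (rule the_equality)
  fix B' assume "\<forall>x y. cinner (A x) y = cinner x (B' y)"
  then show "B' = B" using assms by (intro ext cinner_eqI) (metis cinner_commute)
qed (use assms in auto)

context
  fixes A :: "'a::chilbert_space \<Rightarrow> 'a"
  assumes A: "bounded_clinear A"
begin

lemma bclin_cadjoint: "bounded_clinear (cadjoint A)"
  and cinner_cadjoint_right: "cinner x (cadjoint A y) = cinner (A x) y"
  using cadjoint_exists[OF A] cadjoint_eqI by metis+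

lemma cinner_cadjoint_left: "cinner (cadjoint A x) y = cinner x (A y)"
  by (metis cinner_cadjoint_right cinner_commute)

lemma cadjoint_cadjoint: "cadjoint (cadjoint A) = A"
  by (rule cadjoint_eqI) (rule cinner_cadjoint_left)

lemma norm_cadjoint_le:
  assumes "\<And>x. norm (A x) \<le> norm x" shows "norm (cadjoint A x) \<le> norm x"
proof -
  have "(norm (cadjoint A x))\<^sup>2 = cmod (cinner x (A (cadjoint A x)))"
    by (simp add: cinner_cadjoint_left[symmetric] cinner_self norm_power)
  also have "\<dots> \<le> norm x * norm (cadjoint A x)"
    using norm_cinner_le assms by (meson mult_left_mono norm_ge_zero order_trans)
  finally show ?thesis
    by (metis mult_right_le_imp_le norm_ge_zero order_le_less power2_eq_square)
qed

end

lemma cadjoint_compose: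
  fixes A :: "'a::chilbert_space \<Rightarrow> 'a"
  shows "bounded_clinear A \<Longrightarrow> bounded_clinear B \<Longrightarrow> cadjoint (A \<circ> B) = cadjoint B \<circ> cadjoint A"
  by (rule cadjoint_eqI) (simp add: cinner_cadjoint_right)

lemma cortho_cortho_subset:
  fixes S :: "'a::chilbert_space set"
  assumes S: "csubspace S" "closed S" and x: "\<And>y. y \<in> cortho S \<Longrightarrow> cinner x y = 0"
  shows "x \<in> S"
proof -
  have "x - cproj S x \<in> cortho S" by (rule cproj_ortho[OF S])
  then have "cinner x (x - cproj S x) = 0" "cinner (x - cproj S x) (cproj S x) = 0"
    using x cproj_in[OF S] by (auto simp: cortho_def)
  then have "cinner (x - cproj S x) (x - cproj S x) = 0"
    by (metis cinner_cproj[OF S] cinner_diff_left cinner_diff_right cproj_ident[OF S] cproj_in[OF S]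
        diff_self)
  then have "x = cproj S x" by (simp add: cinner_self)
  then show ?thesis using cproj_in[OF S] by metis
qed

lemma csubspace_hull: "csubspace (csubspace hull X)"
  by (rule hull_in) (auto simp: csubspace_def)

lemma csubspace_closure:
  assumes "csubspace (S::'a::complex_inner set)" shows "csubspace (closure S)"
  unfolding csubspace_def
proof (intro conjI ballI allI)
  show "0 \<in> closure S" using assms csubspace_0 closure_subset by blast
next
  fix x y assume "x \<in> closure S" "y \<in> closure S"
  then obtain f g where "\<And>n. f n \<in> S" "f \<longlonglongrightarrow> x" "\<And>n. g n \<in> S" "g \<longlonglongrightarrow> y"
    unfolding closure_sequential by blast
  then show "x + y \<in> closure S" unfolding closure_sequential
    by (intro exI[of _ "\<lambda>n. f n + g n"]) (auto intro: tendsto_add csubspace_add[OF assms])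
next
  fix c x assume "x \<in> closure S"
  then obtain f where "\<And>n. f n \<in> S" "f \<longlonglongrightarrow> x" unfolding closure_sequential by blast
  then show "c *\<^sub>C x \<in> closure S" unfolding closure_sequential
    by (intro exI[of _ "\<lambda>n. c *\<^sub>C f n"]) (auto intro: tendsto_scaleC csubspace_scaleC[OF assms])
qed

lemma csubspace_closed_cspan: "csubspace (closed_cspan X)"
  and closed_closed_cspan: "closed (closed_cspan X)"
  by (simp_all add: closed_cspan_def csubspace_closure csubspace_hull)

lemma closed_cspan_superset: "X \<subseteq> closed_cspan X"
  unfolding closed_cspan_def by (meson closure_subset hull_subset subset_trans)

lemma closed_cspan_minimal: "X \<subseteq> S \<Longrightarrow> csubspace S \<Longrightarrow> closed S \<Longrightarrow> closed_cspan X \<subseteq> S"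
  unfolding closed_cspan_def by (meson closure_minimal hull_minimal)

lemma csubspace_vimage: "bounded_clinear A \<Longrightarrow> csubspace S \<Longrightarrow> csubspace (A -` S)"
  by (simp add: csubspace_def bclin_D)

lemma closed_vimage_bclin: "bounded_clinear A \<Longrightarrow> closed S \<Longrightarrow> closed (A -` S)"
  by (intro closed_vimage) (auto simp: bounded_clinear_def linear_continuous_on)

lemma closed_cspan_image_subset:
  assumes "bounded_clinear A" "csubspace S" "closed S" "A ` X \<subseteq> S"
  shows "A ` closed_cspan X \<subseteq> S"
  using closed_cspan_minimal[of X "A -` S"] csubspace_vimage closed_vimage_bclin assms by blast

lemma csubspace_kernel: "bounded_clinear A \<Longrightarrow> csubspace {x. A x = 0}"
  by (auto simp: csubspace_def bclin_D)

lemma closed_kernel: "bounded_clinear A \<Longrightarrow> closed {x. A x = 0}"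
  using closed_vimage_bclin[of A "{0}"] by (simp add: vimage_def)

lemma tendsto_bclin:
  "bounded_clinear A \<Longrightarrow> (f \<longlongrightarrow> x) F \<Longrightarrow> ((\<lambda>i. A (f i)) \<longlongrightarrow> A x) F"
  by (simp add: bounded_clinear_def bounded_linear.tendsto)

lemma contraction_isometric_iff:
  fixes A :: "'a::chilbert_space \<Rightarrow> 'a"
  assumes A: "bounded_clinear A" "\<And>x. norm (A x) \<le> norm x"
  shows "norm (A x) = norm x \<longleftrightarrow> cadjoint A (A x) = x"
proof
  assume n: "norm (A x) = norm x"
  have "Re (cinner (cadjoint A (A x)) x) = (norm x)\<^sup>2"
    by (simp add: cinner_cadjoint_left[OF A(1)] cinner_self n)
  moreover have "(norm (cadjoint A (A x)))\<^sup>2 \<le> (norm x)\<^sup>2"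
    using norm_cadjoint_le[OF A] n by (metis norm_ge_zero power_mono)
  ultimately have "(norm (cadjoint A (A x) - x))\<^sup>2 \<le> 0" unfolding norm_diff_sqr by linarith
  then show "cadjoint A (A x) = x" by simp
next
  assume "cadjoint A (A x) = x"
  then have "cinner (A x) (A x) = cinner x x" by (metis cinner_cadjoint_left[OF A(1)])
  then have "(norm (A x))\<^sup>2 = (norm x)\<^sup>2" unfolding cinner_self of_real_eq_iff .
  then show "norm (A x) = norm x" by (simp add: power2_eq_iff_nonneg)
qed

lemma isometric_subspace:
  fixes A :: "'i \<Rightarrow> 'a::chilbert_space \<Rightarrow> 'a"
  assumes A: "\<And>i. i \<in> J \<Longrightarrow> bounded_clinear (A i)" "\<And>i x. i \<in> J \<Longrightarrow> norm (A i x) \<le> norm x"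
  shows "csubspace {x. \<forall>i\<in>J. norm (A i x) = norm x}" "closed {x. \<forall>i\<in>J. norm (A i x) = norm x}"
proof -
  have "{x. \<forall>i\<in>J. norm (A i x) = norm x} = {x. \<forall>i\<in>J. cadjoint (A i) (A i x) = x}"
    using contraction_isometric_iff[OF A] by auto
  then show "csubspace {x. \<forall>i\<in>J. norm (A i x) = norm x}"
    using A(1) by (simp add: csubspace_def bclin_D bclin_cadjoint)
  have "closed {x. norm (A i x) = norm x}" if "i \<in> J" for i
    using A(1)[OF that] linear_continuous_on unfolding bounded_clinear_def
    by (intro closed_Collect_eq continuous_on_norm) auto
  then have "closed (\<Inter>i\<in>J. {x. norm (A i x) = norm x})" by (intro closed_INT ballI)
  also have "(\<Inter>i\<in>J. {x. norm (A i x) = norm x}) = {x. \<forall>i\<in>J. norm (A i x) = norm x}" by auto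
  finally show "closed {x. \<forall>i\<in>J. norm (A i x) = norm x}" .
qed

text \<open>The projection onto a reducing subspace commutes with the operator.\<close>

lemma cproj_commute:
  fixes S :: "'a::chilbert_space set"
  assumes S: "csubspace S" "closed S" and A: "bounded_clinear A"
    and inv: "A ` S \<subseteq> S" "cadjoint A ` S \<subseteq> S"
  shows "cproj S (A x) = A (cproj S x)"
proof (rule cproj_eqI[OF S(1)])
  show "A (cproj S x) \<in> S" using inv cproj_in[OF S] by blast
  have "cinner (A (x - cproj S x)) y = 0" if "y \<in> S" for y
  proof -
    have "cinner (x - cproj S x) (cadjoint A y) = 0"
      using cproj_ortho[OF S, of x] inv that unfolding cortho_def by blast
    then show ?thesis by (simp add: cinner_cadjoint_right[OF A])
  qed
  then show "A x - A (cproj S x) \<in> cortho S" by (simp add: cortho_def bclin_D[OF A])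
qed

text \<open>The unit ball of bounded operators on a separable Hilbert space is sequentially compact in the
  weak operator topology.\<close>

lemma contractions_weakly_sequentially_compact:
  fixes A :: "nat \<Rightarrow> 'a::chilbert_space \<Rightarrow> 'a"
  assumes sep: "separable_space (euclidean :: 'a topology)"
    and A: "\<And>n. bounded_clinear (A n)" "\<And>n x. norm (A n x) \<le> norm x"
  shows "\<exists>r V. strict_mono r \<and> bounded_clinear V \<and> (\<forall>x. norm (V x) \<le> norm x) \<and>
    (\<forall>x y. (\<lambda>k. cinner (A (r k) x) y) \<longlonglongrightarrow> cinner (V x) y)"
proof -
  obtain D :: "'a set" where D: "countable D" "closure D = UNIV"
    using sep by (auto simp: separable_space_def)
  then have "D \<noteq> {}" by auto
  define d where "d = from_nat_into D"
  have d: "\<exists>n. norm (x - d n) < e" if "e > 0" for x e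
    using that D closure_approachable[of x D] from_nat_into_surj[OF D(1)]
    by (metis UNIV_I d_def dist_commute dist_norm)
  define f where "f = (\<lambda>k n. cinner (A k (d (fst (prod_decode n)))) (d (snd (prod_decode n))))"
  have bd: "cmod (cinner (A k x) y) \<le> norm x * norm y" for k x y
    using norm_cinner_le A(2) by (meson mult_right_mono norm_ge_zero order_trans)
  interpret subseqs "\<lambda>n s. convergent (\<lambda>k. f (s k) n)"
  proof
    fix n and s :: "nat \<Rightarrow> nat"
    have "bounded (range (\<lambda>k. f (s k) n))" using bd by (auto simp: f_def bounded_iff)
    then show "\<exists>r'. strict_mono r' \<and> convergent (\<lambda>k. f ((s \<circ> r') k) n)"
      using bounded_imp_convergent_subsequence[of "\<lambda>k. f (s k) n"] by (auto simp: convergent_def o_def)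
  qed
  define r where "r = diagseq"
  have r: "strict_mono r" by (simp add: r_def subseq_diagseq)
  have conv: "convergent (\<lambda>k. f (r k) n)" for n
  proof -
    have "convergent (\<lambda>k. f ((diagseq \<circ> (+) (Suc n)) k) n)"
    proof (rule diagseq_holds)
      fix r s :: "nat \<Rightarrow> nat" and n assume "strict_mono r" "convergent (\<lambda>k. f (s k) n)"
      then show "convergent (\<lambda>k. f ((s \<circ> r) k) n)"
        using convergent_subseq_convergent[of "\<lambda>k. f (s k) n" r] by (simp add: o_def)
    qed
    then have "convergent (\<lambda>k. f (r (k + Suc n)) n)" by (simp add: r_def add.commute)
    then show ?thesis using convergent_ignore_initial_segment[of "\<lambda>k. f (r k) n"] by blast
  qed
  have conv: "convergent (\<lambda>k. cinner (A (r k) x) y)" for x y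
  proof -
    have "Cauchy (\<lambda>k. cinner (A (r k) x) y)"
    proof (rule metric_CauchyI)
      fix e :: real assume e: "e > 0"
      obtain i where i: "norm (x - d i) < e / (6 * (norm y + 1))"
        using d[of "e / (6 * (norm y + 1))" x] e by (auto simp: add_nonneg_pos)
      obtain j where j: "norm (y - d j) < e / (6 * (norm (d i) + 1))"
        using d[of "e / (6 * (norm (d i) + 1))" y] e by (auto simp: add_nonneg_pos)
      have ij: "dist (cinner (A k x) y) (cinner (A k (d i)) (d j)) < e / 3" for k
      proof -
        have "cinner (A k x) y - cinner (A k (d i)) (d j)
            = cinner (A k (x - d i)) y + cinner (A k (d i)) (y - d j)"
          by (simp add: bclin_D[OF A(1)] cinner_simps)
        then have "dist (cinner (A k x) y) (cinner (A k (d i)) (d j))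
            \<le> norm (x - d i) * norm y + norm (d i) * norm (y - d j)"
          unfolding dist_norm by (metis norm_triangle_mono bd)
        moreover have "norm (x - d i) * norm y \<le> norm (x - d i) * (norm y + 1)"
          "norm (d i) * norm (y - d j) \<le> norm (y - d j) * (norm (d i) + 1)"
          by (simp_all add: algebra_simps)
        moreover have "norm (x - d i) * (norm y + 1) < e / 6" "norm (y - d j) * (norm (d i) + 1) < e / 6"
          using i j add_nonneg_pos[OF norm_ge_zero[of y], of 1] add_nonneg_pos[OF norm_ge_zero[of "d i"], of 1]
          by (simp_all add: pos_less_divide_eq algebra_simps)
        ultimately show ?thesis by linarith
      qed
      have "Cauchy (\<lambda>k. cinner (A (r k) (d i)) (d j))"
        using conv[of "prod_encode (i, j)"] by (simp add: f_def Cauchy_convergent_iff)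
      then obtain M where M: "\<And>m n. m \<ge> M \<Longrightarrow> n \<ge> M \<Longrightarrow>
          dist (cinner (A (r m) (d i)) (d j)) (cinner (A (r n) (d i)) (d j)) < e / 3"
        using e unfolding Cauchy_def by (metis divide_pos_pos zero_less_numeral)
      show "\<exists>M. \<forall>m\<ge>M. \<forall>n\<ge>M. dist (cinner (A (r m) x) y) (cinner (A (r n) x) y) < e"
      proof (intro exI allI impI)
        fix m n assume "m \<ge> M" "n \<ge> M"
        from M[OF this] show "dist (cinner (A (r m) x) y) (cinner (A (r n) x) y) < e"
          using ij[of "r m"] ij[of "r n"]
            dist_triangle[of "cinner (A (r m) x) y" "cinner (A (r n) x) y" "cinner (A (r m) (d i)) (d j)"]
            dist_triangle[of "cinner (A (r m) (d i)) (d j)" "cinner (A (r n) x) y" "cinner (A (r n) (d i)) (d j)"]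
            dist_commute[of "cinner (A (r n) (d i)) (d j)" "cinner (A (r n) x) y"] by linarith
      qed
    qed
    then show ?thesis by (simp add: Cauchy_convergent_iff)
  qed
  define b where "b = (\<lambda>x y. lim (\<lambda>k. cinner (A (r k) x) y))"
  have b: "(\<lambda>k. cinner (A (r k) x) y) \<longlonglongrightarrow> b x y" for x y
    using conv by (simp add: b_def convergent_LIMSEQ_iff)
  have "\<exists>V. bounded_clinear V \<and> (\<forall>x. norm (V x) \<le> norm x * 1) \<and> (\<forall>x y. cinner (V x) y = b x y)"
  proof (rule operator_of_sesquilinear)
    fix x x' y c
    have "(\<lambda>k. cinner (A (r k) (x + x')) y) \<longlonglongrightarrow> b x y + b x' y"
      using tendsto_add[OF b b] by (simp add: bclin_D[OF A(1)] cinner_simps)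
    then show "b (x + x') y = b x y + b x' y" using b LIMSEQ_unique by blast
    have "(\<lambda>k. cinner (A (r k) (c *\<^sub>C x)) y) \<longlonglongrightarrow> c * b x y"
      using tendsto_mult[OF tendsto_const b] by (simp add: bclin_D[OF A(1)] cinner_simps)
    then show "b (c *\<^sub>C x) y = c * b x y" using b LIMSEQ_unique by blast
  next
    fix x y y' c
    have "(\<lambda>k. cinner (A (r k) x) (y + y')) \<longlonglongrightarrow> b x y + b x y'"
      using tendsto_add[OF b b] by (simp add: cinner_simps)
    then show "b x (y + y') = b x y + b x y'" using b LIMSEQ_unique by blast
    have "(\<lambda>k. cinner (A (r k) x) (c *\<^sub>C y)) \<longlonglongrightarrow> cnj c * b x y"
      using tendsto_mult[OF tendsto_const b] by (simp add: cinner_simps)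
    then show "b x (c *\<^sub>C y) = cnj c * b x y" using b LIMSEQ_unique by blast
  next
    fix x y
    show "cmod (b x y) \<le> norm x * 1 * norm y"
      using LIMSEQ_le_const2[OF tendsto_norm[OF b]] bd by auto
  qed simp
  then show ?thesis using r b by force
qed

section \<open>Operators on a closed subspace\<close>

context
  fixes S :: "'a::chilbert_space set"
  assumes S: "csubspace S" "closed S"
begin

lemma operators_onD:
  assumes "V \<in> operators_on S"
  shows "bounded_clinear V" "V x \<in> S" "V (cproj S x) = V x" "cproj S (V x) = V x"
proof -
  show "bounded_clinear V" "V x \<in> S" "V (cproj S x) = V x"
    using assms by (auto simp: operators_on_def fun_eq_iff)
  then show "cproj S (V x) = V x" by (simp add: cproj_ident[OF S])
qed

lemma operators_onI:
  "bounded_clinear V \<Longrightarrow> (\<And>x. V x \<in> S) \<Longrightarrow> (\<And>x. V (cproj S x) = V x) \<Longrightarrow> V \<in> operators_on S"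
  by (auto simp: operators_on_def)

lemma operators_on_cadjoint: "V \<in> operators_on S \<Longrightarrow> cadjoint V \<in> operators_on S"
proof (rule operators_onI)
  assume V: "V \<in> operators_on S"
  note A = operators_onD(1)[OF V]
  show "bounded_clinear (cadjoint V)" by (rule bclin_cadjoint[OF A])
  fix x
  have "cproj S (cadjoint V x) = cadjoint V x"
    by (rule cinner_eqI) (simp add: cinner_cproj[OF S] cinner_cadjoint_left[OF A] operators_onD[OF V])
  then show "cadjoint V x \<in> S" using cproj_in[OF S] by metis
  show "cadjoint V (cproj S x) = cadjoint V x"
    by (rule cinner_eqI) (simp add: cinner_cproj[OF S] cinner_cadjoint_left[OF A] operators_onD[OF V])
qed

lemma star_subalgebra_operators_on: "star_subalgebra S (operators_on S)"
  unfolding star_subalgebra_def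
  by (auto intro!: operators_onI bclin_zero bclin_add bclin_scaleC
      bclin_compose csubspace_add csubspace_scaleC csubspace_0 S
      simp: operators_on_cadjoint operators_onD)

lemma topspace_weak_operator_topology: "topspace (weak_operator_topology S) = operators_on S"
  by (simp add: weak_operator_topology_def topspace_pullback_topology)

lemma continuous_map_weak_operator_eval:
  "continuous_map (weak_operator_topology S) euclidean (\<lambda>V. cinner (V x) y)"
proof -
  have "continuous_map euclidean euclidean (\<lambda>f::'a \<times> 'a \<Rightarrow> complex. f (x, y))"
    by (simp add: continuous_on_product_coordinates)
  from continuous_map_pullback[OF this, of "operators_on S" "\<lambda>V (x, y). cinner (V x) y"]
  show ?thesis by (simp add: weak_operator_topology_def o_def)
qed

lemma continuous_map_into_weak_operator_topology:
  assumes "\<And>x y. continuous_map X euclidean (\<lambda>V. cinner (f V x) y)"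
    and "\<And>V. V \<in> topspace X \<Longrightarrow> f V \<in> operators_on S"
  shows "continuous_map X (weak_operator_topology S) f"
  unfolding weak_operator_topology_def
proof (rule continuous_map_pullback')
  show "continuous_map X euclidean ((\<lambda>V (x, y). cinner (V x) y) \<circ> f)"
    unfolding euclidean_product_topology[symmetric] continuous_map_componentwise_UNIV
    using assms(1) by auto
qed (use assms(2) in auto)

lemma closedin_weak_operator_compose_left:
  assumes M: "closedin (weak_operator_topology S) M" and A: "bounded_clinear A" "A ` S \<subseteq> S"
  shows "closedin (weak_operator_topology S) {X \<in> operators_on S. A \<circ> X \<in> M}"
proof -
  have "continuous_map (weak_operator_topology S) (weak_operator_topology S) (\<lambda>X. A \<circ> X)"
  proof (rule continuous_map_into_weak_operator_topology)
    fix x y show "continuous_map (weak_operator_topology S) euclidean (\<lambda>V. cinner ((A \<circ> V) x) y)"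
      using continuous_map_weak_operator_eval[of x "cadjoint A y"]
      by (simp add: cinner_cadjoint_right[OF A(1)])
  next
    fix V assume "V \<in> topspace (weak_operator_topology S)"
    then show "A \<circ> V \<in> operators_on S"
      using A by (intro operators_onI)
        (auto simp: topspace_weak_operator_topology operators_onD intro: bclin_compose)
  qed
  from closedin_continuous_map_preimage[OF this M]
  show ?thesis by (simp add: topspace_weak_operator_topology)
qed

lemma closedin_weak_operator_compose_right:
  assumes M: "closedin (weak_operator_topology S) M"
    and A: "bounded_clinear A" "\<And>x. cproj S (A x) = A (cproj S x)"
  shows "closedin (weak_operator_topology S) {X \<in> operators_on S. X \<circ> A \<in> M}"
proof -
  have "continuous_map (weak_operator_topology S) (weak_operator_topology S) (\<lambda>X. X \<circ> A)"
  proof (rule continuous_map_into_weak_operator_topology)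
    fix x y show "continuous_map (weak_operator_topology S) euclidean (\<lambda>V. cinner ((V \<circ> A) x) y)"
      using continuous_map_weak_operator_eval[of "A x" y] by simp
  next
    fix V assume "V \<in> topspace (weak_operator_topology S)"
    then show "V \<circ> A \<in> operators_on S"
      using A by (intro operators_onI)
        (auto simp: topspace_weak_operator_topology operators_onD A(2)[symmetric] intro: bclin_compose)
  qed
  from closedin_continuous_map_preimage[OF this M]
  show ?thesis by (simp add: topspace_weak_operator_topology)
qed

context
  fixes \<Omega> :: "('a \<Rightarrow> 'a) set"
  assumes \<Omega>: "\<Omega> \<subseteq> operators_on S"
begin

lemma star_subalgebra_limit_algebra: "star_subalgebra S (limit_algebra S \<Omega>)"
  and closedin_limit_algebra: "closedin (weak_operator_topology S) (limit_algebra S \<Omega>)"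
proof -
  let ?F = "{M. (star_subalgebra S M \<and> closedin (weak_operator_topology S) M) \<and> \<Omega> \<subseteq> M}"
  have "closedin (weak_operator_topology S) (operators_on S)"
    by (metis closedin_topspace topspace_weak_operator_topology)
  then have F: "operators_on S \<in> ?F" using star_subalgebra_operators_on \<Omega> by blast
  then have "closedin (weak_operator_topology S) (\<Inter>?F)" by (intro closedin_Inter) blast+
  then show "closedin (weak_operator_topology S) (limit_algebra S \<Omega>)"
    by (simp add: limit_algebra_def hull_def)
  have 1: "\<Inter>?F \<subseteq> operators_on S" using F by blast
  have "star_subalgebra S (\<Inter>F)"
    if "\<And>M. M \<in> F \<Longrightarrow> star_subalgebra S M" "\<Inter>F \<subseteq> operators_on S" for F
    using that by (simp add: star_subalgebra_def)
  from this[OF _ 1] have "star_subalgebra S (\<Inter>?F)" by blast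
  then show "star_subalgebra S (limit_algebra S \<Omega>)" by (simp add: limit_algebra_def hull_def)
qed

lemma limit_algebra_superset: "\<Omega> \<subseteq> limit_algebra S \<Omega>"
  by (simp add: limit_algebra_def hull_subset)

lemma limit_algebra_minimal:
  "\<Omega> \<subseteq> M \<Longrightarrow> star_subalgebra S M \<Longrightarrow> closedin (weak_operator_topology S) M \<Longrightarrow> limit_algebra S \<Omega> \<subseteq> M"
  unfolding limit_algebra_def by (rule hull_minimal) auto

lemma limit_algebra_on: "X \<in> limit_algebra S \<Omega> \<Longrightarrow> X \<in> operators_on S"
  using star_subalgebra_limit_algebra by (auto simp: star_subalgebra_def)

lemma limit_algebra_zero: "(\<lambda>x. 0) \<in> limit_algebra S \<Omega>"
  and limit_algebra_add: "A \<in> limit_algebra S \<Omega> \<Longrightarrow> B \<in> limit_algebra S \<Omega> \<Longrightarrow> (\<lambda>x. A x + B x) \<in> limit_algebra S \<Omega>"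
  and limit_algebra_scaleC: "A \<in> limit_algebra S \<Omega> \<Longrightarrow> (\<lambda>x. c *\<^sub>C A x) \<in> limit_algebra S \<Omega>"
  and limit_algebra_compose: "A \<in> limit_algebra S \<Omega> \<Longrightarrow> B \<in> limit_algebra S \<Omega> \<Longrightarrow> A \<circ> B \<in> limit_algebra S \<Omega>"
  and limit_algebra_cadjoint: "A \<in> limit_algebra S \<Omega> \<Longrightarrow> cadjoint A \<in> limit_algebra S \<Omega>"
  using star_subalgebra_limit_algebra by (auto simp: star_subalgebra_def)

lemma limit_algebra_diff:
  "A \<in> limit_algebra S \<Omega> \<Longrightarrow> B \<in> limit_algebra S \<Omega> \<Longrightarrow> (\<lambda>x. A x - B x) \<in> limit_algebra S \<Omega>"
  using limit_algebra_add[of A "\<lambda>x. (-1) *\<^sub>C B x"] limit_algebra_scaleC[of B "-1"]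
  by (simp add: scaleC_minus_one)

lemma limit_algebra_sum:
  "(\<And>i. i \<in> I \<Longrightarrow> A i \<in> limit_algebra S \<Omega>) \<Longrightarrow> (\<lambda>x. \<Sum>i\<in>I. A i x) \<in> limit_algebra S \<Omega>"
  by (induction I rule: infinite_finite_induct) (auto intro: limit_algebra_zero limit_algebra_add)

lemma limit_algebra_weak_limit:
  assumes "\<And>n::nat. A n \<in> limit_algebra S \<Omega>" "V \<in> operators_on S"
    "\<And>x y. (\<lambda>n. cinner (A n x) y) \<longlonglongrightarrow> cinner (V x) y"
  shows "V \<in> limit_algebra S \<Omega>"
proof -
  have "limitin (weak_operator_topology S) A V sequentially"
    unfolding limitin_weak_operator_topology using assms limit_algebra_on by auto
  then show ?thesis
    by (rule limitin_closedin) (use assms(1) in \<open>auto simp: closedin_limit_algebra\<close>)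
qed

lemma limit_algebra_strong_limit:
  assumes A: "\<And>n::nat. A n \<in> limit_algebra S \<Omega>" and V: "bounded_clinear V"
    and lim: "\<And>x. (\<lambda>n. A n x) \<longlonglongrightarrow> V x"
  shows "V \<in> limit_algebra S \<Omega>"
proof (rule limit_algebra_weak_limit[OF A])
  note op = limit_algebra_on[OF A]
  show "V \<in> operators_on S"
  proof (rule operators_onI[OF V])
    fix x
    show "V x \<in> S" using closed_sequentially[OF S(2) _ lim] operators_onD(2)[OF op] by blast
    have "(\<lambda>n. A n x) \<longlonglongrightarrow> V (cproj S x)" using lim[of "cproj S x"] operators_onD(3)[OF op] by simp
    then show "V (cproj S x) = V x" using lim LIMSEQ_unique by blast
  qed
  show "(\<lambda>n. cinner (A n x) y) \<longlonglongrightarrow> cinner (V x) y" for x y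
    by (intro tendsto_cinner lim tendsto_const)
qed

end

end

section \<open>Strongly closed algebras\<close>

text \<open>A unital algebra of bounded operators that is closed under strong limits of sequences.\<close>

definition strongly_closed_algebra :: "('a::complex_inner \<Rightarrow> 'a) set \<Rightarrow> bool" where
  "strongly_closed_algebra N \<longleftrightarrow>
     (\<forall>A\<in>N. bounded_clinear A) \<and> id \<in> N \<and>
     (\<forall>A\<in>N. \<forall>B\<in>N. (\<lambda>x. A x + B x) \<in> N) \<and> (\<forall>c. \<forall>A\<in>N. (\<lambda>x. c *\<^sub>C A x) \<in> N) \<and>
     (\<forall>A\<in>N. \<forall>B\<in>N. A \<circ> B \<in> N) \<and>
     (\<forall>A V. (\<forall>n::nat. A n \<in> N) \<longrightarrow> bounded_clinear V \<longrightarrow> (\<forall>x. (\<lambda>n. A n x) \<longlonglongrightarrow> V x) \<longrightarrow> V \<in> N)"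

lemma strongly_closed_algebra_stabilizer:
  fixes S :: "'a::complex_inner set"
  assumes S: "csubspace S" "closed S"
  shows "strongly_closed_algebra {A. bounded_clinear A \<and> A ` S \<subseteq> S}"
  unfolding strongly_closed_algebra_def
proof (intro conjI ballI allI impI)
  fix A :: "nat \<Rightarrow> 'a \<Rightarrow> 'a" and V
  assume "\<forall>n. A n \<in> {A. bounded_clinear A \<and> A ` S \<subseteq> S}" "bounded_clinear V" and lim: "\<forall>x. (\<lambda>n. A n x) \<longlonglongrightarrow> V x"
  then show "V \<in> {A. bounded_clinear A \<and> A ` S \<subseteq> S}"
    using closed_sequentially[OF S(2) _ lim[rule_format]] by (auto simp: image_subset_iff)
qed (auto simp: image_subset_iff intro: bclin_id bclin_add bclin_scaleC
    bclin_compose csubspace_add[OF S(1)] csubspace_scaleC[OF S(1)])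

lemma strongly_closed_algebra_left_multipliers:
  fixes S :: "'a::chilbert_space set"
  assumes S: "csubspace S" "closed S" and \<Omega>: "\<Omega> \<subseteq> operators_on S"
  shows "strongly_closed_algebra {A. bounded_clinear A \<and> (\<forall>X\<in>limit_algebra S \<Omega>. A \<circ> X \<in> limit_algebra S \<Omega>)}"
    (is "strongly_closed_algebra ?N")
  unfolding strongly_closed_algebra_def
proof (intro conjI ballI allI impI)
  fix A :: "nat \<Rightarrow> 'a \<Rightarrow> 'a" and V
  assume A: "\<forall>n. A n \<in> ?N" and V: "bounded_clinear V" and lim: "\<forall>x. (\<lambda>n. A n x) \<longlonglongrightarrow> V x"
  have "V \<circ> X \<in> limit_algebra S \<Omega>" if X: "X \<in> limit_algebra S \<Omega>" for X
  proof (rule limit_algebra_strong_limit[OF S \<Omega>, of "\<lambda>n. A n \<circ> X"])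
    show "bounded_clinear (V \<circ> X)"
      by (intro bclin_compose V operators_onD(1)[OF S limit_algebra_on[OF S \<Omega> X]])
  qed (use A X lim in auto)
  then show "V \<in> ?N" using V by blast
next
  fix A B assume "A \<in> ?N" "B \<in> ?N"
  then show "(\<lambda>x. A x + B x) \<in> ?N" "A \<circ> B \<in> ?N"
    using limit_algebra_add[OF S \<Omega>] by (auto simp: o_def intro: bclin_add bclin_compose[unfolded o_def])
next
  fix A c assume "A \<in> ?N"
  then show "(\<lambda>x. c *\<^sub>C A x) \<in> ?N"
    using limit_algebra_scaleC[OF S \<Omega>] by (auto simp: o_def intro: bclin_scaleC)
qed (auto intro: bclin_id)

section \<open>Commutative families of contractions\<close>

text \<open>
  The index set is a set \<open>I\<close> of nonnegative reals that is closed under addition and under nonnegative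
  differences: the half-line for a semigroup, the natural numbers for the powers of an operator.
  Nothing is assumed about \<open>W t\<close> for other \<open>t\<close>, nor about continuity.
\<close>

locale contraction_family =
  fixes I :: "real set" and W :: "real \<Rightarrow> 'a::chilbert_space \<Rightarrow> 'a"
  assumes separable: "separable_space (euclidean :: 'a topology)"
    and index_nonneg: "t \<in> I \<Longrightarrow> 0 \<le> t"
    and index_add: "s \<in> I \<Longrightarrow> t \<in> I \<Longrightarrow> s + t \<in> I"
    and index_diff: "s \<in> I \<Longrightarrow> t \<in> I \<Longrightarrow> s \<le> t \<Longrightarrow> t - s \<in> I"
    and bclin: "t \<in> I \<Longrightarrow> bounded_clinear (W t)"
    and contraction: "t \<in> I \<Longrightarrow> norm (W t x) \<le> norm x"
    and W_add: "s \<in> I \<Longrightarrow> t \<in> I \<Longrightarrow> W (s + t) = W s \<circ> W t"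
begin

text \<open>The adjoint family.\<close>

definition V :: "real \<Rightarrow> 'a \<Rightarrow> 'a" where "V t = cadjoint (W t)"

lemma W_add_apply: "s \<in> I \<Longrightarrow> t \<in> I \<Longrightarrow> W (s + t) x = W s (W t x)"
  by (simp add: W_add)

lemma W_comm: "s \<in> I \<Longrightarrow> t \<in> I \<Longrightarrow> W s (W t x) = W t (W s x)"
  by (simp add: W_add_apply[symmetric] add.commute)

lemma bclin_V: "t \<in> I \<Longrightarrow> bounded_clinear (V t)"
  by (simp add: V_def bclin_cadjoint bclin)

lemma V_contraction: "t \<in> I \<Longrightarrow> norm (V t x) \<le> norm x"
  unfolding V_def by (rule norm_cadjoint_le[OF bclin contraction])

lemma cinner_V_left: "t \<in> I \<Longrightarrow> cinner (V t x) y = cinner x (W t y)"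
  and cinner_V_right: "t \<in> I \<Longrightarrow> cinner x (V t y) = cinner (W t x) y"
  by (simp_all add: V_def cinner_cadjoint_left cinner_cadjoint_right bclin)

lemma cadjoint_V: "t \<in> I \<Longrightarrow> cadjoint (V t) = W t"
  by (simp add: V_def cadjoint_cadjoint bclin)

lemma V_add_apply: "s \<in> I \<Longrightarrow> t \<in> I \<Longrightarrow> V (s + t) x = V s (V t x)"
  unfolding V_def add.commute[of s t] by (simp add: W_add cadjoint_compose bclin)

text \<open>The unitary part: the vectors on which the family and its adjoint are isometric.\<close>

definition U :: "'a set" where
  "U = {x. \<forall>t\<in>I. norm (W t x) = norm x \<and> norm (V t x) = norm x}"

lemma U_iff: "x \<in> U \<longleftrightarrow> (\<forall>t\<in>I. V t (W t x) = x \<and> W t (V t x) = x)"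
  using contraction_isometric_iff[OF bclin contraction] contraction_isometric_iff[OF bclin_V V_contraction]
  by (auto simp: U_def V_def[symmetric] cadjoint_V)

lemma csubspace_U: "csubspace U"
  unfolding csubspace_def by (auto simp: U_iff bclin_D[OF bclin] bclin_D[OF bclin_V])

lemma V_W [simp]: "t \<in> I \<Longrightarrow> x \<in> U \<Longrightarrow> V t (W t x) = x"
  and W_V [simp]: "t \<in> I \<Longrightarrow> x \<in> U \<Longrightarrow> W t (V t x) = x"
  by (simp_all add: U_iff)

lemma closed_U: "closed U"
proof -
  have "U = {x. \<forall>t\<in>I. norm (W t x) = norm x} \<inter> {x. \<forall>t\<in>I. norm (V t x) = norm x}"
    by (auto simp: U_def)
  then show ?thesis
    using isometric_subspace(2)[of I W] isometric_subspace(2)[of I V]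
    by (simp add: closed_Int bclin contraction bclin_V V_contraction)
qed

lemmas U_closed = csubspace_U closed_U

lemma norm_W_U: "t \<in> I \<Longrightarrow> x \<in> U \<Longrightarrow> norm (W t x) = norm x"
  and norm_V_U: "t \<in> I \<Longrightarrow> x \<in> U \<Longrightarrow> norm (V t x) = norm x"
  by (simp_all add: U_def)

lemma W_U: assumes t: "t \<in> I" and x: "x \<in> U" shows "W t x \<in> U"
  unfolding U_def
proof (intro CollectI ballI conjI)
  fix s assume s: "s \<in> I"
  show "norm (W s (W t x)) = norm (W t x)"
    using norm_W_U[OF index_add[OF s t] x] norm_W_U[OF t x] by (simp add: W_add_apply s t)
  show "norm (V s (W t x)) = norm (W t x)"
  proof (cases "s \<le> t")
    case True
    then have I: "t - s \<in> I" using index_diff s t by blast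
    have "W s (W (t - s) x) = W t x" using W_add_apply[OF s I, of x] by simp
    moreover have "norm (W s (W (t - s) x)) = norm (W (t - s) x)"
      using norm_W_U[OF t x] norm_W_U[OF I x] calculation by simp
    then have "V s (W s (W (t - s) x)) = W (t - s) x"
      using contraction_isometric_iff[OF bclin[OF s] contraction[OF s]] by (simp add: V_def)
    ultimately show ?thesis using norm_W_U[OF t x] norm_W_U[OF I x] by simp
  next
    case False
    then have I: "s - t \<in> I" using index_diff s t by simp
    have "V s (W t x) = V (s - t) x" using V_add_apply[OF I t, of "W t x"] t x by simp
    then show ?thesis using norm_W_U[OF t x] norm_V_U[OF I x] by simp
  qed
qed

lemma V_U: assumes t: "t \<in> I" and x: "x \<in> U" shows "V t x \<in> U"
  unfolding U_def
proof (intro CollectI ballI conjI)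
  fix s assume s: "s \<in> I"
  show "norm (V s (V t x)) = norm (V t x)"
    using norm_V_U[OF index_add[OF s t] x] norm_V_U[OF t x] by (simp add: V_add_apply s t)
  show "norm (W s (V t x)) = norm (V t x)"
  proof (cases "s \<le> t")
    case True
    then have I: "t - s \<in> I" using index_diff s t by blast
    have "V s (V (t - s) x) = V t x" using V_add_apply[OF s I, of x] by simp
    moreover have "norm (V s (V (t - s) x)) = norm (V (t - s) x)"
      using norm_V_U[OF t x] norm_V_U[OF I x] calculation by simp
    then have "W s (V s (V (t - s) x)) = V (t - s) x"
      using contraction_isometric_iff[OF bclin_V[OF s] V_contraction[OF s]] by (simp add: cadjoint_V s)
    ultimately show ?thesis using norm_V_U[OF t x] norm_V_U[OF I x] by simp
  next
    case False
    then have I: "s - t \<in> I" using index_diff s t by simp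
    have "W s (V t x) = W (s - t) x" using W_add_apply[OF I t, of "V t x"] t x by simp
    then show ?thesis using norm_V_U[OF t x] norm_W_U[OF I x] by simp
  qed
qed

lemma cproj_W: "t \<in> I \<Longrightarrow> cproj U (W t x) = W t (cproj U x)"
  by (rule cproj_commute[OF U_closed bclin]) (auto simp: V_def[symmetric] W_U V_U)

lemma cproj_V: "t \<in> I \<Longrightarrow> cproj U (V t x) = V t (cproj U x)"
  by (rule cproj_commute[OF U_closed bclin_V]) (auto simp: cadjoint_V W_U V_U)

lemma cproj_U_in: "cproj U x \<in> U"
  by (rule cproj_in[OF U_closed])

lemma V_W_comm: "s \<in> I \<Longrightarrow> t \<in> I \<Longrightarrow> x \<in> U \<Longrightarrow> W t (V s x) = V s (W t x)"
  by (metis V_W W_V W_U V_U W_comm)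

text \<open>The norm decreases along an orbit, so its limit at infinity is the same for all sequences of
  indices.\<close>

lemma norm_orbit_tendsto:
  "\<exists>l. \<forall>\<sigma>. (\<forall>k::nat. \<sigma> k \<in> I) \<longrightarrow> filterlim \<sigma> at_top sequentially \<longrightarrow> (\<lambda>k. (norm (W (\<sigma> k) x))\<^sup>2) \<longlonglongrightarrow> l"
proof -
  define d where "d = (\<lambda>t. (norm (W t x))\<^sup>2)"
  have mono: "d t \<le> d s" if "s \<in> I" "t \<in> I" "s \<le> t" for s t
    using contraction[OF index_diff[OF that], of "W s x"] W_add_apply[OF index_diff[OF that] that(1)]
    by (simp add: d_def power_mono)
  define l where "l = Inf (d ` I)"
  have bb: "bdd_below (d ` I)" by (intro bdd_belowI[of _ 0]) (auto simp: d_def)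
  have "(\<lambda>k. d (\<sigma> k)) \<longlonglongrightarrow> l" if \<sigma>: "\<And>k::nat. \<sigma> k \<in> I" "filterlim \<sigma> at_top sequentially" for \<sigma>
  proof (rule order_tendstoI)
    fix a assume "a < l"
    then show "\<forall>\<^sub>F k in sequentially. a < d (\<sigma> k)"
      using \<sigma>(1) cINF_lower[OF bb] unfolding l_def by (intro always_eventually) (meson less_le_trans)
  next
    fix a assume "l < a"
    then obtain t where t: "t \<in> I" "d t < a"
      using cInf_lessD[of "d ` I" a] \<sigma>(1) unfolding l_def by blast
    have "\<forall>\<^sub>F k in sequentially. t \<le> \<sigma> k" using \<sigma>(2) by (simp add: filterlim_at_top)
    then show "\<forall>\<^sub>F k in sequentially. d (\<sigma> k) < a"
      by eventually_elim (use mono t \<sigma>(1) in \<open>meson le_less_trans\<close>)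
  qed
  then show ?thesis unfolding d_def by blast
qed

lemma shifted_index:
  assumes s: "s \<in> I" and \<tau>: "\<And>k::nat. \<tau> k \<in> I" "filterlim \<tau> at_top sequentially"
  obtains \<sigma> where "\<And>k::nat. \<sigma> k \<in> I" "filterlim \<sigma> at_top sequentially"
    "\<forall>\<^sub>F k in sequentially. \<forall>x. W (\<tau> k) x = W s (W (\<sigma> k) x)"
proof
  define \<sigma> where "\<sigma> = (\<lambda>k. if s \<le> \<tau> k then \<tau> k - s else 0)"
  have ev: "\<forall>\<^sub>F k in sequentially. s \<le> \<tau> k" using \<tau>(2) by (simp add: filterlim_at_top)
  show \<sigma>: "\<sigma> k \<in> I" for k using index_diff[OF s \<tau>(1)] index_diff[OF s s] by (simp add: \<sigma>_def)
  show "filterlim \<sigma> at_top sequentially"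
  proof (rule filterlim_cong[THEN iffD1, OF refl refl])
    show "filterlim (\<lambda>k. - s + \<tau> k) at_top sequentially"
      by (rule filterlim_tendsto_add_at_top[OF tendsto_const \<tau>(2)])
    show "\<forall>\<^sub>F k in sequentially. - s + \<tau> k = \<sigma> k"
      using ev by eventually_elim (simp add: \<sigma>_def)
  qed
  show "\<forall>\<^sub>F k in sequentially. \<forall>x. W (\<tau> k) x = W s (W (\<sigma> k) x)"
    using ev
  proof eventually_elim
    case (elim k)
    then show ?case using W_add_apply[OF s \<sigma>, of k] by (simp add: \<sigma>_def)
  qed
qed

text \<open>The heart of Foguel's theorem: a weak cluster point of an orbit at infinity lies in the
  unitary part, because the defects of isometry along the orbit tend to zero.\<close>

lemma weak_cluster_point_in_U:
  assumes \<tau>: "\<And>k::nat. \<tau> k \<in> I" "filterlim \<tau> at_top sequentially"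
    and lim: "\<And>y. (\<lambda>k. cinner (W (\<tau> k) x) y) \<longlonglongrightarrow> cinner z y"
  shows "z \<in> U"
  unfolding U_iff
proof (intro ballI conjI)
  fix s assume s: "s \<in> I"
  obtain l where l: "\<And>\<sigma>. (\<And>k::nat. \<sigma> k \<in> I) \<Longrightarrow> filterlim \<sigma> at_top sequentially \<Longrightarrow>
      (\<lambda>k. (norm (W (\<sigma> k) x))\<^sup>2) \<longlonglongrightarrow> l"
    using norm_orbit_tendsto[of x] by blast
  have defect: "(norm (V s (W s v) - v))\<^sup>2 \<le> (norm v)\<^sup>2 - (norm (W s v))\<^sup>2" for v
  proof -
    have "Re (cinner (V s (W s v)) v) = (norm (W s v))\<^sup>2"
      by (simp add: cinner_V_left s cinner_self)
    moreover have "(norm (V s (W s v)))\<^sup>2 \<le> (norm (W s v))\<^sup>2"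
      by (intro power_mono V_contraction s) simp
    ultimately show ?thesis unfolding norm_diff_sqr by linarith
  qed
  have vanish: "(\<lambda>k. V s (W s (W (\<sigma> k) x)) - W (\<sigma> k) x) \<longlonglongrightarrow> 0"
    if \<sigma>: "\<And>k::nat. \<sigma> k \<in> I" "filterlim \<sigma> at_top sequentially" for \<sigma>
  proof -
    have s\<sigma>: "filterlim (\<lambda>k. s + \<sigma> k) at_top sequentially"
      by (rule filterlim_tendsto_add_at_top[OF tendsto_const \<sigma>(2)])
    have "(\<lambda>k. (norm (V s (W s (W (\<sigma> k) x)) - W (\<sigma> k) x))\<^sup>2) \<longlonglongrightarrow> 0"
    proof (rule tendsto_sandwich[OF _ _ tendsto_const])
      show "(\<lambda>k. (norm (W (\<sigma> k) x))\<^sup>2 - (norm (W (s + \<sigma> k) x))\<^sup>2) \<longlonglongrightarrow> 0"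
        using tendsto_diff[OF l[OF \<sigma>] l[OF index_add[OF s \<sigma>(1)] s\<sigma>]] by simp
    qed (use defect[of "W (\<sigma> _) x"] in \<open>auto simp: W_add_apply s \<sigma>(1)\<close>)
    then have "(\<lambda>k. sqrt ((norm (V s (W s (W (\<sigma> k) x)) - W (\<sigma> k) x))\<^sup>2)) \<longlonglongrightarrow> sqrt 0"
      by (rule tendsto_real_sqrt)
    then show ?thesis by (simp add: tendsto_norm_zero_iff)
  qed
  have fixed: "B z = z"
    if B: "\<And>u y. cinner (B u) y = cinner u (B y)" "(\<lambda>k. B (W (\<tau> k) x) - W (\<tau> k) x) \<longlonglongrightarrow> 0" for B
  proof (rule cinner_eqI)
    fix y
    have "(\<lambda>k. cinner (B (W (\<tau> k) x) - W (\<tau> k) x) y + cinner (W (\<tau> k) x) y) \<longlonglongrightarrow> cinner 0 y + cinner z y"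
      by (intro tendsto_add tendsto_cinner B(2) lim tendsto_const)
    moreover have "(\<lambda>k. cinner (W (\<tau> k) x) (B y)) \<longlonglongrightarrow> cinner z (B y)" by (rule lim)
    ultimately show "cinner (B z) y = cinner z y"
      using LIMSEQ_unique by (fastforce simp: cinner_diff_left B(1))
  qed
  show "V s (W s z) = z"
    using fixed[of "\<lambda>u. V s (W s u)"] vanish[OF \<tau>] by (simp add: cinner_V_left cinner_V_right s)
  obtain \<sigma> where \<sigma>: "\<And>k::nat. \<sigma> k \<in> I" and \<sigma>': "filterlim \<sigma> at_top sequentially"
    and ev: "\<forall>\<^sub>F k in sequentially. \<forall>x. W (\<tau> k) x = W s (W (\<sigma> k) x)"
    using shifted_index[OF s \<tau>] by blast
  have "(\<lambda>k. W s (V s (W s (W (\<sigma> k) x)) - W (\<sigma> k) x)) \<longlonglongrightarrow> W s 0"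
    by (intro tendsto_bclin[OF bclin[OF s]] vanish \<sigma> \<sigma>')
  then have "(\<lambda>k. W s (V s (W (\<tau> k) x)) - W (\<tau> k) x) \<longlonglongrightarrow> W s 0"
  proof (rule Lim_transform_eventually)
    show "\<forall>\<^sub>F k in sequentially. W s (V s (W s (W (\<sigma> k) x)) - W (\<sigma> k) x) = W s (V s (W (\<tau> k) x)) - W (\<tau> k) x"
      using ev
    proof eventually_elim
      case (elim k)
      then show ?case by (simp add: bclin_D[OF bclin[OF s]])
    qed
  qed
  then show "W s (V s z) = z"
    using fixed[of "\<lambda>u. W s (V s u)"]
    by (simp add: cinner_V_left[symmetric] cinner_V_right[symmetric] s bclin_D[OF bclin[OF s]])
qed

text \<open>\<open>L\<close> is the weak limit of the unitary parts of the operators \<open>W (\<tau> k)\<close>, where \<open>\<tau> k\<close> tends to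
  infinity.\<close>

definition limit_along :: "(nat \<Rightarrow> real) \<Rightarrow> ('a \<Rightarrow> 'a) \<Rightarrow> bool" where
  "limit_along \<tau> L \<longleftrightarrow> (\<forall>k. \<tau> k \<in> I) \<and> filterlim \<tau> at_top sequentially \<and>
     (\<forall>x y. (\<lambda>k. cinner (W (\<tau> k) (cproj U x)) y) \<longlonglongrightarrow> cinner (L x) y)"

lemma limit_alongD:
  assumes "limit_along \<tau> L"
  shows "\<tau> k \<in> I" "filterlim \<tau> at_top sequentially"
    "(\<lambda>k. cinner (W (\<tau> k) (cproj U x)) y) \<longlonglongrightarrow> cinner (L x) y"
  using assms by (auto simp: limit_along_def)

text \<open>The limit operators of the family on its unitary part, without a monotonicity condition on the
  sequence of indices.\<close>

definition lim_ops :: "('a \<Rightarrow> 'a) set" where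
  "lim_ops = {L \<in> operators_on U. \<exists>\<tau>. limit_along \<tau> L}"

lemma lim_ops_on: "lim_ops \<subseteq> operators_on U"
  by (auto simp: lim_ops_def)

lemma lim_opsE:
  assumes "L \<in> lim_ops" obtains \<tau> where "limit_along \<tau> L"
  using assms unfolding lim_ops_def by blast

lemmas lim_opsD = operators_onD[OF U_closed subsetD[OF lim_ops_on]]

lemma cinner_W_cortho:
  "t \<in> I \<Longrightarrow> cinner (W t (x - cproj U x)) u = 0" if "u \<in> U"
  using cproj_ortho[OF U_closed, of x] V_U[OF _ that, of t]
  by (auto simp: cortho_def cinner_V_right[symmetric])

lemma subsequence_in_lim_ops:
  assumes \<tau>: "\<And>k::nat. \<tau> k \<in> I" "filterlim \<tau> at_top sequentially"
  shows "\<exists>r L. strict_mono r \<and> L \<in> lim_ops \<and>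
    (\<forall>x y. (\<lambda>k. cinner (W (\<tau> (r k)) x) y) \<longlonglongrightarrow> cinner (L x) y)"
proof -
  obtain r L where r: "strict_mono r" and L: "bounded_clinear L" and
    lim: "\<And>x y. (\<lambda>k. cinner (W (\<tau> (r k)) x) y) \<longlonglongrightarrow> cinner (L x) y"
    using contractions_weakly_sequentially_compact[OF separable, of "\<lambda>k. W (\<tau> k)"] bclin contraction \<tau>(1)
    by blast
  have \<tau>r: "filterlim (\<lambda>k. \<tau> (r k)) at_top sequentially"
    using filterlim_compose[OF \<tau>(2) filterlim_subseq[OF r]] .
  have LU: "L x \<in> U" for x
    by (rule weak_cluster_point_in_U[OF \<tau>(1) \<tau>r lim])
  have L_P: "L (cproj U x) = L x" for x
  proof -
    have "(\<lambda>k. cinner (W (\<tau> (r k)) (x - cproj U x)) (L (x - cproj U x))) \<longlonglongrightarrow> 0"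
      by (simp add: cinner_W_cortho LU \<tau>(1))
    then have "cinner (L (x - cproj U x)) (L (x - cproj U x)) = 0"
      using LIMSEQ_unique[OF lim] by blast
    then show ?thesis by (simp add: cinner_self bclin_D[OF L])
  qed
  have "L \<in> lim_ops"
    unfolding lim_ops_def limit_along_def
  proof (intro CollectI conjI exI)
    show "L \<in> operators_on U" by (rule operators_onI[OF U_closed L LU L_P])
    show "\<forall>x y. (\<lambda>k. cinner (W (\<tau> (r k)) (cproj U x)) y) \<longlonglongrightarrow> cinner (L x) y"
      using lim[of "cproj U _"] by (simp add: L_P)
  qed (use \<tau> \<tau>r in auto)
  then show ?thesis using r lim by blast
qed

text \<open>The common kernel of the limit operators.  It contains the orthogonal complement of the unitary
  part.\<close>

definition K :: "'a set" where "K = {x. \<forall>L\<in>lim_ops. L x = 0}"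

lemma csubspace_K: "csubspace K"
  using lim_opsD(1) by (auto simp: K_def csubspace_def bclin_D)

lemma closed_K: "closed K"
proof -
  have "K = (\<Inter>L\<in>lim_ops. {x. L x = 0})" by (auto simp: K_def)
  then show ?thesis by (auto intro!: closed_INT closed_kernel lim_opsD(1))
qed

text \<open>It consists of the weakly stable vectors.\<close>

lemma K_iff_weakly_stable:
  "x \<in> K \<longleftrightarrow> (\<forall>y. \<forall>e>0. \<exists>b. \<forall>t\<in>I. b \<le> t \<longrightarrow> cmod (cinner (W t x) y) < e)"
proof
  assume x: "x \<in> K"
  show "\<forall>y. \<forall>e>0. \<exists>b. \<forall>t\<in>I. b \<le> t \<longrightarrow> cmod (cinner (W t x) y) < e"
  proof (rule ccontr)
    assume "\<not> ?thesis"
    then obtain y e where e: "e > 0" "\<And>b. \<exists>t\<in>I. b \<le> t \<and> e \<le> cmod (cinner (W t x) y)"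
      by (meson not_le)
    then have "\<forall>k::nat. \<exists>t. t \<in> I \<and> real k \<le> t \<and> e \<le> cmod (cinner (W t x) y)" by blast
    from choice[OF this] obtain \<tau> where
      "\<forall>k::nat. \<tau> k \<in> I \<and> real k \<le> \<tau> k \<and> e \<le> cmod (cinner (W (\<tau> k) x) y)" ..
    then have \<tau>: "\<And>k. \<tau> k \<in> I" "\<And>k. real k \<le> \<tau> k" "\<And>k. e \<le> cmod (cinner (W (\<tau> k) x) y)"
      by auto
    have "filterlim \<tau> at_top sequentially"
      by (rule filterlim_at_top_mono[OF filterlim_real_sequentially]) (simp add: \<tau>)
    from subsequence_in_lim_ops[OF \<tau>(1) this] obtain r L where L: "L \<in> lim_ops" and
      lim: "(\<lambda>k. cinner (W (\<tau> (r k)) x) y) \<longlonglongrightarrow> cinner (L x) y" by blast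
    have "e \<le> cmod (cinner (L x) y)"
      by (rule LIMSEQ_le_const[OF tendsto_norm[OF lim]]) (use \<tau>(3) in auto)
    moreover have "L x = 0" using x L by (simp add: K_def)
    ultimately show False using e(1) by simp
  qed
next
  assume *: "\<forall>y. \<forall>e>0. \<exists>b. \<forall>t\<in>I. b \<le> t \<longrightarrow> cmod (cinner (W t x) y) < e"
  show "x \<in> K" unfolding K_def
  proof (intro CollectI ballI cinner_eq_zeroI)
    fix L y assume L: "L \<in> lim_ops"
    then obtain \<tau> where "limit_along \<tau> L" by (rule lim_opsE)
    note \<tau> = limit_alongD(1,2)[OF this] and lim = limit_alongD(3)[OF this]
    have "cinner (W (\<tau> k) (cproj U x)) y = cinner (W (\<tau> k) x) (cproj U y)" for k
      by (metis \<tau>(1) cinner_cproj[OF U_closed] cproj_W)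
    then have lim': "(\<lambda>k. cinner (W (\<tau> k) x) (cproj U y)) \<longlonglongrightarrow> cinner (L x) y" using lim[of x y] by simp
    have "(\<lambda>k. cinner (W (\<tau> k) x) (cproj U y)) \<longlonglongrightarrow> 0"
    proof (rule tendstoI)
      fix e :: real assume "e > 0"
      then obtain b where "\<forall>t\<in>I. b \<le> t \<longrightarrow> cmod (cinner (W t x) (cproj U y)) < e" using * by blast
      moreover have "\<forall>\<^sub>F k in sequentially. b \<le> \<tau> k" using \<tau>(2) by (simp add: filterlim_at_top)
      ultimately show "\<forall>\<^sub>F k in sequentially. dist (cinner (W (\<tau> k) x) (cproj U y)) 0 < e"
        by (elim eventually_mono) (simp add: \<tau>(1))
    qed
    then show "cinner (L x) y = 0" using lim' LIMSEQ_unique by blast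
  qed
qed

lemma lim_ops_W_comm:
  assumes L: "L \<in> lim_ops" and s: "s \<in> I"
  shows "L (W s x) = W s (L x)" and "L (V s x) = V s (L x)"
proof -
  obtain \<tau> where "limit_along \<tau> L" using L by (rule lim_opsE)
  note \<tau> = limit_alongD(1)[OF this] and lim = limit_alongD(3)[OF this]
  show "L (W s x) = W s (L x)"
  proof (rule cinner_eqI)
    fix y
    have "cinner (W (\<tau> k) (cproj U (W s x))) y = cinner (W (\<tau> k) (cproj U x)) (V s y)" for k
      using \<tau> s by (simp add: cproj_W cinner_V_right W_comm[of s])
    then show "cinner (L (W s x)) y = cinner (W s (L x)) y"
      using lim[of "W s x" y] lim[of x "V s y"] LIMSEQ_unique by (fastforce simp: cinner_V_right s)
  qed
  show "L (V s x) = V s (L x)"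
  proof (rule cinner_eqI)
    fix y
    have "cinner (W (\<tau> k) (cproj U (V s x))) y = cinner (W (\<tau> k) (cproj U x)) (W s y)" for k
      using \<tau> s by (simp add: cproj_V cinner_V_left[symmetric] V_W_comm cproj_U_in)
    then show "cinner (L (V s x)) y = cinner (V s (L x)) y"
      using lim[of "V s x" y] lim[of x "W s y"] LIMSEQ_unique by (fastforce simp: cinner_V_left s)
  qed
qed

lemma lim_ops_mult:
  assumes L: "L \<in> lim_ops" and s: "s \<in> I"
  shows "W s \<circ> L \<in> lim_ops" and "V s \<circ> L \<in> lim_ops"
proof -
  obtain \<tau> where "limit_along \<tau> L" using L by (rule lim_opsE)
  note \<tau> = limit_alongD(1,2)[OF this] and lim = limit_alongD(3)[OF this]
  show "W s \<circ> L \<in> lim_ops" unfolding lim_ops_def limit_along_def limit_along_def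
  proof (intro CollectI conjI exI allI)
    show "W s \<circ> L \<in> operators_on U"
      using L s by (intro operators_onI[OF U_closed])
        (auto intro: bclin_compose bclin W_U simp: lim_opsD)
    show "filterlim (\<lambda>k. s + \<tau> k) at_top sequentially"
      by (rule filterlim_tendsto_add_at_top[OF tendsto_const \<tau>(2)])
    show "s + \<tau> k \<in> I" for k by (intro index_add s \<tau>)
    show "(\<lambda>k. cinner (W (s + \<tau> k) (cproj U x)) y) \<longlonglongrightarrow> cinner ((W s \<circ> L) x) y" for x y
      using lim[of x "V s y"] by (simp add: W_add_apply s \<tau> cinner_V_right)
  qed
  obtain \<sigma> where \<sigma>: "\<And>k::nat. \<sigma> k \<in> I" "filterlim \<sigma> at_top sequentially"
    and ev: "\<forall>\<^sub>F k in sequentially. \<forall>x. W (\<tau> k) x = W s (W (\<sigma> k) x)"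
    using shifted_index[OF s \<tau>] by blast
  show "V s \<circ> L \<in> lim_ops" unfolding lim_ops_def limit_along_def limit_along_def
  proof (intro CollectI conjI exI allI)
    show "V s \<circ> L \<in> operators_on U"
      using L s by (intro operators_onI[OF U_closed])
        (auto intro: bclin_compose bclin_V V_U simp: lim_opsD)
    show "\<sigma> k \<in> I" for k by (rule \<sigma>(1))
    show "filterlim \<sigma> at_top sequentially" by (rule \<sigma>(2))
    fix x y
    have "(\<lambda>k. cinner (W (\<tau> k) (cproj U x)) (W s y)) \<longlonglongrightarrow> cinner ((V s \<circ> L) x) y"
      using lim[of x "W s y"] by (simp add: s cinner_V_left)
    then show "(\<lambda>k. cinner (W (\<sigma> k) (cproj U x)) y) \<longlonglongrightarrow> cinner ((V s \<circ> L) x) y"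
    proof (rule Lim_transform_eventually)
      show "\<forall>\<^sub>F k in sequentially. cinner (W (\<tau> k) (cproj U x)) (W s y) = cinner (W (\<sigma> k) (cproj U x)) y"
        using ev
      proof eventually_elim
        case (elim k)
        then show ?case using cinner_V_left[OF s, symmetric] W_U[OF \<sigma>(1) cproj_U_in] s by simp
      qed
    qed
  qed
qed

text \<open>Limit operators commute with the family and its adjoint, and hence are normal.\<close>

lemma lim_ops_normal:
  assumes L: "L \<in> lim_ops" shows "norm (cadjoint L x) = norm (L x)"
proof -
  note B = lim_opsD(1)[OF L]
  note L' = operators_onD[OF U_closed operators_on_cadjoint[OF U_closed subsetD[OF lim_ops_on L]]]
  obtain \<tau> where "limit_along \<tau> L" using L by (rule lim_opsE)
  note \<tau> = limit_alongD(1)[OF this] and lim = limit_alongD(3)[OF this]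
  have comm: "cadjoint L (W s x) = W s (cadjoint L x)" if "s \<in> I" for s x
    by (rule cinner_eqI)
      (simp add: cinner_cadjoint_left[OF B] cinner_V_right[OF that, symmetric] lim_ops_W_comm[OF L that])
  have "cinner (W (\<tau> k) (cproj U (cadjoint L x))) x = cinner (W (\<tau> k) (cproj U x)) (L x)" for k
    using \<tau> by (simp add: L' cinner_cadjoint_left[OF B, symmetric] comm cproj_ident[OF U_closed])
  then have "cinner (L (cadjoint L x)) x = cinner (L x) (L x)"
    using lim[of "cadjoint L x" x] lim[of x "L x"] LIMSEQ_unique by fastforce
  then have "cinner (cadjoint L x) (cadjoint L x) = cinner (L x) (L x)"
    by (simp add: cinner_cadjoint_right[OF B])
  then have "(norm (cadjoint L x))\<^sup>2 = (norm (L x))\<^sup>2" unfolding cinner_self of_real_eq_iff .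
  then show ?thesis by (simp add: power2_eq_iff_nonneg)
qed

abbreviation M :: "('a \<Rightarrow> 'a) set" where "M \<equiv> limit_algebra U lim_ops"

lemmas M_rules = limit_algebra_superset[OF U_closed lim_ops_on, THEN subsetD]
  limit_algebra_on[OF U_closed lim_ops_on]
  limit_algebra_add[OF U_closed lim_ops_on]
  limit_algebra_scaleC[OF U_closed lim_ops_on]
  limit_algebra_compose[OF U_closed lim_ops_on]
  limit_algebra_cadjoint[OF U_closed lim_ops_on]
  limit_algebra_zero[OF U_closed lim_ops_on]

text \<open>By normality, \<open>K\<close> is also killed by the adjoints of the limit operators, so that the operators
  vanishing on \<open>K\<close> together with their adjoints form a weakly closed algebra containing them.\<close>

lemma limit_algebra_vanishes_on_K:
  assumes X: "X \<in> M" and x: "x \<in> K" shows "X x = 0"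
proof -
  define N where "N = {X \<in> operators_on U. \<forall>x\<in>K. \<forall>y. cinner (X x) y = 0 \<and> cinner (X y) x = 0}"
  have N: "X \<in> N \<longleftrightarrow> X \<in> operators_on U \<and> (\<forall>x\<in>K. X x = 0 \<and> cadjoint X x = 0)" for X
  proof -
    have "(\<forall>y. cinner (X x) y = 0 \<and> cinner (X y) x = 0) \<longleftrightarrow> X x = 0 \<and> cadjoint X x = 0"
      if "X \<in> operators_on U" for x
    proof -
      note bc = operators_onD(1)[OF U_closed that]
      have "cadjoint X x = 0" if "\<forall>y. cinner (X y) x = 0"
        using that cinner_self[of "cadjoint X x"] by (simp add: cinner_cadjoint_right[OF bc])
      moreover have "X x = 0" if "\<forall>y. cinner (X x) y = 0"
        using that by (intro cinner_eq_zeroI) simp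
      moreover have "cinner (X y) x = 0" if "cadjoint X x = 0" for y
        using that cinner_cadjoint_right[OF bc, of y x] by simp
      ultimately show ?thesis by auto
    qed
    then show ?thesis by (auto simp: N_def)
  qed
  have "M \<subseteq> N"
  proof (rule limit_algebra_minimal[OF U_closed lim_ops_on])
    show "lim_ops \<subseteq> N"
    proof
      fix L assume L: "L \<in> lim_ops"
      have "L x = 0 \<and> cadjoint L x = 0" if "x \<in> K" for x
      proof -
        have "L x = 0" using that L by (simp add: K_def)
        then show ?thesis using lim_ops_normal[OF L, of x] by simp
      qed
      then show "L \<in> N" using subsetD[OF lim_ops_on L] by (simp add: N)
    qed
    have *: "cadjoint A \<in> N" if "A \<in> N" for A
      using that operators_on_cadjoint[OF U_closed] cadjoint_cadjoint[OF operators_onD(1)[OF U_closed]]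
      by (simp add: N)
    have comp: "A \<circ> B \<in> N" if "A \<in> N" "B \<in> N" for A B
    proof -
      have A: "A \<in> operators_on U" and B: "B \<in> operators_on U" using that by (auto simp: N)
      note bA = operators_onD(1)[OF U_closed A] and bB = operators_onD(1)[OF U_closed B]
      have "A \<circ> B \<in> operators_on U"
        using star_subalgebra_operators_on[OF U_closed] A B unfolding star_subalgebra_def by blast
      then show ?thesis
        using that by (simp add: N cadjoint_compose[OF bA bB] bclin_D(6)[OF bA]
            bclin_D(6)[OF bclin_cadjoint[OF bB]])
    qed
    have add: "(\<lambda>x. A x + B x) \<in> N" if "A \<in> N" "B \<in> N" for A B
    proof -
      have "(\<lambda>x. A x + B x) \<in> operators_on U"
        using star_subalgebra_operators_on[OF U_closed] that unfolding star_subalgebra_def N_def by blast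
      then show ?thesis using that by (simp add: N_def cinner_add_left)
    qed
    have scale: "(\<lambda>x. c *\<^sub>C A x) \<in> N" if "A \<in> N" for A c
    proof -
      have "(\<lambda>x. c *\<^sub>C A x) \<in> operators_on U"
        using star_subalgebra_operators_on[OF U_closed] that unfolding star_subalgebra_def N_def by blast
      then show ?thesis using that by (simp add: N_def cinner_scaleC_left)
    qed
    have zero: "(\<lambda>x. 0) \<in> N"
      using M_rules(2)[OF M_rules(7)] by (simp add: N_def)
    show "star_subalgebra U N"
      unfolding star_subalgebra_def
    proof (intro conjI ballI allI)
      show "N \<subseteq> operators_on U" by (auto simp: N_def)
    qed (rule * add scale comp zero; assumption)+
    have "closedin (weak_operator_topology U) {X \<in> topspace (weak_operator_topology U). cinner (X x) y \<in> {0}}" for x y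
      by (rule closedin_continuous_map_preimage[OF continuous_map_weak_operator_eval[OF U_closed]]) simp
    then have c: "closedin (weak_operator_topology U) {X \<in> operators_on U. cinner (X x) y = 0}" for x y
      by (simp add: topspace_weak_operator_topology[OF U_closed])
    have "N = (\<Inter>p \<in> K \<times> UNIV. {X \<in> operators_on U. cinner (X (fst p)) (snd p) = 0} \<inter>
        {X \<in> operators_on U. cinner (X (snd p)) (fst p) = 0})"
      using csubspace_0[OF csubspace_K] by (auto simp: N_def)
    also have "closedin (weak_operator_topology U) \<dots>"
      using csubspace_0[OF csubspace_K] by (intro closedin_INT closedin_Int c) auto
    finally show "closedin (weak_operator_topology U) N" .
  qed
  then show ?thesis using X x N by blast
qed

text \<open>Multiplication on both sides, by the family and by its adjoint, is considered at once, in order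
  to obtain a set of operators closed under adjoints.\<close>

lemma W_mult_limit_algebra:
  assumes t: "t \<in> I" and X: "X \<in> M" shows "W t \<circ> X \<in> M"
proof -
  define N where "N = {X \<in> operators_on U. X \<in> M \<and> W t \<circ> X \<in> M \<and> V t \<circ> X \<in> M \<and> X \<circ> W t \<in> M \<and> X \<circ> V t \<in> M}"
  note ops = M_rules(2)
  note bc = operators_onD(1)[OF U_closed ops]
  have NI: "X \<in> N" if "X \<in> M" "W t \<circ> X \<in> M" "V t \<circ> X \<in> M" "X \<circ> W t \<in> M" "X \<circ> V t \<in> M" for X
    using that ops by (simp add: N_def)
  have ND: "X \<in> M" "W t \<circ> X \<in> M" "V t \<circ> X \<in> M" "X \<circ> W t \<in> M" "X \<circ> V t \<in> M" if "X \<in> N" for X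
    using that by (simp_all add: N_def)
  have "M \<subseteq> N"
  proof (rule limit_algebra_minimal[OF U_closed lim_ops_on])
    show "lim_ops \<subseteq> N"
    proof
      fix L assume L: "L \<in> lim_ops"
      have "L \<circ> W t = W t \<circ> L" "L \<circ> V t = V t \<circ> L" using lim_ops_W_comm[OF L t] by auto
      then show "L \<in> N" using lim_ops_mult[OF L t] L M_rules(1) by (intro NI) auto
    qed
    have adj: "cadjoint X \<in> N" if X: "X \<in> N" for X
    proof -
      note XM = ND[OF X]
      have "W t \<circ> cadjoint X = cadjoint (X \<circ> V t)" "V t \<circ> cadjoint X = cadjoint (X \<circ> W t)"
        "cadjoint X \<circ> W t = cadjoint (V t \<circ> X)" "cadjoint X \<circ> V t = cadjoint (W t \<circ> X)"
        using t by (simp_all add: cadjoint_compose bc[OF XM(1)] bclin bclin_V cadjoint_V V_def[symmetric])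
      then show ?thesis by (intro NI; simp only: M_rules(6) XM)
    qed
    have add: "(\<lambda>x. X x + Y x) \<in> N" if "X \<in> N" "Y \<in> N" for X Y
    proof -
      have "W t \<circ> (\<lambda>x. X x + Y x) = (\<lambda>x. (W t \<circ> X) x + (W t \<circ> Y) x)"
        "V t \<circ> (\<lambda>x. X x + Y x) = (\<lambda>x. (V t \<circ> X) x + (V t \<circ> Y) x)"
        "(\<lambda>x. X x + Y x) \<circ> W t = (\<lambda>x. (X \<circ> W t) x + (Y \<circ> W t) x)"
        "(\<lambda>x. X x + Y x) \<circ> V t = (\<lambda>x. (X \<circ> V t) x + (Y \<circ> V t) x)"
        using t by (auto simp: bclin_D bclin bclin_V)
      then show ?thesis
        by (intro NI; simp only: M_rules(3) ND[OF that(1)] ND[OF that(2)])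
    qed
    have scale: "(\<lambda>x. c *\<^sub>C X x) \<in> N" if "X \<in> N" for X c
    proof -
      have "W t \<circ> (\<lambda>x. c *\<^sub>C X x) = (\<lambda>x. c *\<^sub>C (W t \<circ> X) x)"
        "V t \<circ> (\<lambda>x. c *\<^sub>C X x) = (\<lambda>x. c *\<^sub>C (V t \<circ> X) x)"
        "(\<lambda>x. c *\<^sub>C X x) \<circ> W t = (\<lambda>x. c *\<^sub>C (X \<circ> W t) x)"
        "(\<lambda>x. c *\<^sub>C X x) \<circ> V t = (\<lambda>x. c *\<^sub>C (X \<circ> V t) x)"
        using t by (auto simp: bclin_D bclin bclin_V)
      then show ?thesis by (intro NI; simp only: M_rules(4) ND[OF that])
    qed
    have comp: "X \<circ> Y \<in> N" if "X \<in> N" "Y \<in> N" for X Y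
    proof (rule NI)
      note X = ND[OF that(1)] and Y = ND[OF that(2)]
      show "X \<circ> Y \<in> M" by (rule M_rules(5)[OF X(1) Y(1)])
      show "W t \<circ> (X \<circ> Y) \<in> M" "V t \<circ> (X \<circ> Y) \<in> M"
        using M_rules(5)[OF X(2) Y(1)] M_rules(5)[OF X(3) Y(1)] by (simp_all only: o_assoc)
      show "X \<circ> Y \<circ> W t \<in> M" "X \<circ> Y \<circ> V t \<in> M"
        using M_rules(5)[OF X(1) Y(4)] M_rules(5)[OF X(1) Y(5)] by (simp_all only: o_assoc)
    qed
    have zero: "(\<lambda>x. 0) \<in> N"
      by (rule NI) (simp_all add: o_def M_rules(7) bclin_D(6)[OF bclin[OF t]]
          bclin_D(6)[OF bclin_V[OF t]])
    show "star_subalgebra U N"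
      unfolding star_subalgebra_def
    proof (intro conjI ballI allI)
      show "N \<subseteq> operators_on U" by (auto simp: N_def)
    qed (rule adj add scale comp zero; assumption)+
    have N_eq: "N = M \<inter> ({X \<in> operators_on U. W t \<circ> X \<in> M} \<inter> ({X \<in> operators_on U. V t \<circ> X \<in> M} \<inter>
      ({X \<in> operators_on U. X \<circ> W t \<in> M} \<inter> {X \<in> operators_on U. X \<circ> V t \<in> M})))"
      using ops by (auto simp: N_def)
    show "closedin (weak_operator_topology U) N"
      unfolding N_eq
      by (intro closedin_Int closedin_limit_algebra closedin_weak_operator_compose_left
          closedin_weak_operator_compose_right U_closed lim_ops_on bclin bclin_V t
          cproj_W cproj_V) (auto simp: W_U V_U t)
  qed
  then show ?thesis using X by (auto simp: N_def)
qed

end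

section \<open>The unit of the limit algebra\<close>

text \<open>For a self-adjoint operator \<open>0 \<le> A \<le> 1\<close> the even powers of \<open>1 - A\<close> converge strongly to the
  projection onto the kernel of \<open>A\<close>.\<close>

lemma even_powers_tendsto_kernel_projection:
  fixes A :: "'a::chilbert_space \<Rightarrow> 'a"
  assumes A: "bounded_clinear A" and sa: "\<And>x y. cinner (A x) y = cinner x (A y)"
    and pos: "\<And>x. 0 \<le> Re (cinner (A x) x)" and le: "\<And>x. Re (cinner (A x) x) \<le> (norm x)\<^sup>2"
  shows "(\<lambda>n. ((\<lambda>x. x - A x) ^^ (2 * n)) x) \<longlonglongrightarrow> cproj {x. A x = 0} x"
proof -
  define B where "B = (\<lambda>x. x - A x)"
  have bB: "bounded_clinear B" unfolding B_def by (intro bclin_diff bclin_ident A)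
  have B_contr: "norm (B x) \<le> norm x" for x
  proof -
    have "0 \<le> Re (cinner (A (x - A x)) (x - A x))" by (rule pos)
    also have "\<dots> = Re (cinner (A x) x) - 2 * (norm (A x))\<^sup>2 + Re (cinner (A (A x)) (A x))"
      by (simp add: bclin_D[OF A] cinner_simps sa[of "A x" x] cinner_self)
    also have "\<dots> \<le> Re (cinner (A x) x) - (norm (A x))\<^sup>2" using le[of "A x"] by simp
    finally have "(norm (B x))\<^sup>2 \<le> (norm x)\<^sup>2"
      using pos[of x] cinner_commute[of x "A x"] by (simp add: B_def norm_diff_sqr)
    then show ?thesis by (rule power2_le_imp_le) simp
  qed
  have sB: "cinner ((B ^^ n) x) y = cinner x ((B ^^ n) y)" for n x y
  proof (induction n arbitrary: y)
    case (Suc n)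
    have "cinner (B u) y = cinner u (B y)" for u by (simp add: B_def cinner_simps sa)
    then have "cinner ((B ^^ Suc n) x) y = cinner x ((B ^^ n) (B y))" by (simp add: Suc.IH)
    then show ?case by (simp add: funpow_swap1)
  qed simp
  have B_add: "(B ^^ m) ((B ^^ n) x) = (B ^^ (m + n)) x" for m n x by (simp add: funpow_add)
  define a where "a = (\<lambda>n. (norm ((B ^^ n) x))\<^sup>2)"
  have "decseq a" unfolding a_def
    by (intro decseq_SucI power_mono) (auto simp: B_contr)
  moreover have "0 \<le> a n" for n by (simp add: a_def)
  ultimately obtain l where l: "a \<longlonglongrightarrow> l" using decseq_convergent[of a 0] by blast
  have ip: "cinner ((B ^^ (2 * m)) x) ((B ^^ (2 * n)) x) = a (m + n)" for m n
  proof -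
    have "cinner ((B ^^ (2 * m)) x) ((B ^^ (2 * n)) x) = cinner x ((B ^^ (2 * m + 2 * n)) x)"
      by (simp only: sB B_add)
    also have "\<dots> = cinner x ((B ^^ (m + n)) ((B ^^ (m + n)) x))"
    proof -
      have "2 * m + 2 * n = (m + n) + (m + n)" by simp
      then show ?thesis by (simp only: B_add)
    qed
    also have "\<dots> = a (m + n)" by (simp only: sB[symmetric] cinner_self a_def)
    finally show ?thesis .
  qed
  have "Cauchy (\<lambda>n. (B ^^ (2 * n)) x)"
  proof (rule metric_CauchyI)
    fix e :: real assume e: "e > 0"
    then have "\<forall>\<^sub>F n in sequentially. dist (a n) l < e\<^sup>2 / 4" by (intro tendstoD[OF l]) auto
    then obtain N where N: "\<And>n. n \<ge> N \<Longrightarrow> \<bar>a n - l\<bar> < e\<^sup>2 / 4"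
      by (auto simp: eventually_sequentially dist_real_def)
    show "\<exists>N. \<forall>m\<ge>N. \<forall>n\<ge>N. dist ((B ^^ (2 * m)) x) ((B ^^ (2 * n)) x) < e"
    proof (intro exI allI impI)
      fix m n assume mn: "N \<le> m" "N \<le> n"
      have "(dist ((B ^^ (2 * m)) x) ((B ^^ (2 * n)) x))\<^sup>2 = a (2 * m) - 2 * a (m + n) + a (2 * n)"
        unfolding dist_norm norm_diff_sqr ip by (simp add: a_def)
      also have "\<dots> < e\<^sup>2"
      proof -
        have "\<bar>a (2 * m) - l\<bar> < e\<^sup>2 / 4" "\<bar>a (m + n) - l\<bar> < e\<^sup>2 / 4" "\<bar>a (2 * n) - l\<bar> < e\<^sup>2 / 4"
          using mn by (intro N; simp)+
        then show ?thesis unfolding abs_less_iff by linarith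
      qed
      finally show "dist ((B ^^ (2 * m)) x) ((B ^^ (2 * n)) x) < e"
        using e by (simp add: power2_less_imp_less)
    qed
  qed
  then obtain q where q: "(\<lambda>n. (B ^^ (2 * n)) x) \<longlonglongrightarrow> q"
    by (auto simp: Cauchy_convergent_iff convergent_def)
  have "(\<lambda>n. B (B ((B ^^ (2 * n)) x))) \<longlonglongrightarrow> B (B q)"
    by (rule tendsto_bclin[OF bB tendsto_bclin[OF bB q]])
  then have "(\<lambda>n. (B ^^ (2 * Suc n)) x) \<longlonglongrightarrow> B (B q)" by simp
  then have "B (B q) = q" using LIMSEQ_Suc[OF q] LIMSEQ_unique by blast
  then have "A (A q) = A q + A q"
    by (simp add: B_def bclin_D[OF A] algebra_simps)
  then have "Re (cinner (A (A q)) (A q)) = 2 * (norm (A q))\<^sup>2" by (simp add: cinner_simps cinner_self)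
  then have "(norm (A q))\<^sup>2 \<le> 0" using le[of "A q"] by simp
  then have Aq: "A q = 0" by simp
  have "cproj {x. A x = 0} x = q"
  proof (rule cproj_eqI[OF csubspace_kernel[OF A]])
    have "cinner (x - q) k = 0" if k: "A k = 0" for k
    proof -
      have "(B ^^ n) k = k" for n by (induction n) (simp_all add: B_def k)
      then have "(\<lambda>n. cinner (x - (B ^^ (2 * n)) x) k) = (\<lambda>n. 0)"
        by (simp add: cinner_diff_left sB)
      moreover have "(\<lambda>n. cinner (x - (B ^^ (2 * n)) x) k) \<longlonglongrightarrow> cinner (x - q) k"
        by (intro tendsto_cinner tendsto_diff tendsto_const q)
      ultimately show ?thesis using LIMSEQ_unique tendsto_const by metis
    qed
    then show "x - q \<in> cortho {x. A x = 0}" by (simp add: cortho_def)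
  qed (simp add: Aq)
  then show ?thesis using q by (simp add: B_def)
qed

text \<open>In a separable space, the common kernel of a set of bounded operators is already the common
  kernel of countably many of them.\<close>

lemma countable_common_kernel:
  fixes \<Omega> :: "('a::chilbert_space \<Rightarrow> 'a) set"
  assumes sep: "separable_space (euclidean :: 'a topology)"
    and \<Omega>: "\<And>L. L \<in> \<Omega> \<Longrightarrow> bounded_clinear L" and zero: "(\<lambda>x. 0) \<in> \<Omega>"
  shows "\<exists>L :: nat \<Rightarrow> 'a \<Rightarrow> 'a. (\<forall>k. L k \<in> \<Omega>) \<and> (\<forall>x. (\<forall>k. L k x = 0) \<longrightarrow> (\<forall>A\<in>\<Omega>. A x = 0))"
proof -
  obtain D :: "'a set" where D: "countable D" "closure D = UNIV"
    using sep by (auto simp: separable_space_def)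
  then have "D \<noteq> {}" by auto
  define d where "d = from_nat_into D"
  have d: "\<exists>n. dist (d n) x < e" if "e > 0" for x e
    using that D closure_approachable[of x D] from_nat_into_surj[OF D(1)] by (metis UNIV_I d_def)
  define good where "good = (\<lambda>i j A. A \<in> \<Omega> \<and> (\<forall>x. dist (d i) x < 1 / Suc j \<longrightarrow> A x \<noteq> (0::'a)))"
  define L where "L = (\<lambda>k. if \<exists>A. good (fst (prod_decode k)) (snd (prod_decode k)) A
    then SOME A. good (fst (prod_decode k)) (snd (prod_decode k)) A else (\<lambda>x. 0))"
  have good_L: "good i j (L (prod_encode (i, j)))" if "good i j A" for i j A
    using someI[of "good i j", OF that] that by (auto simp: L_def)
  have "L k \<in> \<Omega>" for k
    using someI_ex[of "good (fst (prod_decode k)) (snd (prod_decode k))"] zero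
    by (auto simp: L_def good_def)
  moreover have "A x = 0" if x: "\<forall>k. L k x = 0" and A: "A \<in> \<Omega>" for x A
  proof (rule ccontr)
    assume "A x \<noteq> 0"
    have "open (- {x. A x = 0})" using closed_kernel[OF \<Omega>[OF A]] by (simp add: open_Compl)
    then obtain e where e: "e > 0" "\<And>y. dist y x < e \<Longrightarrow> A y \<noteq> 0"
      using \<open>A x \<noteq> 0\<close> unfolding open_dist by auto
    obtain j where j: "1 / Suc j < e / 2" using nat_approx_posE[of "e/2"] e(1) by auto
    obtain i where i: "dist (d i) x < 1 / Suc j" using d[of "1 / Suc j" x] by auto
    have "good i j A" unfolding good_def
    proof (intro conjI allI impI A)
      fix y assume "dist (d i) y < 1 / Suc j"
      then have "dist y x < e" using i j dist_triangle2[of y x "d i"] by (simp add: dist_commute)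
      then show "A y \<noteq> 0" by (rule e(2))
    qed
    from good_L[OF this] i x show False by (auto simp: good_def)
  qed
  ultimately show ?thesis by blast
qed

text \<open>The limit algebra contains the projection onto the orthogonal complement of the common kernel of its
  generators, which is its unit.\<close>

lemma limit_algebra_unit:
  fixes S :: "'a::chilbert_space set"
  assumes sep: "separable_space (euclidean :: 'a topology)"
    and S: "csubspace S" "closed S" and \<Omega>: "\<Omega> \<subseteq> operators_on S"
    and contr: "\<And>L x. L \<in> \<Omega> \<Longrightarrow> norm (L x) \<le> norm x"
  shows "(\<lambda>x. x - cproj {x. \<forall>L\<in>\<Omega>. L x = 0} x) \<in> limit_algebra S \<Omega>"
proof -
  let ?M = "limit_algebra S \<Omega>"
  have bc: "L \<in> insert (\<lambda>x. 0) \<Omega> \<Longrightarrow> bounded_clinear L" for L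
    using \<Omega> by (auto simp: operators_on_def bclin_zero)
  have "\<exists>L :: nat \<Rightarrow> 'a \<Rightarrow> 'a. (\<forall>k. L k \<in> insert (\<lambda>x. 0) \<Omega>) \<and>
      (\<forall>x. (\<forall>k. L k x = 0) \<longrightarrow> (\<forall>A\<in>insert (\<lambda>x. 0) \<Omega>. A x = 0))"
    by (rule countable_common_kernel[OF sep bc]) auto
  then obtain L :: "nat \<Rightarrow> 'a \<Rightarrow> 'a" where "(\<forall>k. L k \<in> insert (\<lambda>x. 0) \<Omega>) \<and>
      (\<forall>x. (\<forall>k. L k x = 0) \<longrightarrow> (\<forall>A\<in>insert (\<lambda>x. 0) \<Omega>. A x = 0))" ..
  then have L: "\<And>k. L k \<in> insert (\<lambda>x. 0) \<Omega>"
    and ker: "\<And>x. (\<And>k. L k x = 0) \<Longrightarrow> \<forall>A\<in>\<Omega>. A x = 0" by simp_all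
  note bL = bc[OF L]
  have L_contr: "norm (L k x) \<le> norm x" for k x using L[of k] contr by auto
  have LM: "L k \<in> ?M" for k
    using L[of k] limit_algebra_superset[OF S \<Omega>] limit_algebra_zero[OF S \<Omega>] by auto
  define c where "c = (\<lambda>k::nat. (1/2::real) ^ Suc k)"
  have c: "c sums 1" unfolding c_def by (rule power_half_series)
  have c0: "0 \<le> c k" "0 < c k" for k by (simp_all add: c_def)
  have c1: "sum c {..<n} \<le> 1" for n
    using sum_le_suminf[of c "{..<n}"] sums_unique[OF c] sums_summable[OF c] c0(1) by auto
  define f where "f = (\<lambda>k x. c k *\<^sub>R cadjoint (L k) (L k x))"
  define G where "G = (\<lambda>n x. \<Sum>k<n. f k x)"
  have fM: "f k \<in> ?M" for k
  proof -
    have "(\<lambda>x. complex_of_real (c k) *\<^sub>C (cadjoint (L k) \<circ> L k) x) \<in> ?M"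
      by (intro limit_algebra_scaleC limit_algebra_compose limit_algebra_cadjoint LM S \<Omega>)
    then show ?thesis by (simp add: f_def scaleR_eq_scaleC)
  qed
  have GM: "G n \<in> ?M" for n unfolding G_def by (intro limit_algebra_sum fM S \<Omega>)
  have f_norm: "norm (f k x) \<le> c k * norm x" for k x
    using norm_cadjoint_le[OF bL L_contr, of k "L k x"] L_contr[of k x] c0(1)[of k]
    by (simp add: f_def mult_left_mono)
  have f_ip: "cinner (f k x) x = complex_of_real (c k * (norm (L k x))\<^sup>2)" for k x
    by (simp add: f_def cinner_scaleR_left cinner_cadjoint_left[OF bL] cinner_self scaleR_conv_of_real)
  have f_sa: "cinner (f k x) y = cinner x (f k y)" for k x y
    by (simp add: f_def cinner_scaleR_left cinner_scaleR_right cinner_cadjoint_left[OF bL]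
        cinner_cadjoint_right[OF bL])
  have G_ip: "cinner (G n x) y = (\<Sum>k<n. cinner (f k x) y)" for n x y
    unfolding G_def by (rule bounded_bilinear.sum_left[OF bounded_bilinear_cinner])
  have G_ip': "cinner x (G n y) = (\<Sum>k<n. cinner x (f k y))" for n x y
    unfolding G_def by (rule bounded_bilinear.sum_right[OF bounded_bilinear_cinner])
  have G_norm: "norm (G n x) \<le> norm x * 1" for n x
  proof -
    have "norm (G n x) \<le> (\<Sum>k<n. c k * norm x)"
      unfolding G_def by (intro order_trans[OF norm_sum] sum_mono f_norm)
    also have "\<dots> = sum c {..<n} * norm x" by (simp add: sum_distrib_right)
    also have "\<dots> \<le> 1 * norm x" by (intro mult_right_mono c1) simp
    finally show ?thesis by simp
  qed
  define A where "A = (\<lambda>x. \<Sum>k. f k x)"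
  have lim: "(\<lambda>n. G n x) \<longlonglongrightarrow> A x" for x
  proof -
    have "summable (\<lambda>k. c k * norm x)" using sums_summable[OF c] by (rule summable_mult2)
    then have "summable (\<lambda>k. f k x)" by (rule summable_comparison_test') (rule f_norm)
    then show ?thesis unfolding A_def G_def by (rule summable_LIMSEQ)
  qed
  note G_bc = operators_onD(1)[OF S limit_algebra_on[OF S \<Omega> GM]]
  have bA: "bounded_clinear A"
  proof (rule bclinI[where K = 1])
    fix x y :: 'a and a :: complex
    have "(\<lambda>n. G n (x + y)) \<longlonglongrightarrow> A x + A y"
      using tendsto_add[OF lim lim] by (simp add: bclin_D[OF G_bc])
    then show "A (x + y) = A x + A y" using lim LIMSEQ_unique by blast
    have "(\<lambda>n. G n (a *\<^sub>C x)) \<longlonglongrightarrow> a *\<^sub>C A x"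
      using tendsto_scaleC[OF lim] by (simp add: bclin_D[OF G_bc])
    then show "A (a *\<^sub>C x) = a *\<^sub>C A x" using lim LIMSEQ_unique by blast
    show "norm (A x) \<le> norm x * 1"
      by (rule LIMSEQ_le_const2[OF tendsto_norm[OF lim]]) (use G_norm in blast)
  qed
  have AM: "A \<in> ?M" by (rule limit_algebra_strong_limit[OF S \<Omega> GM bA lim])
  have sa: "cinner (A x) y = cinner x (A y)" for x y
  proof -
    have "(\<lambda>n. cinner (G n x) y) \<longlonglongrightarrow> cinner (A x) y" "(\<lambda>n. cinner x (G n y)) \<longlonglongrightarrow> cinner x (A y)"
      by (intro tendsto_cinner lim tendsto_const)+
    then show ?thesis using LIMSEQ_unique by (fastforce simp: G_ip G_ip' f_sa)
  qed
  have ip_lim: "(\<lambda>n. \<Sum>k<n. c k * (norm (L k x))\<^sup>2) \<longlonglongrightarrow> Re (cinner (A x) x)" for x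
  proof -
    have "(\<lambda>n. Re (cinner (G n x) x)) \<longlonglongrightarrow> Re (cinner (A x) x)"
      by (intro tendsto_Re tendsto_cinner lim tendsto_const)
    then show ?thesis by (simp add: G_ip f_ip)
  qed
  have summand_le: "c k * (norm (L k x))\<^sup>2 \<le> Re (cinner (A x) x)" for k x
  proof (rule LIMSEQ_le_const[OF ip_lim], intro exI allI impI)
    fix n assume "Suc k \<le> n"
    then show "c k * (norm (L k x))\<^sup>2 \<le> (\<Sum>k<n. c k * (norm (L k x))\<^sup>2)"
      using c0(1) by (intro member_le_sum) auto
  qed
  have pos: "0 \<le> Re (cinner (A x) x)" for x
    using summand_le[of 0 x] c0(1)[of 0] by (meson mult_nonneg_nonneg order_trans zero_le_power2)
  have le: "Re (cinner (A x) x) \<le> (norm x)\<^sup>2" for x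
  proof -
    have "norm (A x) \<le> norm x"
      by (rule LIMSEQ_le_const2[OF tendsto_norm[OF lim]]) (use G_norm in auto)
    then have "norm (A x) * norm x \<le> norm x * norm x" by (rule mult_right_mono) simp
    then show ?thesis
      using complex_Re_le_cmod[of "cinner (A x) x"] norm_cinner_le[of "A x" x]
      by (simp add: power2_eq_square)
  qed
  have kernel: "{x. A x = 0} = {x. \<forall>L\<in>\<Omega>. L x = 0}"
  proof (intro set_eqI iffI; clarsimp)
    fix x B assume "A x = 0" "B \<in> \<Omega>"
    have "L k x = 0" for k
    proof -
      have "c k * (norm (L k x))\<^sup>2 \<le> 0" using summand_le[of k x] \<open>A x = 0\<close> by simp
      then show ?thesis using c0(2)[of k] by (simp add: mult_le_0_iff)
    qed
    then show "B x = 0" using ker[of x] \<open>B \<in> \<Omega>\<close> by blast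
  next
    fix x assume "\<forall>L\<in>\<Omega>. L x = 0"
    then have "L k x = 0" for k using L[of k] by auto
    then have "f k x = 0" for k by (simp add: f_def bclin_D[OF bclin_cadjoint[OF bL]])
    then show "A x = 0" by (simp add: A_def)
  qed
  have F: "(\<lambda>x. x - ((\<lambda>x. x - A x) ^^ n) x) \<in> ?M" for n
  proof (induction n)
    case 0 then show ?case by (simp add: limit_algebra_zero[OF S \<Omega>])
  next
    case (Suc n)
    let ?F = "\<lambda>x. x - ((\<lambda>x. x - A x) ^^ n) x"
    have "(\<lambda>x. (?F x + A x) - (A \<circ> ?F) x) \<in> ?M"
      by (intro limit_algebra_diff limit_algebra_add limit_algebra_compose Suc.IH AM S \<Omega>)
    then show ?case by (simp add: bclin_D[OF bA] algebra_simps)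
  qed
  have cK: "csubspace {x. A x = 0}" "closed {x. A x = 0}"
    by (simp_all add: csubspace_kernel closed_kernel bA)
  have "(\<lambda>x. x - cproj {x. A x = 0} x) \<in> ?M"
  proof (rule limit_algebra_strong_limit[OF S \<Omega> F])
    show "bounded_clinear (\<lambda>x. x - cproj {x. A x = 0} x)"
      by (intro bclin_diff bclin_ident bclin_cproj cK)
    show "(\<lambda>n. x - ((\<lambda>x. x - A x) ^^ (2 * n)) x) \<longlonglongrightarrow> x - cproj {x. A x = 0} x" for x
      by (intro tendsto_diff tendsto_const even_powers_tendsto_kernel_projection bA sa pos le)
  qed
  then show ?thesis by (simp only: kernel)
qed

section \<open>Comparison of two families\<close>

context contraction_family
begin

lemma lim_ops_contraction: assumes L: "L \<in> lim_ops" shows "norm (L x) \<le> norm x"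
proof -
  obtain \<tau> where "limit_along \<tau> L" using L by (rule lim_opsE)
  note \<tau> = limit_alongD(1)[OF this] and lim = limit_alongD(3)[OF this]
  have "cmod (cinner (L x) (L x)) \<le> norm x * norm (L x)"
  proof (rule LIMSEQ_le_const2[OF tendsto_norm[OF lim]], intro exI allI impI)
    fix k
    have "norm (W (\<tau> k) (cproj U x)) \<le> norm x"
      using contraction[OF \<tau>] norm_cproj_le[OF U_closed] order_trans by blast
    then show "cmod (cinner (W (\<tau> k) (cproj U x)) (L x)) \<le> norm x * norm (L x)"
      using norm_cinner_le by (meson mult_right_mono norm_ge_zero order_trans)
  qed
  then have "norm (L x) * norm (L x) \<le> norm x * norm (L x)"
    by (simp add: cinner_self norm_mult power2_eq_square)
  then show ?thesis by (metis mult_right_le_imp_le norm_ge_zero order_le_less)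
qed

lemma limit_algebra_unit_K: "(\<lambda>x. x - cproj K x) \<in> M"
  unfolding K_def
  by (rule limit_algebra_unit) (use separable U_closed lim_ops_on lim_ops_contraction in auto)

text \<open>Limit operators map the unitary vectors of an invariant closed subspace into that subspace.\<close>

lemma lim_ops_invariant:
  assumes Z: "csubspace Z" "closed Z" and a: "a \<in> Z" "a \<in> U"
    and inv: "\<And>t. t \<in> I \<Longrightarrow> W t ` Z \<subseteq> Z" and L: "L \<in> lim_ops"
  shows "L a \<in> Z"
proof (rule cortho_cortho_subset[OF Z])
  fix y assume y: "y \<in> cortho Z"
  obtain \<tau> where "limit_along \<tau> L" using L by (rule lim_opsE)
  note \<tau> = limit_alongD(1)[OF this] and lim = limit_alongD(3)[OF this]
  have "cinner (W (\<tau> k) (cproj U a)) y = 0" for k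
  proof -
    have "W (\<tau> k) a \<in> Z" using inv[OF \<tau>] a by blast
    then have "cinner y (W (\<tau> k) a) = 0" using y by (simp add: cortho_def)
    then show ?thesis using a by (subst cinner_commute) (simp add: cproj_ident[OF U_closed])
  qed
  then show "cinner (L a) y = 0" using lim[of a y] by (simp add: LIMSEQ_const_iff)
qed

text \<open>Up to a vector killed by all limit operators, every vector lies in the closed span of its
  limit orbit.\<close>

lemma limit_subspace_decomposition:
  defines "Z \<equiv> \<lambda>x. limit_subspace lim_ops x"
  shows "csubspace (Z x)" "closed (Z x)" "Z x \<subseteq> U" "\<And>t. t \<in> I \<Longrightarrow> W t ` Z x \<subseteq> Z x"
    "x - cproj (Z x) x \<in> K"
proof -
  show Z: "csubspace (Z x)" "closed (Z x)"
    by (simp_all add: Z_def limit_subspace_def csubspace_closed_cspan closed_closed_cspan)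
  show ZU: "Z x \<subseteq> U"
    unfolding Z_def limit_subspace_def limit_orbit_def
    by (rule closed_cspan_minimal) (auto simp: csubspace_U closed_U lim_opsD)
  have orbit: "L x \<in> Z x" if "L \<in> lim_ops" for L
    unfolding Z_def limit_subspace_def
    by (rule subsetD[OF closed_cspan_superset]) (use that in \<open>auto simp: limit_orbit_def\<close>)
  have inv: "A ` Z x \<subseteq> Z x" if A: "bounded_clinear A" "\<And>L. L \<in> lim_ops \<Longrightarrow> A \<circ> L \<in> lim_ops" for A
  proof -
    have "A ` limit_orbit lim_ops x \<subseteq> Z x"
      using orbit[OF A(2)] by (auto simp: limit_orbit_def)
    then have "A ` closed_cspan (limit_orbit lim_ops x) \<subseteq> Z x"
      by (rule closed_cspan_image_subset[OF A(1) Z])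
    then show ?thesis by (simp add: Z_def limit_subspace_def)
  qed
  show WZ: "W t ` Z x \<subseteq> Z x" if "t \<in> I" for t
    by (rule inv) (use lim_ops_mult bclin that in auto)
  have VZ: "V t ` Z x \<subseteq> Z x" if "t \<in> I" for t
    by (rule inv) (use lim_ops_mult bclin_V that in auto)
  let ?a = "cproj (Z x) x"
  have a: "?a \<in> Z x" by (rule cproj_in[OF Z])
  show "x - ?a \<in> K"
    unfolding K_def
  proof (intro CollectI ballI)
    fix L assume L: "L \<in> lim_ops"
    obtain \<tau> where "limit_along \<tau> L" using L by (rule lim_opsE)
  note \<tau> = limit_alongD(1)[OF this] and lim = limit_alongD(3)[OF this]
    have "L ?a \<in> Z x" using lim_ops_invariant[OF Z a _ WZ L] a ZU by blast
    then have 1: "L (x - ?a) \<in> Z x"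
      using orbit[OF L] csubspace_diff[OF Z(1)] by (simp add: bclin_D[OF lim_opsD(1)[OF L]])
    have "cinner (W (\<tau> k) (cproj U (x - ?a))) z = 0" if z: "z \<in> Z x" for k z
    proof -
      have Vz: "V (\<tau> k) z \<in> Z x" using VZ[OF \<tau>] z by blast
      have "cinner (W (\<tau> k) (cproj U (x - ?a))) z = cinner (x - ?a) (V (\<tau> k) z)"
        using Vz ZU by (simp add: cinner_V_right[OF \<tau>, symmetric] cinner_cproj[OF U_closed]
            cproj_ident[OF U_closed] subset_iff)
      also have "\<dots> = 0" using cproj_ortho[OF Z, of x] Vz by (simp add: cortho_def)
      finally show ?thesis .
    qed
    then have "cinner (L (x - ?a)) z = 0" if "z \<in> Z x" for z
      using lim[of "x - ?a" z] that by (simp add: LIMSEQ_const_iff)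
    from this[OF 1] show "L (x - ?a) = 0" by (simp add: cinner_self)
  qed
qed

end

text \<open>Two families with the same unitary part, the second of which lies in every strongly closed
  algebra containing the first.\<close>

locale contraction_family_pair =
  F: contraction_family I W + F': contraction_family I' W'
  for I :: "real set" and W :: "real \<Rightarrow> 'a::chilbert_space \<Rightarrow> 'a" and I' and W' :: "real \<Rightarrow> 'a \<Rightarrow> 'a" +
  assumes U_eq: "F'.U = F.U"
    and generated: "\<And>N t. strongly_closed_algebra N \<Longrightarrow> (\<forall>t\<in>I. W t \<in> N) \<Longrightarrow> t \<in> I' \<Longrightarrow> W' t \<in> N"
begin

text \<open>A limit operator \<open>L\<close> of the second family vanishes on \<open>K\<close>, so it equals \<open>L E\<close> with the unit \<open>E\<close>
  of the first limit algebra and is a weak limit of elements \<open>W' t E\<close> of that algebra.\<close>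

lemma lim_ops_subset_limit_algebra:
  assumes K: "F'.K = F.K" shows "F'.lim_ops \<subseteq> F.M"
proof
  fix L assume L: "L \<in> F'.lim_ops"
  obtain \<tau> where "F'.limit_along \<tau> L" using L by (rule F'.lim_opsE)
  note \<tau> = F'.limit_alongD(1)[OF this] and lim = F'.limit_alongD(3)[OF this, unfolded U_eq]
  let ?E = "\<lambda>x. x - cproj F.K x"
  have E: "?E \<in> F.M" by (rule F.limit_algebra_unit_K)
  have mult: "W' t \<circ> X \<in> F.M" if "t \<in> I'" "X \<in> F.M" for t X
    using generated[OF strongly_closed_algebra_left_multipliers[OF F.U_closed F.lim_ops_on] _ that(1)]
      F.W_mult_limit_algebra F.bclin that(2) by blast
  show "L \<in> F.M"
  proof (rule limit_algebra_weak_limit[OF F.U_closed F.lim_ops_on])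
    show "W' (\<tau> n) \<circ> ?E \<in> F.M" for n by (rule mult[OF \<tau> E])
    show "L \<in> operators_on F.U" using F'.lim_ops_on L U_eq by auto
    fix x y
    have "cproj F.K x \<in> F'.K" unfolding K by (rule cproj_in[OF F.csubspace_K F.closed_K])
    then have "L (cproj F.K x) = 0" using L by (simp add: F'.K_def)
    then have "L (?E x) = L x" by (simp add: bclin_D[OF F'.lim_opsD(1)[OF L]])
    moreover have "cproj F.U (?E x) = ?E x"
      by (rule cproj_ident[OF F.U_closed operators_onD(2)[OF F.U_closed F.M_rules(2)[OF E]]])
    ultimately show "(\<lambda>n. cinner ((W' (\<tau> n) \<circ> ?E) x) y) \<longlonglongrightarrow> cinner (L x) y"
      using lim[of "?E x" y] by simp
  qed
qed

lemma limit_orbit_subset_limit_subspace: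
  assumes K: "F'.K = F.K" shows "limit_orbit F'.lim_ops x \<subseteq> limit_subspace F.lim_ops x"
proof -
  let ?Z = "limit_subspace F.lim_ops x"
  note Z = F.limit_subspace_decomposition[where x = x]
  have inv: "W' t ` ?Z \<subseteq> ?Z" if "t \<in> I'" for t
    using generated[OF strongly_closed_algebra_stabilizer[OF Z(1,2)] _ that] Z(4) F.bclin by blast
  have "L x \<in> ?Z" if L: "L \<in> F'.lim_ops" for L
  proof -
    have "L (x - cproj ?Z x) = 0" using Z(5) L unfolding K[symmetric] by (simp add: F'.K_def)
    then have "L x = L (cproj ?Z x)" by (simp add: bclin_D[OF F'.lim_opsD(1)[OF L]])
    also have "\<dots> \<in> ?Z"
      using F'.lim_ops_invariant[OF Z(1,2) _ _ inv L] cproj_in[OF Z(1,2)] Z(3) U_eq by blast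
    finally show ?thesis .
  qed
  then show ?thesis by (auto simp: limit_orbit_def)
qed

lemma K_subset_if_limit_algebra_subset:
  assumes "F'.M \<subseteq> F.M" shows "F.K \<subseteq> F'.K"
  using assms F.limit_algebra_vanishes_on_K F'.M_rules(1) by (auto simp: F'.K_def)

lemma K_subset_if_limit_orbit_subset:
  assumes "\<And>x. limit_orbit F'.lim_ops x \<subseteq> limit_subspace F.lim_ops x" shows "F.K \<subseteq> F'.K"
proof
  fix x assume x: "x \<in> F.K"
  have "limit_orbit F.lim_ops x \<subseteq> {0}" using x by (auto simp: limit_orbit_def F.K_def)
  then have "limit_subspace F.lim_ops x \<subseteq> {0}"
    unfolding limit_subspace_def by (rule closed_cspan_minimal) (auto simp: csubspace_def)
  then show "x \<in> F'.K" using assms[of x] by (auto simp: F'.K_def limit_orbit_def)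
qed

end

theorem limit_algebras_eq_iff_kernels_eq:
  assumes "contraction_family_pair I W I' W'" "contraction_family_pair I' W' I W"
  shows "contraction_family.M I W = contraction_family.M I' W' \<longleftrightarrow>
      contraction_family.K I W = contraction_family.K I' W'" (is ?algebra)
    and "entangled (contraction_family.lim_ops I W) (contraction_family.lim_ops I' W') \<longleftrightarrow>
      contraction_family.K I W = contraction_family.K I' W'" (is ?entangled)
proof -
  interpret P: contraction_family_pair I W I' W' by fact
  interpret Q: contraction_family_pair I' W' I W by fact
  have 1: "P.F.M = P.F'.M" if K: "P.F.K = P.F'.K"
  proof (rule antisym)
    note R = star_subalgebra_limit_algebra closedin_limit_algebra
    have "P.F.M \<subseteq> P.F'.M"
      by (rule limit_algebra_minimal[OF P.F.U_closed P.F.lim_ops_on])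
        (use Q.lim_ops_subset_limit_algebra[OF K] R[OF P.F'.U_closed P.F'.lim_ops_on] P.U_eq in auto)
    then show "P.F.M \<subseteq> P.F'.M" .
    have "P.F'.M \<subseteq> P.F.M"
      by (rule limit_algebra_minimal[OF P.F'.U_closed P.F'.lim_ops_on])
        (use P.lim_ops_subset_limit_algebra[OF K[symmetric]] R[OF P.F.U_closed P.F.lim_ops_on] P.U_eq in auto)
    then show "P.F'.M \<subseteq> P.F.M" .
  qed
  show ?algebra
    using 1 P.K_subset_if_limit_algebra_subset Q.K_subset_if_limit_algebra_subset by blast
  show ?entangled
    unfolding entangled_def
    using P.limit_orbit_subset_limit_subspace Q.limit_orbit_subset_limit_subspace
      P.K_subset_if_limit_orbit_subset Q.K_subset_if_limit_orbit_subset by (metis subset_antisym)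
qed

section \<open>Resolvents of a contraction semigroup\<close>

locale contraction_semigroup =
  fixes T :: "real \<Rightarrow> 'a::chilbert_space \<Rightarrow> 'a"
  assumes C0: "C0_contraction_semigroup T"
begin

lemma bclin: "0 \<le> t \<Longrightarrow> bounded_clinear (T t)"
  and contraction: "0 \<le> t \<Longrightarrow> norm (T t x) \<le> norm x"
  and T_0: "T 0 = id"
  and T_add: "0 \<le> s \<Longrightarrow> 0 \<le> t \<Longrightarrow> T (s + t) = T s \<circ> T t"
  and continuous_at_0: "((\<lambda>t. T t x) \<longlongrightarrow> x) (at_right 0)"
  using C0 by (auto simp: C0_contraction_semigroup_def)

lemma T_add_apply: "0 \<le> s \<Longrightarrow> 0 \<le> t \<Longrightarrow> T (s + t) x = T s (T t x)"
  by (simp add: T_add)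

lemma T_comm: "0 \<le> s \<Longrightarrow> 0 \<le> t \<Longrightarrow> T s (T t x) = T t (T s x)"
  by (simp add: T_add_apply[symmetric] add.commute)

lemma T_diff_le:
  assumes "0 \<le> s" "s \<le> t" shows "norm (T t x - T s x) \<le> norm (T (t - s) x - x)"
proof -
  have "T t x - T s x = T s (T (t - s) x - x)"
    using assms T_add_apply[of s "t - s" x] by (simp add: bclin_D[OF bclin])
  then show ?thesis using contraction[OF assms(1)] by simp
qed

lemma continuous_on_orbit: "continuous_on {0..} (\<lambda>t. T t x)"
  unfolding continuous_on_iff
proof (intro ballI allI impI)
  fix s e :: real assume s: "s \<in> {0..}" and e: "e > 0"
  have "\<forall>\<^sub>F h in at_right 0. dist (T h x) x < e" by (rule tendstoD[OF continuous_at_0 e])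
  then obtain d where d: "d > 0" "\<And>h. 0 < h \<Longrightarrow> h < d \<Longrightarrow> dist (T h x) x < e"
    unfolding eventually_at_right_field by auto
  then have d': "norm (T h x - x) < e" if "0 \<le> h" "h < d" for h
    using that e by (cases "h = 0") (auto simp: T_0 dist_norm)
  show "\<exists>d>0. \<forall>t\<in>{0..}. dist t s < d \<longrightarrow> dist (T t x) (T s x) < e"
  proof (intro exI conjI ballI impI)
    fix t assume t: "t \<in> {0..}" "dist t s < d"
    show "dist (T t x) (T s x) < e"
    proof (cases "s \<le> t")
      case True
      then show ?thesis using T_diff_le[of s t x] d'[of "t - s"] s t by (simp add: dist_norm)
    next
      case False
      then show ?thesis using T_diff_le[of t s x] d'[of "s - t"] s t
        by (simp add: dist_norm norm_minus_commute)
    qed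
  qed (rule d(1))
qed

text \<open>The generator as a relation: \<open>x\<close> lies in its domain and is mapped to \<open>y\<close>.\<close>

definition is_gen :: "'a \<Rightarrow> 'a \<Rightarrow> bool" where
  "is_gen x y \<longleftrightarrow> ((\<lambda>h. (T h x - x) /\<^sub>R h) \<longlongrightarrow> y) (at_right 0)"

lemma generator_eq: "is_gen x y \<Longrightarrow> generator T x = y"
  unfolding generator_def is_gen_def by (rule tendsto_Lim) simp_all

lemma generator_domain_iff: "x \<in> generator_domain T \<longleftrightarrow> (\<exists>y. is_gen x y)"
  by (simp add: generator_domain_def is_gen_def)

lemma eventually_pos: "\<forall>\<^sub>F h::real in at_right 0. 0 < h"
  by (simp add: eventually_at_right_less)

lemma is_gen_add:
  assumes "is_gen x y" "is_gen x' y'" shows "is_gen (x + x') (y + y')"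
  unfolding is_gen_def
proof (rule Lim_transform_eventually)
  show "((\<lambda>h. (T h x - x) /\<^sub>R h + (T h x' - x') /\<^sub>R h) \<longlongrightarrow> y + y') (at_right 0)"
    using assms by (intro tendsto_add) (auto simp: is_gen_def)
  show "\<forall>\<^sub>F h in at_right 0. (T h x - x) /\<^sub>R h + (T h x' - x') /\<^sub>R h = (T h (x + x') - (x + x')) /\<^sub>R h"
    using eventually_pos
    by eventually_elim (simp add: bclin_D[OF bclin] scaleR_add_right[symmetric])
qed

lemma is_gen_scaleC:
  assumes "is_gen x y" shows "is_gen (c *\<^sub>C x) (c *\<^sub>C y)"
  unfolding is_gen_def
proof (rule Lim_transform_eventually)
  show "((\<lambda>h. c *\<^sub>C ((T h x - x) /\<^sub>R h)) \<longlongrightarrow> c *\<^sub>C y) (at_right 0)"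
    using assms by (intro tendsto_scaleC) (auto simp: is_gen_def)
  show "\<forall>\<^sub>F h in at_right 0. c *\<^sub>C ((T h x - x) /\<^sub>R h) = (T h (c *\<^sub>C x) - c *\<^sub>C x) /\<^sub>R h"
    using eventually_pos
    by eventually_elim (simp add: bclin_D[OF bclin] scaleC_diff_right scaleC_scaleR)
qed

lemma is_gen_diff:
  assumes "is_gen x y" "is_gen x' y'" shows "is_gen (x - x') (y - y')"
  using is_gen_add[OF assms(1) is_gen_scaleC[OF assms(2), of "-1"]]
  by (simp add: scaleC_minus_one)

lemma is_gen_T:
  assumes "is_gen x y" "0 \<le> t" shows "is_gen (T t x) (T t y)"
  unfolding is_gen_def
proof (rule Lim_transform_eventually)
  show "((\<lambda>h. T t ((T h x - x) /\<^sub>R h)) \<longlongrightarrow> T t y) (at_right 0)"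
    by (rule tendsto_bclin[OF bclin[OF assms(2)] assms(1)[unfolded is_gen_def]])
  show "\<forall>\<^sub>F h in at_right 0. T t ((T h x - x) /\<^sub>R h) = (T h (T t x) - T t x) /\<^sub>R h"
    using eventually_pos
    by eventually_elim (simp add: bclin_D[OF bclin[OF assms(2)]] T_comm[OF _ assms(2)])
qed

text \<open>The generator is dissipative, since
  \<open>2 Re (T\<^sub>h x - x, x) = \<parallel>T\<^sub>h x\<parallel>\<^sup>2 - \<parallel>x\<parallel>\<^sup>2 - \<parallel>T\<^sub>h x - x\<parallel>\<^sup>2\<close>.\<close>

lemma Re_difference_quotient:
  "2 * Re (cinner ((T h x - x) /\<^sub>R h) x) = ((norm (T h x))\<^sup>2 - (norm x)\<^sup>2) / h - (norm (T h x - x))\<^sup>2 / h"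
proof -
  have "2 * Re (cinner (T h x - x) x) = (norm (T h x))\<^sup>2 - (norm x)\<^sup>2 - (norm (T h x - x))\<^sup>2"
    by (simp add: norm_diff_sqr cinner_diff_left cinner_self)
  then show ?thesis by (simp add: cinner_scaleR_left divide_simps)
qed

lemma is_gen_dissipative:
  assumes "is_gen x y" shows "Re (cinner y x) \<le> 0"
proof (rule tendsto_upperbound[of "\<lambda>h. Re (cinner ((T h x - x) /\<^sub>R h) x)"])
  show "((\<lambda>h. Re (cinner ((T h x - x) /\<^sub>R h) x)) \<longlongrightarrow> Re (cinner y x)) (at_right 0)"
    using assms by (intro tendsto_Re tendsto_cinner tendsto_const) (simp add: is_gen_def)
  show "\<forall>\<^sub>F h in at_right 0. Re (cinner ((T h x - x) /\<^sub>R h) x) \<le> 0"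
    using eventually_pos
  proof eventually_elim
    case (elim h)
    have "(norm (T h x))\<^sup>2 \<le> (norm x)\<^sup>2" using contraction[of h x] elim by (intro power_mono) auto
    then have "((norm (T h x))\<^sup>2 - (norm x)\<^sup>2) / h \<le> 0" "0 \<le> (norm (T h x - x))\<^sup>2 / h"
      using elim by (simp_all add: divide_nonpos_pos)
    then show ?case using Re_difference_quotient[of h x] by linarith
  qed
qed simp

lemma norm_le_resolvent:
  assumes "is_gen y z" "0 \<le> h" shows "norm y \<le> norm (y - h *\<^sub>R z)"
proof -
  have "(norm y)\<^sup>2 \<le> Re (cinner (y - h *\<^sub>R z) y)"
    using mult_nonneg_nonpos[OF assms(2) is_gen_dissipative[OF assms(1)]]
    by (simp add: cinner_diff_left cinner_scaleR_left cinner_self)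
  also have "\<dots> \<le> norm (y - h *\<^sub>R z) * norm y"
    using complex_Re_le_cmod norm_cinner_le order_trans by blast
  finally show ?thesis
    by (metis mult_right_le_imp_le norm_ge_zero order_le_less power2_eq_square)
qed

text \<open>The resolvent equation \<open>y - G y = x\<close> is solved by the Laplace transform
  \<open>y = \<integral>\<^sub>0\<^sup>\<infinity> exp (-s) T\<^sub>s x ds\<close>, which satisfies \<open>T\<^sub>h y = exp h (y - \<integral>\<^sub>0\<^sup>h exp (-s) T\<^sub>s x ds)\<close>.\<close>

definition partial_laplace :: "'a \<Rightarrow> real \<Rightarrow> 'a" where
  "partial_laplace x a = integral {0..a} (\<lambda>s. exp (- s) *\<^sub>R T s x)"

lemma continuous_on_laplace_integrand:
  "A \<subseteq> {0..} \<Longrightarrow> continuous_on A (\<lambda>s. exp (- s) *\<^sub>R T s x)"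
  by (intro continuous_intros continuous_on_subset[OF continuous_on_orbit])

lemma partial_laplace_add:
  assumes "0 \<le> a" "0 \<le> b"
  shows "partial_laplace x (a + b) = partial_laplace x a + exp (- a) *\<^sub>R T a (partial_laplace x b)"
proof -
  let ?g = "\<lambda>s. exp (- s) *\<^sub>R T s x"
  have int: "?g integrable_on {c..d}" if "0 \<le> c" for c d
    by (rule integrable_continuous_interval) (use that in \<open>auto intro: continuous_on_laplace_integrand\<close>)
  have lin: "bounded_linear (\<lambda>x. exp (- a) *\<^sub>R T a x)"
    using bclin[OF assms(1)] by (intro bounded_linear_const_scaleR) (simp add: bounded_clinear_def)
  have "integral {a..a + b} ?g = integral {0..b} (?g \<circ> (+) a)"
    using integral_shift_Icc_real[of 0 b ?g a] by (simp add: add.commute)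
  also have "\<dots> = integral {0..b} ((\<lambda>x. exp (- a) *\<^sub>R T a x) \<circ> ?g)"
    by (rule integral_cong) (use assms in \<open>simp add: T_add_apply bclin_D[OF bclin] exp_add[symmetric]\<close>)
  also have "\<dots> = exp (- a) *\<^sub>R T a (integral {0..b} ?g)"
    by (rule integral_linear[OF int lin]) simp
  finally show ?thesis
    using Henstock_Kurzweil_Integration.integral_combine[of 0 a "a + b" ?g] int[of 0] assms
    by (simp add: partial_laplace_def)
qed

lemma partial_laplace_quotient: "((\<lambda>h. partial_laplace x h /\<^sub>R h) \<longlongrightarrow> x) (at_right 0)"
proof -
  have "(partial_laplace x has_vector_derivative exp (- 0) *\<^sub>R T 0 x) (at 0 within {0..1})"
    unfolding partial_laplace_def
    by (rule integral_has_vector_derivative) (auto intro: continuous_on_laplace_integrand)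
  then have "((\<lambda>h. norm (partial_laplace x h - h *\<^sub>R x) / norm h) \<longlongrightarrow> 0) (at_right 0)"
    by (simp add: has_vector_derivative_def has_derivative_iff_norm T_0 at_within_Icc_at_right
        partial_laplace_def)
  then have "((\<lambda>h. norm (partial_laplace x h /\<^sub>R h - x)) \<longlongrightarrow> 0) (at_right 0)"
  proof (rule Lim_transform_eventually)
    show "\<forall>\<^sub>F h in at_right 0. norm (partial_laplace x h - h *\<^sub>R x) / norm h = norm (partial_laplace x h /\<^sub>R h - x)"
      using eventually_pos
    proof eventually_elim
      case (elim h)
      have "partial_laplace x h /\<^sub>R h - x = (partial_laplace x h - h *\<^sub>R x) /\<^sub>R h"
        using elim by (simp add: scaleR_diff_right)
      then show ?case using elim by (simp add: divide_inverse_commute)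
    qed
  qed
  then show ?thesis by (simp add: tendsto_norm_zero_iff Lim_null[of _ x])
qed

lemma resolvent_exists_1: "\<exists>y. is_gen y (y - x)"
proof -
  let ?F = "partial_laplace x"
  have F_Suc: "?F (real (Suc n)) = ?F (real n) + exp (- real n) *\<^sub>R T (real n) (?F 1)" for n
    using partial_laplace_add[of "real n" 1 x] by (simp add: add.commute)
  have decay: "norm (exp (- real n) *\<^sub>R T (real n) v) \<le> (exp (-1)) ^ n * norm v" for n v
    using contraction[of "real n" v] by (simp add: exp_of_nat_mult[symmetric] mult_left_mono)
  have geom: "summable (\<lambda>n. (exp (-1::real)) ^ n * norm v)" for v :: 'a
    by (intro summable_mult2 summable_geometric) simp
  have "summable (\<lambda>n. exp (- real n) *\<^sub>R T (real n) (?F 1))"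
    by (rule summable_comparison_test'[OF geom decay])
  then have "(\<lambda>n. \<Sum>k<n. exp (- real k) *\<^sub>R T (real k) (?F 1)) \<longlonglongrightarrow> (\<Sum>k. exp (- real k) *\<^sub>R T (real k) (?F 1))"
    by (rule summable_LIMSEQ)
  moreover have "(\<Sum>k<n. exp (- real k) *\<^sub>R T (real k) (?F 1)) = ?F (real n)" for n
  proof (induction n)
    case (Suc n)
    then show ?case by (simp only: sum.lessThan_Suc F_Suc)
  qed (simp add: partial_laplace_def)
  ultimately obtain y where y: "(\<lambda>n. ?F (real n)) \<longlonglongrightarrow> y" by auto
  have Ty: "T h y = exp h *\<^sub>R (y - ?F h)" if h: "0 \<le> h" for h
  proof -
    have "(\<lambda>n. exp (- real n) *\<^sub>R T (real n) (?F h)) \<longlonglongrightarrow> 0"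
      by (rule summable_LIMSEQ_zero[OF summable_comparison_test'[OF geom decay]])
    then have "(\<lambda>n. exp h *\<^sub>R ((?F (real n) + exp (- real n) *\<^sub>R T (real n) (?F h)) - ?F h)) \<longlonglongrightarrow> exp h *\<^sub>R ((y + 0) - ?F h)"
      by (intro tendsto_scaleR tendsto_const tendsto_diff tendsto_add y)
    moreover have "exp h *\<^sub>R ((?F (real n) + exp (- real n) *\<^sub>R T (real n) (?F h)) - ?F h) = T h (?F (real n))" for n
    proof -
      have "?F (real n) + exp (- real n) *\<^sub>R T (real n) (?F h) = ?F h + exp (- h) *\<^sub>R T h (?F (real n))"
        using partial_laplace_add[of "real n" h x] partial_laplace_add[of h "real n" x] h
        by (simp add: add.commute)
      then show ?thesis by (simp add: exp_add[symmetric])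
    qed
    ultimately have "(\<lambda>n. T h (?F (real n))) \<longlonglongrightarrow> exp h *\<^sub>R (y - ?F h)" by simp
    moreover have "(\<lambda>n. T h (?F (real n))) \<longlonglongrightarrow> T h y"
      by (rule tendsto_bclin[OF bclin[OF h] y])
    ultimately show ?thesis using LIMSEQ_unique by blast
  qed
  have "((\<lambda>h::real. (exp h - 1) / h) \<longlongrightarrow> 1) (at 0)"
    using DERIV_exp[of 0] by (simp add: has_field_derivative_iff)
  then have e1: "((\<lambda>h::real. (exp h - 1) / h) \<longlongrightarrow> 1) (at_right 0)"
    by (rule tendsto_within_subset) simp
  have e2: "((\<lambda>h::real. exp h) \<longlongrightarrow> exp 0) (at_right 0)"
    by (intro tendsto_intros)
  have "((\<lambda>h. ((exp h - 1) / h) *\<^sub>R y - exp h *\<^sub>R (?F h /\<^sub>R h)) \<longlongrightarrow> 1 *\<^sub>R y - exp 0 *\<^sub>R x) (at_right 0)"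
    by (intro tendsto_diff tendsto_scaleR e1 e2 tendsto_const partial_laplace_quotient)
  then have "((\<lambda>h. ((exp h - 1) / h) *\<^sub>R y - exp h *\<^sub>R (?F h /\<^sub>R h)) \<longlongrightarrow> y - x) (at_right 0)" by simp
  then have "is_gen y (y - x)"
    unfolding is_gen_def
  proof (rule Lim_transform_eventually)
    show "\<forall>\<^sub>F h in at_right 0. ((exp h - 1) / h) *\<^sub>R y - exp h *\<^sub>R (?F h /\<^sub>R h) = (T h y - y) /\<^sub>R h"
      using eventually_pos
      by eventually_elim (simp add: Ty scaleR_diff_left scaleR_diff_right right_diff_distrib
          divide_inverse_commute mult.commute)
  qed
  then show ?thesis by blast
qed

lemma scaled_semigroup:
  assumes h: "0 < h" shows "contraction_semigroup (\<lambda>t. T (h * t))"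
proof
  have "((\<lambda>t. T (h * t) x) \<longlongrightarrow> x) (at_right 0)" for x
  proof (rule filterlim_compose[OF continuous_at_0])
    show "filterlim (\<lambda>t. h * t) (at_right 0) (at_right 0)"
      unfolding filterlim_at
    proof
      show "((\<lambda>t. h * t) \<longlongrightarrow> 0) (at_right 0)"
        using tendsto_mult[OF tendsto_const tendsto_ident_at, of h 0 "{0<..}"] by simp
      show "\<forall>\<^sub>F t in at_right 0. h * t \<in> {0<..} \<and> h * t \<noteq> 0"
        using eventually_pos by eventually_elim (use h in auto)
    qed
  qed
  then show "C0_contraction_semigroup (\<lambda>t. T (h * t))"
    using h by (auto simp: C0_contraction_semigroup_def bclin contraction T_0 T_add distrib_left)
qed

lemma is_gen_scaled:
  assumes h: "0 < h" and g: "((\<lambda>k. (T (h * k) x - x) /\<^sub>R k) \<longlongrightarrow> z) (at_right 0)"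
  shows "is_gen x (z /\<^sub>R h)"
  unfolding is_gen_def
proof (rule Lim_transform_eventually)
  have "filterlim (\<lambda>t. t / h) (at_right 0) (at_right 0)"
    unfolding filterlim_at
  proof
    show "((\<lambda>t. t / h) \<longlongrightarrow> 0) (at_right 0)"
      using tendsto_divide[OF tendsto_ident_at tendsto_const, of h 0 "{0<..}"] h by simp
    show "\<forall>\<^sub>F t in at_right 0. t / h \<in> {0<..} \<and> t / h \<noteq> 0"
      using eventually_pos by eventually_elim (use h in auto)
  qed
  from filterlim_compose[OF g this]
  show "((\<lambda>t. ((T (h * (t / h)) x - x) /\<^sub>R (t / h)) /\<^sub>R h) \<longlongrightarrow> z /\<^sub>R h) (at_right 0)"
    by (intro tendsto_scaleR tendsto_const)
  show "\<forall>\<^sub>F t in at_right 0. ((T (h * (t / h)) x - x) /\<^sub>R (t / h)) /\<^sub>R h = (T t x - x) /\<^sub>R t"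
    using eventually_pos
  proof eventually_elim
    case (elim t)
    have "h * (t / h) = t" "inverse h * inverse (t / h) = inverse t"
      using h elim by (simp_all add: field_simps)
    then show ?case by (simp only: scaleR_scaleR)
  qed
qed

lemma resolvent_exists:
  assumes h: "0 < h" shows "\<exists>y z. is_gen y z \<and> y - h *\<^sub>R z = x"
proof -
  interpret S: contraction_semigroup "\<lambda>t. T (h * t)" by (rule scaled_semigroup[OF h])
  obtain y where "S.is_gen y (y - x)" using S.resolvent_exists_1 by blast
  then have "is_gen y ((y - x) /\<^sub>R h)" using is_gen_scaled[OF h] by (simp add: S.is_gen_def)
  then show ?thesis using h by (intro exI[of _ y] exI[of _ "(y - x) /\<^sub>R h"]) simp
qed

text \<open>\<open>resolvent h = (1 - h G)\<^sup>-\<^sup>1\<close> for \<open>h > 0\<close>.\<close>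

definition resolvent :: "real \<Rightarrow> 'a \<Rightarrow> 'a" where
  "resolvent h x = (SOME y. \<exists>z. is_gen y z \<and> y - h *\<^sub>R z = x)"

context
  fixes h :: real
  assumes h: "0 < h"
begin

lemma resolvent_generator: "is_gen (resolvent h x) ((resolvent h x - x) /\<^sub>R h)"
proof -
  obtain z where z: "is_gen (resolvent h x) z" "resolvent h x - h *\<^sub>R z = x"
    using someI_ex[OF resolvent_exists[OF h, of x]] unfolding resolvent_def by blast
  from z(2) have "resolvent h x - x = h *\<^sub>R z" by (simp add: algebra_simps)
  then show ?thesis using z(1) h by simp
qed

lemma norm_resolvent: "norm (resolvent h x) \<le> norm x"
  using norm_le_resolvent[OF resolvent_generator, of h x] h by simp

lemma resolvent_eqI: assumes "is_gen y z" "y - h *\<^sub>R z = x" shows "resolvent h x = y"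
proof -
  let ?z = "(resolvent h x - x) /\<^sub>R h"
  have "norm (resolvent h x - y) \<le> norm ((resolvent h x - y) - h *\<^sub>R (?z - z))"
    by (rule norm_le_resolvent[OF is_gen_diff[OF resolvent_generator assms(1)]]) (use h in simp)
  also have "(resolvent h x - y) - h *\<^sub>R (?z - z) = x - (y - h *\<^sub>R z)"
    using h by (simp add: algebra_simps)
  finally show ?thesis by (simp add: assms(2))
qed

lemma bclin_resolvent: "bounded_clinear (resolvent h)"
proof (rule bclinI[where K = 1])
  show "resolvent h (x + y) = resolvent h x + resolvent h y" for x y
    by (rule resolvent_eqI[OF is_gen_add[OF resolvent_generator resolvent_generator]])
      (use h in \<open>simp add: algebra_simps\<close>)
  show "resolvent h (c *\<^sub>C x) = c *\<^sub>C resolvent h x" for c x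
    by (rule resolvent_eqI[OF is_gen_scaleC[OF resolvent_generator]])
      (use h in \<open>simp add: scaleC_scaleR[symmetric] scaleC_diff_right[symmetric]\<close>)
qed (simp add: norm_resolvent)

lemma resolvent_T: "0 \<le> t \<Longrightarrow> resolvent h (T t x) = T t (resolvent h x)"
  by (rule resolvent_eqI[OF is_gen_T[OF resolvent_generator]])
    (use h in \<open>auto simp: bclin_D[OF bclin]\<close>)

end

abbreviation R :: "'a \<Rightarrow> 'a" where "R \<equiv> resolvent 1"

lemma R_generator: "is_gen (R x) (R x - x)"
  using resolvent_generator[of 1 x] by simp

lemma R_eqI: "is_gen y z \<Longrightarrow> y - z = x \<Longrightarrow> R x = y"
  using resolvent_eqI[of 1 y z x] by simp

section \<open>The cogenerator\<close>

abbreviation C :: "'a \<Rightarrow> 'a" where "C \<equiv> cogenerator T"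

lemma cogenerator_eq: "C x = x - 2 *\<^sub>R R x"
proof -
  have gen: "is_gen (- R x) (- (R x - x))"
    using is_gen_scaleC[OF R_generator, of "-1" x] by (simp add: scaleC_minus_one)
  have "inj_on (\<lambda>y. generator T y - y) (generator_domain T)"
  proof (rule inj_onI)
    fix y y' assume "y \<in> generator_domain T" "y' \<in> generator_domain T"
      and eq: "generator T y - y = generator T y' - y'"
    then obtain z z' where z: "is_gen y z" "is_gen y' z'" by (auto simp: generator_domain_iff)
    have "R (y - z) = y" "R (y' - z') = y'" using z by (auto intro: R_eqI)
    moreover have "y - z = y' - z'" using eq generator_eq z by (simp add: algebra_simps)
    ultimately show "y = y'" by simp
  qed
  moreover have "generator T (- R x) - (- R x) = x" by (simp add: generator_eq[OF gen])
  moreover have "- R x \<in> generator_domain T" using gen generator_domain_iff by blast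
  ultimately have "inv_into (generator_domain T) (\<lambda>y. generator T y - y) x = - R x"
    by (metis (mono_tags, lifting) inv_into_f_eq)
  then show ?thesis by (simp add: cogenerator_def generator_eq[OF gen] scaleR_2)
qed

lemma bclin_C: "bounded_clinear C"
proof -
  have "bounded_clinear (\<lambda>x. x - 2 *\<^sub>R R x)"
    unfolding scaleR_eq_scaleC
    by (intro bclin_diff bclin_ident bclin_scaleC bclin_resolvent) simp
  then show ?thesis by (simp add: cogenerator_eq[abs_def])
qed

text \<open>With \<open>y = R x\<close> and \<open>z = G y = y - x\<close>, the cogenerator maps \<open>x = y - z\<close> to \<open>-(y + z)\<close>.\<close>

lemma norm_C_sqr: "(norm (C x))\<^sup>2 = (norm x)\<^sup>2 + 4 * Re (cinner (R x - x) (R x))"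
  by (simp add: cogenerator_eq norm_diff_sqr[of x] cinner_simps cinner_self power_mult_distrib
      scaleR_conv_of_real algebra_simps)

lemma norm_C: "norm (C x) \<le> norm x"
proof (rule power2_le_imp_le)
  show "(norm (C x))\<^sup>2 \<le> (norm x)\<^sup>2"
    using is_gen_dissipative[OF R_generator, of x] norm_C_sqr[of x] by linarith
qed simp

lemmas bclin_C_pow = bclin_funpow[OF bclin_C]
  and norm_C_pow = norm_funpow_le[OF norm_C]

end

section \<open>The algebras generated by the semigroup and by the cogenerator\<close>

text \<open>The Neumann series for \<open>y = (1 - q B)\<^sup>-\<^sup>1 w\<close> with remainder.\<close>

lemma geometric_iteration:
  fixes B :: "'a::chilbert_space \<Rightarrow> 'a"
  assumes B: "bounded_clinear B" and y: "y = q *\<^sub>R B y + w"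
  shows "y = (\<Sum>k<n. q ^ k *\<^sub>R (B ^^ k) w) + q ^ n *\<^sub>R (B ^^ n) y"
proof (induction n)
  case (Suc n)
  note pow = bclin_funpow[OF B, of n]
  have "(B ^^ n) y = q *\<^sub>R (B ^^ Suc n) y + (B ^^ n) w"
  proof -
    have "(B ^^ n) y = (B ^^ n) (q *\<^sub>R B y + w)" by (rule arg_cong[OF y])
    also have "\<dots> = q *\<^sub>R (B ^^ n) (B y) + (B ^^ n) w" by (simp only: bclin_D[OF pow])
    also have "(B ^^ n) (B y) = (B ^^ Suc n) y" by (simp add: funpow_swap1)
    finally show ?thesis .
  qed
  then have "q ^ n *\<^sub>R (B ^^ n) y = q ^ n *\<^sub>R (B ^^ n) w + q ^ Suc n *\<^sub>R (B ^^ Suc n) y"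
    by (simp only: scaleR_add_right scaleR_scaleR power_Suc2 add.commute)
  then show ?case using Suc by (simp only: sum.lessThan_Suc add.assoc)
qed simp

context
  fixes N :: "('a::chilbert_space \<Rightarrow> 'a) set"
  assumes N: "strongly_closed_algebra N"
begin

lemma algebra_bounded: "A \<in> N \<Longrightarrow> bounded_clinear A"
  and algebra_id: "id \<in> N"
  and algebra_add: "A \<in> N \<Longrightarrow> B \<in> N \<Longrightarrow> (\<lambda>x. A x + B x) \<in> N"
  and algebra_scaleC: "A \<in> N \<Longrightarrow> (\<lambda>x. c *\<^sub>C A x) \<in> N"
  and algebra_compose: "A \<in> N \<Longrightarrow> B \<in> N \<Longrightarrow> A \<circ> B \<in> N"
  using N by (auto simp: strongly_closed_algebra_def)

lemma algebra_limit:
  "(\<And>n::nat. F n \<in> N) \<Longrightarrow> bounded_clinear A \<Longrightarrow> (\<And>x. (\<lambda>n. F n x) \<longlonglongrightarrow> A x) \<Longrightarrow> A \<in> N"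
  using N unfolding strongly_closed_algebra_def by blast

lemma algebra_scaleR: "A \<in> N \<Longrightarrow> (\<lambda>x. r *\<^sub>R A x) \<in> N"
  unfolding scaleR_eq_scaleC by (rule algebra_scaleC)

lemma algebra_diff: "A \<in> N \<Longrightarrow> B \<in> N \<Longrightarrow> (\<lambda>x. A x - B x) \<in> N"
  using algebra_add[of A "\<lambda>x. (-1) *\<^sub>C B x"] algebra_scaleC[of B "-1"] by (simp add: scaleC_minus_one)

lemma algebra_pow: "A \<in> N \<Longrightarrow> A ^^ n \<in> N"
  by (induction n) (simp_all only: funpow.simps algebra_id algebra_compose)

lemma algebra_sum: "(\<And>i. i < n \<Longrightarrow> A i \<in> N) \<Longrightarrow> (\<lambda>x. \<Sum>i<n. A i x) \<in> N" for n :: nat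
proof (induction n)
  case 0
  show ?case using algebra_diff[OF algebra_id algebra_id] by simp
next
  case (Suc n)
  then show ?case by (simp add: algebra_add)
qed

lemma algebra_ident: "(\<lambda>x. x) \<in> N"
  using algebra_id by (simp add: id_def)

end

context contraction_semigroup
begin

text \<open>\<open>R\<close> is the strong limit of the resolvents of the difference quotients \<open>(T\<^sub>h - 1) / h\<close>, expanded in
  Neumann series which are cut off after \<open>1 / h\<^sup>2\<close> terms.\<close>

lemma R_in_algebra:
  assumes N: "strongly_closed_algebra N" and T: "\<And>t. 0 \<le> t \<Longrightarrow> T t \<in> N"
  shows "R \<in> N"
proof -
  define h where "h = (\<lambda>m::nat. 1 / real (Suc m))"
  define c where "c = (\<lambda>m. 1 / (1 + h m))"
  have h: "0 < h m" for m by (simp add: h_def)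
  then have c: "0 < c m" "c m < 1" "1 - c m = c m * h m" for m
  proof -
    have "0 < 1 + h m" using h[of m] by simp
    then show "0 < c m" "c m < 1" "1 - c m = c m * h m"
      using h[of m] unfolding c_def by (simp_all add: divide_simps)
  qed
  define F where "F = (\<lambda>m x. \<Sum>k<(Suc m) * (Suc m). ((1 - c m) * c m ^ k) *\<^sub>R (T (h m) ^^ k) x)"
  have FN: "F m \<in> N" for m
    unfolding F_def by (intro algebra_sum[OF N] algebra_scaleR[OF N] algebra_pow[OF N] T less_imp_le[OF h])
  have "(\<lambda>m. F m x) \<longlonglongrightarrow> R x" for x
  proof -
    define y where "y = R x"
    define r where "r = (\<lambda>m. (T (h m) y - y) /\<^sub>R h m - (y - x))"
    have h_lim: "filterlim h (at_right 0) sequentially"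
      unfolding filterlim_at h_def using LIMSEQ_Suc[OF lim_1_over_n]
      by (auto intro!: always_eventually)
    have r: "r \<longlonglongrightarrow> 0"
      using tendsto_diff[OF filterlim_compose[OF R_generator[of x, unfolded is_gen_def] h_lim] tendsto_const, of "R x - x"]
      by (simp add: r_def y_def)
    have pow_le: "norm ((T (h m) ^^ k) v) \<le> norm v" for m k v
      by (intro norm_funpow_le contraction less_imp_le h)
    have bound: "norm (F m x - y) \<le> norm (r m) + c m ^ (Suc m * Suc m) * norm y" for m
    proof -
      let ?n = "Suc m * Suc m" and ?B = "T (h m)"
      \<comment> \<open>\<open>T\<^sub>h y = y + h (y - x + r)\<close>, solved for \<open>y\<close>, with \<open>c = 1 / (1 + h)\<close>\<close>
      have "y = c m *\<^sub>R ?B y + (1 - c m) *\<^sub>R (x - r m)"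
      proof -
        have "h m *\<^sub>R r m = ?B y - y - h m *\<^sub>R (y - x)"
          using h[of m] by (simp add: r_def scaleR_diff_right)
        then have "(1 + h m) *\<^sub>R y = ?B y + h m *\<^sub>R (x - r m)"
          by (simp add: algebra_simps)
        then have "c m *\<^sub>R ((1 + h m) *\<^sub>R y) = c m *\<^sub>R ?B y + (c m * h m) *\<^sub>R (x - r m)"
          by (simp add: scaleR_add_right)
        moreover have "c m * (1 + h m) = 1" using h[of m] by (simp add: c_def)
        ultimately show ?thesis by (simp add: c(3))
      qed
      from geometric_iteration[OF bclin[OF less_imp_le[OF h]] this, of ?n]
      have y': "y = (\<Sum>k<?n. c m ^ k *\<^sub>R (?B ^^ k) ((1 - c m) *\<^sub>R (x - r m))) + c m ^ ?n *\<^sub>R (?B ^^ ?n) y" .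
      have pow: "bounded_clinear (?B ^^ k)" for k
        by (rule algebra_bounded[OF N algebra_pow[OF N T]]) (simp add: less_imp_le[OF h])
      have "F m x - y = (\<Sum>k<?n. ((1 - c m) * c m ^ k) *\<^sub>R (?B ^^ k) (r m)) - c m ^ ?n *\<^sub>R (?B ^^ ?n) y"
      proof -
        have "(\<Sum>k<?n. c m ^ k *\<^sub>R (?B ^^ k) ((1 - c m) *\<^sub>R (x - r m)))
            = F m x - (\<Sum>k<?n. ((1 - c m) * c m ^ k) *\<^sub>R (?B ^^ k) (r m))"
          unfolding F_def sum_subtractf[symmetric]
          by (simp only: bclin_D[OF pow] scaleR_scaleR scaleR_diff_right mult.commute)
        then have "y = F m x - (\<Sum>k<?n. ((1 - c m) * c m ^ k) *\<^sub>R (?B ^^ k) (r m)) + c m ^ ?n *\<^sub>R (?B ^^ ?n) y"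
          using y' by (simp only:)
        moreover have "a - v = b - d" if "v = a - b + d" for a b d v :: 'a using that by simp
        ultimately show ?thesis by blast
      qed
      then have "norm (F m x - y) \<le> norm (\<Sum>k<?n. ((1 - c m) * c m ^ k) *\<^sub>R (?B ^^ k) (r m)) + norm (c m ^ ?n *\<^sub>R (?B ^^ ?n) y)"
        by (metis norm_triangle_ineq4)
      also have "norm (c m ^ ?n *\<^sub>R (?B ^^ ?n) y) \<le> c m ^ ?n * norm y"
      proof -
        have "norm (c m ^ ?n *\<^sub>R (?B ^^ ?n) y) = c m ^ ?n * norm ((?B ^^ ?n) y)"
          using c[of m] by (simp only: norm_scaleR power_abs abs_of_pos)
        also have "\<dots> \<le> c m ^ ?n * norm y"
          using c(1)[of m] by (intro mult_left_mono pow_le zero_le_power less_imp_le)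
        finally show ?thesis .
      qed
      also have "norm (\<Sum>k<?n. ((1 - c m) * c m ^ k) *\<^sub>R (?B ^^ k) (r m)) \<le> (\<Sum>k<?n. (1 - c m) * c m ^ k * norm (r m))"
      proof (rule order_trans[OF norm_sum], rule sum_mono)
        fix k
        have "0 \<le> (1 - c m) * c m ^ k" using c[of m] by simp
        then show "norm (((1 - c m) * c m ^ k) *\<^sub>R (?B ^^ k) (r m)) \<le> (1 - c m) * c m ^ k * norm (r m)"
          unfolding norm_scaleR by (simp only: abs_of_nonneg mult_left_mono pow_le)
      qed
      also have "(\<Sum>k<?n. (1 - c m) * c m ^ k * norm (r m)) = (1 - c m ^ ?n) * norm (r m)"
        using c(1,2)[of m] by (simp add: sum_distrib_right[symmetric] sum_distrib_left[symmetric] sum_gp_strict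
            del: mult_Suc mult_Suc_right)
      also have "\<dots> \<le> norm (r m)"
      proof -
        have "0 \<le> c m ^ ?n" "c m ^ ?n \<le> 1"
          using zero_le_power[of "c m" ?n] power_le_one[of "c m" ?n] c(1,2)[of m] by (simp_all only: less_imp_le)
        then show ?thesis by (intro mult_left_le_one_le) (simp_all only: norm_ge_zero diff_ge_0_iff_ge diff_le_eq le_add_same_cancel1)
      qed
      finally show ?thesis by simp
    qed
    have c_pow: "c m ^ (Suc m * Suc m) \<le> (1/2) ^ Suc m" for m
    proof -
      have "2 \<le> (1 + h m) ^ Suc m"
      proof -
        have "real (Suc m) * h m = 1" by (simp add: h_def del: of_nat_Suc)
        then have "1 + 1 \<le> (h m + 1) ^ Suc m"
          using linear_plus_1_le_power[of "h m" "Suc m"] h[of m] by (simp only: less_imp_le)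
        then show ?thesis by (simp only: add.commute one_add_one)
      qed
      from frac_le[OF _ order_refl _ this, of 1] have "c m ^ Suc m \<le> 1/2"
        by (simp only: c_def power_one_over zero_le_one zero_less_numeral)
      then have "(c m ^ Suc m) ^ Suc m \<le> (1/2) ^ Suc m"
        using c[of m] by (intro power_mono) auto
      then show ?thesis by (simp only: power_mult)
    qed
    have "(\<lambda>m. F m x - y) \<longlonglongrightarrow> 0"
    proof (rule Lim_null_comparison)
      show "\<forall>\<^sub>F m in sequentially. norm (F m x - y) \<le> norm (r m) + (1/2) ^ Suc m * norm y"
        using order_trans[OF bound add_left_mono[OF mult_right_mono[OF c_pow norm_ge_zero]]]
        by (intro always_eventually) blast
      have "(\<lambda>m. norm (r m) + (1/2) ^ Suc m * norm y) \<longlonglongrightarrow> 0 + 0 * norm y"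
        by (intro tendsto_add tendsto_mult tendsto_const tendsto_norm_zero r LIMSEQ_Suc LIMSEQ_power_zero) simp
      then show "(\<lambda>m. norm (r m) + (1/2) ^ Suc m * norm y) \<longlonglongrightarrow> 0" by simp
    qed
    then show ?thesis by (simp add: y_def LIM_zero_iff)
  qed
  then show ?thesis by (rule algebra_limit[OF N FN bclin_resolvent[OF zero_less_one]])
qed

lemma cogenerator_in_algebra:
  assumes N: "strongly_closed_algebra N" and T: "\<And>t. 0 \<le> t \<Longrightarrow> T t \<in> N"
  shows "C \<in> N"
  using algebra_diff[OF N algebra_ident[OF N] algebra_scaleR[OF N R_in_algebra[OF N T], of 2]]
  by (simp add: cogenerator_eq[abs_def])

text \<open>With \<open>q = (1 - h) / (1 + h)\<close> one has \<open>(1 - h G)\<^sup>-\<^sup>1 = (1 + h)\<^sup>-\<^sup>1 (1 - q C)\<^sup>-\<^sup>1 (1 - C)\<close>, and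
  \<open>|q| < 1\<close>.\<close>

lemma resolvent_in_algebra:
  assumes N: "strongly_closed_algebra N" and C: "C \<in> N" and h: "0 < h"
  shows "resolvent h \<in> N"
proof -
  define q where "q = (1 - h) / (1 + h)"
  have q: "\<bar>q\<bar> < 1" using h by (simp add: q_def abs_less_iff field_simps)
  define w where "w = (\<lambda>x. (x - C x) /\<^sub>R (1 + h))"
  define F where "F = (\<lambda>n x. \<Sum>k<n. q ^ k *\<^sub>R (C ^^ k) (w x))"
  have wN: "w \<in> N" unfolding w_def by (intro algebra_scaleR[OF N] algebra_diff[OF N] algebra_ident[OF N] C)
  have "(\<lambda>x. q ^ k *\<^sub>R ((C ^^ k) \<circ> w) x) \<in> N" for k
    by (intro algebra_scaleR[OF N] algebra_compose[OF N] algebra_pow[OF N] C wN)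
  then have FN: "F n \<in> N" for n unfolding F_def o_def by (intro algebra_sum[OF N])
  have "(\<lambda>n. F n x) \<longlonglongrightarrow> resolvent h x" for x
  proof -
    define y where "y = resolvent h x"
    define z where "z = (y - x) /\<^sub>R h"
    have g: "is_gen y z" unfolding y_def z_def by (rule resolvent_generator[OF h])
    have x: "x = y - h *\<^sub>R z" using h by (simp add: z_def)
    have "R (y - z) = y" by (rule R_eqI[OF g]) simp
    then have Cyz: "C (y - z) = - (y + z)" by (simp add: cogenerator_eq scaleR_2)
    have "(1 + h) *\<^sub>R y = (1 - h) *\<^sub>R C y + (x - C x)"
    proof -
      have "(1 - h) *\<^sub>R C y + (x - C x) = x - h *\<^sub>R (C (y - z))"
        by (subst (2) x) (simp add: bclin_D[OF bclin_C] algebra_simps)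
      then show ?thesis by (simp add: Cyz x algebra_simps)
    qed
    then have "(1 / (1 + h)) *\<^sub>R ((1 + h) *\<^sub>R y) = (1 / (1 + h)) *\<^sub>R ((1 - h) *\<^sub>R C y + (x - C x))" by simp
    then have "y = q *\<^sub>R C y + w x"
      using h by (simp add: q_def w_def scaleR_add_right divide_inverse mult.commute)
    from geometric_iteration[OF bclin_C this]
    have y: "y = F n x + q ^ n *\<^sub>R (C ^^ n) y" for n by (simp add: F_def)
    have "(\<lambda>n. F n x - y) \<longlonglongrightarrow> 0"
    proof (rule Lim_null_comparison)
      show "\<forall>\<^sub>F n in sequentially. norm (F n x - y) \<le> \<bar>q\<bar> ^ n * norm y"
      proof (intro always_eventually allI)
        fix n
        have "F n x - y = - (q ^ n *\<^sub>R (C ^^ n) y)" using y[of n] by (simp add: algebra_simps)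
        then show "norm (F n x - y) \<le> \<bar>q\<bar> ^ n * norm y"
          by (simp add: power_abs mult_left_mono norm_C_pow)
      qed
      show "(\<lambda>n. \<bar>q\<bar> ^ n * norm y) \<longlonglongrightarrow> 0"
        using tendsto_mult[OF LIMSEQ_power_zero[of "\<bar>q\<bar>"] tendsto_const, of "norm y"] q by simp
    qed
    then show ?thesis by (simp add: y_def LIM_zero_iff)
  qed
  then show ?thesis by (rule algebra_limit[OF N FN bclin_resolvent[OF h]])
qed

lemma closure_generator_domain: "closure {y. \<exists>z. is_gen y z} = UNIV"
proof -
  let ?D = "{y. \<exists>z. is_gen y z}"
  have "csubspace ?D"
    unfolding csubspace_def
  proof (intro conjI ballI allI)
    show "0 \<in> ?D" using is_gen_diff[OF R_generator R_generator, of 0 0] by auto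
  next
    fix x y assume "x \<in> ?D" "y \<in> ?D"
    then show "x + y \<in> ?D" by (auto intro: is_gen_add)
  next
    fix c x assume "x \<in> ?D"
    then show "c *\<^sub>C x \<in> ?D" by (auto intro: is_gen_scaleC)
  qed
  then have D: "csubspace (closure ?D)" "closed (closure ?D)" by (simp_all add: csubspace_closure)
  have zero: "y = 0" if y: "y \<in> cortho (closure ?D)" for y
  proof -
    have "R y \<in> closure ?D"
      by (rule subsetD[OF closure_subset]) (auto intro: R_generator)
    then have "cinner y (R y) = 0" using y by (simp add: cortho_def)
    moreover have "(norm (R y))\<^sup>2 \<le> Re (cinner y (R y))"
      using is_gen_dissipative[OF R_generator, of y] by (simp add: cinner_diff_left cinner_self)
    ultimately have R: "R y = 0" by simp
    have "is_gen 0 (- y)" using R_generator[of y] R by simp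
    moreover have "is_gen 0 0"
      using is_gen_diff[OF R_generator R_generator, of y y] by simp
    ultimately have "- y = 0" using generator_eq[of 0 "- y"] generator_eq[of 0 0] by simp
    then show "y = 0" by simp
  qed
  have "x \<in> closure ?D" for x
    using zero[OF cproj_ortho[OF D, of x]] cproj_in[OF D, of x] by simp
  then show ?thesis by auto
qed

text \<open>For contractions, strong convergence need only be checked on the domain of the generator.\<close>

lemma strong_convergence_if_dense:
  fixes F :: "'i \<Rightarrow> 'a \<Rightarrow> 'a"
  assumes F: "\<And>i. bounded_clinear (F i)" "\<And>i x. norm (F i x) \<le> norm x"
    and A: "bounded_clinear A" "\<And>x. norm (A x) \<le> norm x"
    and D: "\<And>y z. is_gen y z \<Longrightarrow> ((\<lambda>i. F i y) \<longlongrightarrow> A y) G"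
  shows "((\<lambda>i. F i x) \<longlongrightarrow> A x) G"
proof (rule tendstoI)
  fix e :: real assume e: "e > 0"
  have "x \<in> closure {y. \<exists>z. is_gen y z}" by (simp add: closure_generator_domain)
  then have "\<exists>y\<in>{y. \<exists>z. is_gen y z}. dist y x < e / 3"
    unfolding closure_approachable using e by (metis divide_pos_pos zero_less_numeral)
  then obtain y z where y: "is_gen y z" "dist y x < e / 3" by blast
  have near: "norm (B x - B y) < e / 3" if "bounded_clinear B" "\<And>x. norm (B x) \<le> norm x" for B
    using that(2)[of "x - y"] y(2) by (simp add: bclin_D[OF that(1)] dist_norm norm_minus_commute)
  have "\<forall>\<^sub>F i in G. dist (F i y) (A y) < e / 3" by (rule tendstoD[OF D[OF y(1)]]) (use e in simp)
  then show "\<forall>\<^sub>F i in G. dist (F i x) (A x) < e"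
  proof eventually_elim
    case (elim i)
    have "F i x - A x = (F i x - F i y) + (F i y - A y) - (A x - A y)" by simp
    then have "norm (F i x - A x) \<le> norm (F i x - F i y) + norm (F i y - A y) + norm (A x - A y)"
      using norm_triangle_ineq4 norm_triangle_ineq by (smt (verit))
    then show ?case using elim near[OF F, of i] near[OF A] unfolding dist_norm by linarith
  qed
qed

lemma resolvent_diff: "is_gen y z \<Longrightarrow> 0 < h \<Longrightarrow> resolvent h y - y = h *\<^sub>R resolvent h z"
proof -
  assume y: "is_gen y z" and h: "0 < h"
  have "resolvent h (y - h *\<^sub>R z) = y" by (rule resolvent_eqI[OF h y]) simp
  then show ?thesis by (simp add: bclin_D[OF bclin_resolvent[OF h]] algebra_simps)
qed

lemma resolvent_tendsto:
  assumes h: "\<And>n::nat. 0 < h n" "h \<longlonglongrightarrow> 0" shows "(\<lambda>n. resolvent (h n) x) \<longlonglongrightarrow> x"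
proof (rule strong_convergence_if_dense[where A = "\<lambda>x. x"])
  fix y z assume y: "is_gen y z"
  have "(\<lambda>n. resolvent (h n) y - y) \<longlonglongrightarrow> 0"
  proof (rule Lim_null_comparison)
    show "\<forall>\<^sub>F n in sequentially. norm (resolvent (h n) y - y) \<le> h n * norm z"
      using h(1) norm_resolvent[OF h(1)] by (simp add: resolvent_diff[OF y h(1)] less_imp_le)
    show "(\<lambda>n. h n * norm z) \<longlonglongrightarrow> 0" using tendsto_mult[OF h(2) tendsto_const, of "norm z"] by simp
  qed
  then show "(\<lambda>n. resolvent (h n) y) \<longlonglongrightarrow> y" by (simp add: LIM_zero_iff)
qed (auto intro: bclin_resolvent norm_resolvent h bclin_ident)

lemma T_pow: "0 \<le> h \<Longrightarrow> T h ^^ n = T (real n * h)"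
proof (induction n)
  case (Suc n)
  then show ?case using T_add[of h "real n * h"] by (simp add: algebra_simps)
qed (simp add: T_0)

lemma step_tendsto: "0 < t \<Longrightarrow> filterlim (\<lambda>m. t / real (Suc m)) (at_right 0) sequentially"
  unfolding filterlim_at
proof
  show "(\<lambda>m. t / real (Suc m)) \<longlonglongrightarrow> 0"
    by (rule LIMSEQ_Suc[OF lim_const_over_n])
qed (auto intro!: always_eventually)

text \<open>The exponential formula: the backward Euler scheme converges, being stable and consistent.\<close>

lemma exponential_formula:
  assumes t: "0 < t"
  shows "(\<lambda>m. (resolvent (t / real (Suc m)) ^^ Suc m) x) \<longlonglongrightarrow> T t x"
proof (rule strong_convergence_if_dense[where F = "\<lambda>m. resolvent (t / real (Suc m)) ^^ Suc m" and A = "T t"])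
  define h where "h = (\<lambda>m. t / real (Suc m))"
  have h: "0 < h m" for m using t by (simp add: h_def)
  have hn: "real (Suc m) * h m = t" for m by (simp add: h_def del: of_nat_Suc)
  have h_lim: "filterlim h (at_right 0) sequentially" unfolding h_def by (rule step_tendsto[OF t])
  show "norm ((resolvent (t / real (Suc m)) ^^ Suc m) x) \<le> norm x" for m x
    by (intro norm_funpow_le norm_resolvent h[unfolded h_def])
  show "bounded_clinear (resolvent (t / real (Suc m)) ^^ Suc m)" for m
    by (intro bclin_funpow bclin_resolvent h[unfolded h_def])
  show "bounded_clinear (T t)" "\<And>x. norm (T t x) \<le> norm x" using t by (simp_all add: bclin contraction)
  fix y z assume y: "is_gen y z"
  \<comment> \<open>stability: the errors of the single steps add up\<close>
  have telescope: "norm ((resolvent k ^^ n) y - (T k ^^ n) y) \<le> real n * norm (resolvent k y - T k y)"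
    if k: "0 < k" for k n
  proof (induction n)
    case (Suc n)
    have comm: "resolvent k ((T k ^^ n) y) = (T k ^^ n) (resolvent k y)"
      using resolvent_T[OF k, of "real n * k" y] k by (simp add: T_pow)
    have lin: "bounded_clinear (T k ^^ n)" and contr: "norm ((T k ^^ n) v) \<le> norm v" for v
      using k by (simp_all add: T_pow bclin contraction)
    have "(resolvent k ^^ Suc n) y - (T k ^^ Suc n) y =
        resolvent k ((resolvent k ^^ n) y - (T k ^^ n) y) + (T k ^^ n) (resolvent k y - T k y)"
      by (simp add: bclin_D[OF bclin_resolvent[OF k]] bclin_D[OF lin] comm funpow_swap1)
    then have "norm ((resolvent k ^^ Suc n) y - (T k ^^ Suc n) y) \<le>
        norm ((resolvent k ^^ n) y - (T k ^^ n) y) + norm (resolvent k y - T k y)"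
      using norm_triangle_mono[OF norm_resolvent[OF k] contr] by metis
    also have "\<dots> \<le> real n * norm (resolvent k y - T k y) + norm (resolvent k y - T k y)" using Suc by simp
    finally show ?case by (simp add: algebra_simps)
  qed simp
  have "(\<lambda>m. (resolvent (h m) ^^ Suc m) y - T t y) \<longlonglongrightarrow> 0"
  proof (rule Lim_null_comparison)
    show "\<forall>\<^sub>F m in sequentially. norm ((resolvent (h m) ^^ Suc m) y - T t y) \<le>
        t * norm (resolvent (h m) z - (T (h m) y - y) /\<^sub>R h m)"
    proof (intro always_eventually allI)
      fix m
      have "resolvent (h m) y - T (h m) y = h m *\<^sub>R (resolvent (h m) z - (T (h m) y - y) /\<^sub>R h m)"
        using h[of m] by (simp add: resolvent_diff[OF y h, symmetric] scaleR_diff_right)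
      then have "real (Suc m) * norm (resolvent (h m) y - T (h m) y)
          = real (Suc m) * h m * norm (resolvent (h m) z - (T (h m) y - y) /\<^sub>R h m)"
        using h[of m] by simp
      then show "norm ((resolvent (h m) ^^ Suc m) y - T t y) \<le> t * norm (resolvent (h m) z - (T (h m) y - y) /\<^sub>R h m)"
        using telescope[OF h[of m], of "Suc m"] T_pow[OF less_imp_le[OF h], of "Suc m" m] by (simp only: hn)
    qed
    have h0: "h \<longlonglongrightarrow> 0" using h_lim by (simp add: filterlim_at)
    have "(\<lambda>m. t * norm (resolvent (h m) z - (T (h m) y - y) /\<^sub>R h m)) \<longlonglongrightarrow> t * norm (z - z)"
      by (intro tendsto_mult tendsto_const tendsto_norm tendsto_diff resolvent_tendsto h h0
          filterlim_compose[OF y[unfolded is_gen_def] h_lim])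
    then show "(\<lambda>m. t * norm (resolvent (h m) z - (T (h m) y - y) /\<^sub>R h m)) \<longlonglongrightarrow> 0" by simp
  qed
  then show "(\<lambda>m. (resolvent (t / real (Suc m)) ^^ Suc m) y) \<longlonglongrightarrow> T t y"
    unfolding h_def by (simp only: LIM_zero_iff)
qed

lemma semigroup_in_algebra:
  assumes N: "strongly_closed_algebra N" and C: "C \<in> N" and t: "0 \<le> t"
  shows "T t \<in> N"
proof (cases "t = 0")
  case True
  then show ?thesis by (simp add: T_0 algebra_id[OF N])
next
  case False
  with t have t: "0 < t" by simp
  show ?thesis
  proof (rule algebra_limit[OF N _ _ exponential_formula[OF t]])
    show "resolvent (t / real (Suc m)) ^^ Suc m \<in> N" for m
      by (intro algebra_pow[OF N] resolvent_in_algebra[OF N C]) (use t in simp)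
  qed (use t in \<open>simp add: bclin\<close>)
qed

section \<open>The unitary parts of the semigroup and of its cogenerator\<close>

text \<open>The isometric part of the semigroup is the isometric part of its cogenerator, because on both of
  them \<open>Re (G y, y)\<close> vanishes.\<close>

lemma isometric_iff:
  "(\<forall>t\<ge>0. norm (T t x) = norm x) \<longleftrightarrow> (\<forall>n. norm ((C ^^ n) x) = norm x)"
proof -
  define Z where "Z = {x. \<forall>t\<in>{0..}. norm (T t x) = norm x}"
  define Z' where "Z' = {x. \<forall>n\<in>UNIV. norm ((C ^^ n) x) = norm x}"
  have Z: "csubspace Z" "closed Z"
    unfolding Z_def by (rule isometric_subspace; simp add: bclin contraction)+
  have Z': "csubspace Z'" "closed Z'"
    unfolding Z'_def by (rule isometric_subspace; simp add: bclin_C_pow norm_C_pow)+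
  have "T t ` Z \<subseteq> Z" if t: "0 \<le> t" for t
  proof (rule image_subsetI)
    fix x assume "x \<in> Z"
    then have x: "norm (T s x) = norm x" if "0 \<le> s" for s using that by (simp add: Z_def)
    have "norm (T s (T t x)) = norm (T t x)" if "0 \<le> s" for s
      using T_add_apply[of s t x] x[of "s + t"] x[of t] t that by simp
    then show "T t x \<in> Z" by (simp add: Z_def)
  qed
  then have TZ: "T t \<in> {A. bounded_clinear A \<and> A ` Z \<subseteq> Z}" if "0 \<le> t" for t using bclin that by blast
  have RZ: "R ` Z \<subseteq> Z" and CZ: "C ` Z \<subseteq> Z"
    using R_in_algebra[OF strongly_closed_algebra_stabilizer[OF Z] TZ]
      cogenerator_in_algebra[OF strongly_closed_algebra_stabilizer[OF Z] TZ] by blast+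
  have 1: "norm (C x) = norm x" if x: "x \<in> Z" for x
  proof -
    let ?y = "R x"
    have y: "?y \<in> Z" using RZ x by blast
    have "((\<lambda>h. 2 * Re (cinner ((T h ?y - ?y) /\<^sub>R h) ?y)) \<longlongrightarrow> 2 * Re (cinner (?y - x) ?y)) (at_right 0)"
      by (intro tendsto_mult tendsto_const tendsto_Re tendsto_cinner R_generator[unfolded is_gen_def])
    moreover have "((\<lambda>h. 2 * Re (cinner ((T h ?y - ?y) /\<^sub>R h) ?y)) \<longlongrightarrow> 0) (at_right 0)"
    proof (rule Lim_transform_eventually)
      have "((\<lambda>h::real. - (h * (norm ((T h ?y - ?y) /\<^sub>R h))\<^sup>2)) \<longlongrightarrow> - (0 * (norm (?y - x))\<^sup>2)) (at_right 0)"
        by (intro tendsto_minus tendsto_mult tendsto_ident_at tendsto_power tendsto_norm R_generator[unfolded is_gen_def])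
      then show "((\<lambda>h::real. - (h * (norm ((T h ?y - ?y) /\<^sub>R h))\<^sup>2)) \<longlongrightarrow> 0) (at_right 0)" by simp
      show "\<forall>\<^sub>F h in at_right 0. - (h * (norm ((T h ?y - ?y) /\<^sub>R h))\<^sup>2) = 2 * Re (cinner ((T h ?y - ?y) /\<^sub>R h) ?y)"
        using eventually_pos
      proof eventually_elim
        case (elim h)
        have "norm (T h ?y) = norm ?y" using y elim by (simp add: Z_def)
        then have "2 * Re (cinner ((T h ?y - ?y) /\<^sub>R h) ?y) = - ((norm (T h ?y - ?y))\<^sup>2 / h)"
          using Re_difference_quotient[of h ?y] by simp
        also have "(norm (T h ?y - ?y))\<^sup>2 / h = h * (norm ((T h ?y - ?y) /\<^sub>R h))\<^sup>2"
          using elim by (simp add: power_mult_distrib power_inverse power2_eq_square divide_inverse)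
        finally show ?case by simp
      qed
    qed
    ultimately have "2 * Re (cinner (?y - x) ?y) = 0"
      using tendsto_unique[OF trivial_limit_at_right_real] by blast
    then have "(norm (C x))\<^sup>2 = (norm x)\<^sup>2" using norm_C_sqr[of x] by simp
    then show ?thesis by (simp add: power2_eq_iff_nonneg)
  qed
  have ZZ': "x \<in> Z'" if x: "x \<in> Z" for x
  proof -
    have "(C ^^ n) x \<in> Z \<and> norm ((C ^^ n) x) = norm x" for n
    proof (induction n)
      case (Suc n)
      then show ?case using 1[of "(C ^^ n) x"] CZ by auto
    qed (simp add: x)
    then show ?thesis by (simp add: Z'_def)
  qed
  have "C ` Z' \<subseteq> Z'"
  proof (rule image_subsetI)
    fix x assume "x \<in> Z'"
    then have x: "norm ((C ^^ n) x) = norm x" for n by (simp add: Z'_def)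
    have "norm ((C ^^ n) (C x)) = norm (C x)" for n
      using x[of "Suc n"] x[of "Suc 0"] by (simp add: funpow_swap1)
    then show "C x \<in> Z'" by (simp add: Z'_def)
  qed
  then have CZ': "C \<in> {A. bounded_clinear A \<and> A ` Z' \<subseteq> Z'}" using bclin_C by blast
  have TZ': "T t ` Z' \<subseteq> Z'" if "0 \<le> t" for t
    using semigroup_in_algebra[OF strongly_closed_algebra_stabilizer[OF Z'] CZ' that] by blast
  have JZ': "resolvent h ` Z' \<subseteq> Z'" if "0 < h" for h
    using resolvent_in_algebra[OF strongly_closed_algebra_stabilizer[OF Z'] CZ' that] by blast
  have 2: "norm (T t (R w)) = norm (R w)" if t: "0 < t" and w: "w \<in> Z'" for t w
  proof -
    let ?y = "R w" and ?z = "R w - w"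
    have orth: "Re (cinner (T s ?z) (T s ?y)) = 0" if s: "0 \<le> s" for s
    proof -
      have "T s w \<in> Z'" using TZ'[OF s] w by blast
      then have "norm ((C ^^ 1) (T s w)) = norm (T s w)" unfolding Z'_def by blast
      then have "Re (cinner (R (T s w) - T s w) (R (T s w))) = 0" using norm_C_sqr[of "T s w"] by simp
      then show ?thesis using s by (simp add: resolvent_T bclin_D[OF bclin])
    qed
    define r where "r = (\<lambda>h. (T h ?y - ?y) /\<^sub>R h - ?z)"
    \<comment> \<open>In a step of length \<open>h\<close> the square of the norm decreases by \<open>o(h)\<close> only, uniformly in \<open>s\<close>.\<close>
    have step: "(norm (T s ?y))\<^sup>2 - 2 * h * (norm (r h) * norm ?y) \<le> (norm (T h (T s ?y)))\<^sup>2"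
      if s: "0 \<le> s" and h: "0 < h" for s h
    proof -
      have "T h ?y - ?y = h *\<^sub>R (?z + r h)" using h by (simp add: r_def)
      then have "T s (T h ?y - ?y) = h *\<^sub>R (T s ?z + T s (r h))" using s by (simp add: bclin_D[OF bclin])
      then have "T h (T s ?y) - T s ?y = h *\<^sub>R (T s ?z + T s (r h))"
        using s h by (simp add: bclin_D[OF bclin] T_comm[of h s])
      then have "Re (cinner (T h (T s ?y) - T s ?y) (T s ?y)) = h * Re (cinner (T s (r h)) (T s ?y))"
        using orth[OF s] by (simp add: cinner_simps)
      moreover have "\<bar>Re (cinner (T s (r h)) (T s ?y))\<bar> \<le> norm (r h) * norm ?y"
        using abs_Re_le_cmod norm_cinner_le contraction[OF s]
        by (meson mult_mono norm_ge_zero order_trans)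
      then have "- (h * (norm (r h) * norm ?y)) \<le> h * Re (cinner (T s (r h)) (T s ?y))"
        using mult_left_mono[of "- (norm (r h) * norm ?y)" "Re (cinner (T s (r h)) (T s ?y))" h] h by simp
      moreover have "(norm (T h (T s ?y)))\<^sup>2 = (norm (T s ?y))\<^sup>2 + 2 * Re (cinner (T h (T s ?y) - T s ?y) (T s ?y))
          + (norm (T h (T s ?y) - T s ?y))\<^sup>2"
        using norm_add_sqr[of "T s ?y" "T h (T s ?y) - T s ?y"] cinner_commute[of "T s ?y" "T h (T s ?y) - T s ?y"] by simp
      ultimately show ?thesis using zero_le_power2[of "norm (T h (T s ?y) - T s ?y)"] by linarith
    qed
    have iter: "(norm ?y)\<^sup>2 - real n * (2 * h * (norm (r h) * norm ?y)) \<le> (norm (T (real n * h) ?y))\<^sup>2"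
      if h: "0 < h" for n h
    proof (induction n)
      case (Suc n)
      have "T h (T (real n * h) ?y) = T (real (Suc n) * h) ?y"
        using T_add_apply[of h "real n * h" ?y] h by (simp add: algebra_simps)
      then show ?case using Suc step[of "real n * h" h] h by (simp add: algebra_simps)
    qed (simp add: T_0)
    have le: "(norm ?y)\<^sup>2 - 2 * t * (norm (r (t / real (Suc m))) * norm ?y) \<le> (norm (T t ?y))\<^sup>2" for m
      using iter[of "t / real (Suc m)" "Suc m"] t by (simp del: of_nat_Suc add: mult.assoc[symmetric])
    have "(\<lambda>m. r (t / real (Suc m))) \<longlonglongrightarrow> ?z - ?z"
      unfolding r_def
      by (intro tendsto_diff tendsto_const filterlim_compose[OF R_generator[unfolded is_gen_def] step_tendsto[OF t]])
    then have "(\<lambda>m. norm (r (t / real (Suc m)))) \<longlonglongrightarrow> norm (?z - ?z)" by (rule tendsto_norm)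
    then have "(\<lambda>m. (norm ?y)\<^sup>2 - 2 * t * (norm (r (t / real (Suc m))) * norm ?y)) \<longlonglongrightarrow> (norm ?y)\<^sup>2 - 2 * t * (norm (?z - ?z) * norm ?y)"
      by (intro tendsto_diff tendsto_mult tendsto_const)
    from LIMSEQ_le_const2[OF this, of "(norm (T t ?y))\<^sup>2"] le
    have "(norm ?y)\<^sup>2 - 2 * t * (norm (?z - ?z) * norm ?y) \<le> (norm (T t ?y))\<^sup>2" by blast
    then have "(norm ?y)\<^sup>2 \<le> (norm (T t ?y))\<^sup>2" by simp
    then have "norm ?y \<le> norm (T t ?y)" by (rule power2_le_imp_le) simp
    then show ?thesis using contraction[of t ?y] t by simp
  qed
  have Z'Z: "x \<in> Z" if x: "x \<in> Z'" for x
  proof -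
    have "norm (T t x) = norm x" if t: "0 \<le> t" for t
    proof (cases "t = 0")
      case True then show ?thesis by (simp add: T_0)
    next
      case False
      with t have t: "0 < t" by simp
      define h where "h = (\<lambda>m::nat. 1 / real (Suc m))"
      have h: "0 < h m" for m by (simp add: h_def)
      have h0: "h \<longlonglongrightarrow> 0" unfolding h_def by (rule LIMSEQ_Suc[OF lim_1_over_n])
      let ?y = "\<lambda>m. resolvent (h m) x"
      have "norm (T t (?y m)) = norm (?y m)" for m
      proof -
        let ?w = "?y m - (?y m - x) /\<^sub>R h m"
        have "?y m \<in> Z'" using JZ'[OF h] x by blast
        then have "?w \<in> Z'" using x by (intro csubspace_diff csubspace_scaleR Z') auto
        moreover have "R ?w = ?y m" by (rule R_eqI[OF resolvent_generator[OF h]]) simp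
        ultimately show ?thesis using 2[OF t, of ?w] by simp
      qed
      moreover have "(\<lambda>m. norm (T t (?y m))) \<longlonglongrightarrow> norm (T t x)"
        by (intro tendsto_norm tendsto_bclin[OF bclin[OF less_imp_le[OF t]]] resolvent_tendsto h h0)
      moreover have "(\<lambda>m. norm (?y m)) \<longlonglongrightarrow> norm x" by (intro tendsto_norm resolvent_tendsto h h0)
      ultimately show ?thesis using LIMSEQ_unique by auto
    qed
    then show ?thesis by (simp add: Z_def)
  qed
  show ?thesis using ZZ' Z'Z unfolding Z_def Z'_def by auto
qed

text \<open>The adjoint semigroup is strongly continuous, and its cogenerator is the adjoint of the
  cogenerator.\<close>

abbreviation Ts :: "real \<Rightarrow> 'a \<Rightarrow> 'a" where "Ts t \<equiv> cadjoint (T t)"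

lemma adjoint_semigroup: "contraction_semigroup Ts"
proof
  have "((\<lambda>t. Ts t x) \<longlongrightarrow> x) (at_right 0)" for x
  proof -
    have "((\<lambda>t. Ts t x - x) \<longlongrightarrow> 0) (at_right 0)"
    proof (rule Lim_null_comparison)
      have "((\<lambda>t. sqrt (2 * (norm x)\<^sup>2 - 2 * Re (cinner x (T t x)))) \<longlongrightarrow> sqrt (2 * (norm x)\<^sup>2 - 2 * Re (cinner x x))) (at_right 0)"
        by (intro tendsto_real_sqrt tendsto_diff tendsto_mult tendsto_const tendsto_Re tendsto_cinner continuous_at_0)
      then show "((\<lambda>t. sqrt (2 * (norm x)\<^sup>2 - 2 * Re (cinner x (T t x)))) \<longlongrightarrow> 0) (at_right 0)"
        by (simp add: cinner_self)
      show "\<forall>\<^sub>F t in at_right 0. norm (Ts t x - x) \<le> sqrt (2 * (norm x)\<^sup>2 - 2 * Re (cinner x (T t x)))"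
        using eventually_pos
      proof eventually_elim
        case (elim t)
        have "(norm (Ts t x))\<^sup>2 \<le> (norm x)\<^sup>2"
          using norm_cadjoint_le[OF bclin contraction, of t x] elim by (intro power_mono) auto
        then have "(norm (Ts t x - x))\<^sup>2 \<le> 2 * (norm x)\<^sup>2 - 2 * Re (cinner x (T t x))"
          using elim by (simp add: norm_diff_sqr cinner_cadjoint_left[OF bclin])
        then show ?case by (rule real_le_rsqrt)
      qed
    qed
    then show ?thesis by (simp add: LIM_zero_iff)
  qed
  moreover have "Ts 0 = id" unfolding T_0 by (rule cadjoint_eqI) simp
  moreover have "Ts (s + t) = Ts s \<circ> Ts t" if "0 \<le> s" "0 \<le> t" for s t
    using that T_add[of t s] by (simp add: cadjoint_compose bclin add.commute)
  ultimately show "C0_contraction_semigroup Ts"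
    by (simp add: C0_contraction_semigroup_def bclin_cadjoint bclin norm_cadjoint_le contraction)
qed

lemma cogenerator_adjoint: "cogenerator Ts = cadjoint C"
proof (rule cadjoint_eqI[symmetric])
  interpret A: contraction_semigroup Ts by (rule adjoint_semigroup)
  fix x y
  let ?u = "R x" and ?v = "A.R y"
  have "((\<lambda>h. cinner ((T h ?u - ?u) /\<^sub>R h) ?v) \<longlongrightarrow> cinner (?u - x) ?v) (at_right 0)"
    by (intro tendsto_cinner tendsto_const R_generator[unfolded is_gen_def])
  moreover have "((\<lambda>h. cinner ((T h ?u - ?u) /\<^sub>R h) ?v) \<longlongrightarrow> cinner ?u (?v - y)) (at_right 0)"
  proof (rule Lim_transform_eventually)
    show "((\<lambda>h. cinner ?u ((Ts h ?v - ?v) /\<^sub>R h)) \<longlongrightarrow> cinner ?u (?v - y)) (at_right 0)"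
      by (intro tendsto_cinner tendsto_const A.R_generator[unfolded A.is_gen_def])
    show "\<forall>\<^sub>F h in at_right 0. cinner ?u ((Ts h ?v - ?v) /\<^sub>R h) = cinner ((T h ?u - ?u) /\<^sub>R h) ?v"
      using eventually_pos
      by eventually_elim (simp add: cinner_simps cinner_cadjoint_right[OF bclin])
  qed
  ultimately have "cinner (?u - x) ?v = cinner ?u (?v - y)"
    using tendsto_unique[OF trivial_limit_at_right_real] by blast
  then have "cinner x ?v = cinner ?u y" by (simp add: cinner_simps)
  then show "cinner (C x) y = cinner x (cogenerator Ts y)"
    by (simp add: cogenerator_eq A.cogenerator_eq cinner_simps)
qed

end

lemma filterlim_incseq_subseq:
  fixes s :: "nat \<Rightarrow> 'i::{linorder, no_top}"
  assumes s: "filterlim s at_top sequentially"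
  shows "\<exists>r. strict_mono r \<and> incseq (s \<circ> r)"
proof -
  obtain r where r: "strict_mono r" "monoseq (\<lambda>n. s (r n))" using seq_monosub by blast
  have "\<not> decseq (\<lambda>n. s (r n))"
  proof
    assume dec: "decseq (\<lambda>n. s (r n))"
    obtain b where b: "s (r 0) < b" using gt_ex by blast
    have "\<forall>\<^sub>F n in sequentially. b \<le> s (r n)"
      using filterlim_compose[OF s filterlim_subseq[OF r(1)]] by (simp add: filterlim_at_top)
    then obtain n where "b \<le> s (r n)" by (auto simp: eventually_sequentially)
    moreover have "s (r n) \<le> s (r 0)" using dec by (simp add: decseq_def)
    ultimately show False using b by simp
  qed
  then have "incseq (\<lambda>n. s (r n))" using r(2) by (auto simp: monoseq_iff)
  then show ?thesis using r(1) by (auto simp: o_def)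
qed

text \<open>Since the limits are taken along sequences tending to infinity, only the operators with
  nonnegative index matter, and the monotonicity of the sequences is no restriction.\<close>

lemma (in contraction_family) limit_operators_eq:
  fixes X :: "'i::{linorder, no_top} \<Rightarrow> 'a \<Rightarrow> 'a" and \<iota> :: "'i \<Rightarrow> real" and j :: "real \<Rightarrow> 'i"
  assumes X: "\<And>t. t \<in> I \<Longrightarrow> X (j t) = W t \<circ> cproj U"
    and \<iota>: "filterlim \<iota> at_top at_top" "\<And>i. i0 \<le> i \<Longrightarrow> \<iota> i \<in> I \<and> j (\<iota> i) = i"
    and j: "filterlim j at_top at_top"
  shows "limit_operators U X = lim_ops"
proof -
  have op: "W t \<circ> cproj U \<in> operators_on U" if "t \<in> I" for t
    by (rule operators_onI[OF U_closed])
      (simp_all add: that bclin bclin_compose bclin_cproj U_closed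
        W_U cproj_U_in cproj_ident)
  show ?thesis
  proof (intro subset_antisym subsetI)
    fix L assume "L \<in> limit_operators U X"
    then obtain t where t: "filterlim t at_top sequentially" and
      lim: "limitin (weak_operator_topology U) (\<lambda>k. X (t k)) L sequentially"
      unfolding limit_operators_def by blast
    have ev: "\<forall>\<^sub>F k in sequentially. i0 \<le> t k" using t by (simp add: filterlim_at_top)
    define \<tau> where "\<tau> = (\<lambda>k. \<iota> (max i0 (t k)))"
    have \<tau>I: "\<tau> k \<in> I" for k by (simp add: \<tau>_def \<iota>(2))
    have "filterlim (\<lambda>k. max i0 (t k)) at_top sequentially"
      by (rule filterlim_at_top_mono[OF t]) simp
    from filterlim_compose[OF \<iota>(1) this] have \<tau>: "filterlim \<tau> at_top sequentially" by (simp add: \<tau>_def)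
    have "(\<lambda>k. cinner (W (\<tau> k) (cproj U x)) y) \<longlonglongrightarrow> cinner (L x) y" for x y
    proof (rule Lim_transform_eventually)
      show "(\<lambda>k. cinner (X (t k) x) y) \<longlonglongrightarrow> cinner (L x) y"
        using lim by (simp add: limitin_weak_operator_topology)
      show "\<forall>\<^sub>F k in sequentially. cinner (X (t k) x) y = cinner (W (\<tau> k) (cproj U x)) y"
        using ev
      proof eventually_elim
        case (elim k)
        then have "j (\<tau> k) = t k" by (simp add: \<tau>_def \<iota>(2) max_def)
        then show ?case using X[OF \<tau>I, of k] by simp
      qed
    qed
    moreover have "L \<in> operators_on U" using lim by (simp add: limitin_weak_operator_topology)
    ultimately show "L \<in> lim_ops" unfolding lim_ops_def limit_along_def using \<tau> \<tau>I by auto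
  next
    fix L assume L: "L \<in> lim_ops"
    then obtain \<tau> where "limit_along \<tau> L" by (rule lim_opsE)
    note \<tau> = limit_alongD(1,2)[OF this] and lim = limit_alongD(3)[OF this]
    have j\<tau>: "filterlim (\<lambda>k. j (\<tau> k)) at_top sequentially" by (rule filterlim_compose[OF j \<tau>(2)])
    from filterlim_incseq_subseq[OF this] obtain r where
      r: "strict_mono r" "incseq (\<lambda>k. j (\<tau> (r k)))" by (auto simp: o_def)
    show "L \<in> limit_operators U X"
      unfolding limit_operators_def limitin_weak_operator_topology
    proof (intro CollectI exI conjI allI)
      show "incseq (\<lambda>k. j (\<tau> (r k)))" by (rule r(2))
      show "filterlim (\<lambda>k. j (\<tau> (r k))) at_top sequentially"
        by (rule filterlim_compose[OF j\<tau> filterlim_subseq[OF r(1)]])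
      show "L \<in> operators_on U" using L lim_ops_on by blast
      show "\<forall>\<^sub>F k in sequentially. X (j (\<tau> (r k))) \<in> operators_on U" by (simp add: X \<tau>(1) op)
      show "(\<lambda>k. cinner (X (j (\<tau> (r k))) x) y) \<longlonglongrightarrow> cinner (L x) y" for x y
        using LIMSEQ_subseq_LIMSEQ[OF lim r(1), of x y] by (simp add: X \<tau>(1) o_def)
    qed
  qed
qed

section \<open>The semigroup and the powers of its cogenerator\<close>

locale separable_contraction_semigroup = contraction_semigroup T
  for T :: "real \<Rightarrow> 'a::chilbert_space \<Rightarrow> 'a" +
  assumes separable: "separable_space (euclidean :: 'a topology)"
begin

text \<open>The powers of the cogenerator, as a family indexed by the real numbers \<open>0, 1, 2, \<dots>\<close>.\<close>

definition powers :: "real \<Rightarrow> 'a \<Rightarrow> 'a" where "powers t = C ^^ nat \<lfloor>t\<rfloor>"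

lemma powers_of_nat: "powers (real n) = C ^^ n"
  by (simp add: powers_def)

sublocale F: contraction_family "{0..}" T
  by unfold_locales (auto simp: separable bclin contraction T_add)

sublocale D: contraction_family \<nat> powers
proof
  show "t - s \<in> \<nat>" if "s \<in> \<nat>" "t \<in> \<nat>" "s \<le> t" for s t :: real
    using that by (auto elim!: Nats_cases simp flip: of_nat_diff)
  show "powers (s + t) = powers s \<circ> powers t" if "s \<in> \<nat>" "t \<in> \<nat>" for s t
  proof -
    obtain m n where "s = real m" "t = real n" using \<open>s \<in> \<nat>\<close> \<open>t \<in> \<nat>\<close> by (auto elim!: Nats_cases)
    then show ?thesis by (simp only: powers_of_nat funpow_add flip: of_nat_add)
  qed
qed (auto elim!: Nats_cases simp: separable powers_of_nat bclin_C_pow norm_C_pow)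

lemma cadjoint_C_pow: "cadjoint (C ^^ n) = cadjoint C ^^ n"
proof (induction n)
  case 0
  show ?case unfolding funpow.simps by (rule cadjoint_eqI) simp
next
  case (Suc n)
  have "cadjoint (C ^^ Suc n) = cadjoint ((C ^^ n) \<circ> C)" by (simp only: funpow_Suc_right)
  also have "\<dots> = cadjoint C \<circ> cadjoint C ^^ n"
    by (simp only: cadjoint_compose[OF bclin_C_pow bclin_C] Suc)
  finally show ?case unfolding funpow.simps .
qed

lemma unitary_parts_eq: "D.U = F.U"
proof -
  interpret A: contraction_semigroup Ts by (rule adjoint_semigroup)
  have "x \<in> D.U \<longleftrightarrow> (\<forall>n. norm ((C ^^ n) x) = norm x) \<and> (\<forall>n. norm ((cadjoint C ^^ n) x) = norm x)" for x
  proof -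
    have "(\<forall>t\<in>\<nat>. Q t) \<longleftrightarrow> (\<forall>n. Q (real n))" for Q by (auto simp: Nats_def)
    then show ?thesis unfolding D.U_def D.V_def by (auto simp: powers_of_nat cadjoint_C_pow)
  qed
  also have "\<dots> x \<longleftrightarrow> (\<forall>t\<ge>0. norm (T t x) = norm x) \<and> (\<forall>t\<ge>0. norm (Ts t x) = norm x)" for x
    unfolding isometric_iff A.isometric_iff cogenerator_adjoint ..
  also have "\<dots> x \<longleftrightarrow> x \<in> F.U" for x
    unfolding F.U_def F.V_def by auto
  finally show ?thesis by blast
qed

text \<open>In particular the greatest subspace in the definition of the unitary part exists.\<close>

lemma unitary_subspace_eq: "unitary_subspace T = F.U"
  unfolding unitary_subspace_def
proof (rule Greatest_equality)
  show "csubspace F.U \<and> closed F.U \<and> (\<forall>t\<ge>0. reduces F.U (T t) \<and> unitary_on F.U (T t))"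
  proof (intro conjI allI impI F.U_closed)
    fix t :: real assume "0 \<le> t"
    then have t: "t \<in> {0..}" by simp
    show "reduces F.U (T t)"
      unfolding reduces_def cortho_def
      using F.W_U[OF t] F.V_U[OF t] by (auto simp: F.cinner_V_right[OF t, symmetric])
    show "unitary_on F.U (T t)"
      unfolding unitary_on_def
    proof (intro conjI ballI)
      show "T t ` F.U = F.U"
      proof (intro subset_antisym subsetI)
        fix x assume x: "x \<in> F.U"
        then have "x = T t (F.V t x)" using F.W_V[OF t] by simp
        then show "x \<in> T t ` F.U" using F.V_U[OF t x] by blast
      qed (use F.W_U[OF t] in auto)
      show "cinner (T t x) (T t y) = cinner x y" if "x \<in> F.U" "y \<in> F.U" for x y
        using F.cinner_V_left[OF t, of "T t x" y] F.V_W[OF t that(1)] by simp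
    qed
  qed
next
  fix S assume S: "csubspace S \<and> closed S \<and> (\<forall>t\<ge>0. reduces S (T t) \<and> unitary_on S (T t))"
  show "S \<subseteq> F.U"
  proof
    fix x assume x: "x \<in> S"
    show "x \<in> F.U" unfolding F.U_iff
    proof (intro ballI conjI)
      fix t :: real assume t: "t \<in> {0..}"
      then have u: "unitary_on S (T t)" using S by simp
      have VW: "F.V t (T t v) = v" if v: "v \<in> S" for v
      proof -
        have "cinner (T t v) (T t v) = cinner v v" using u v by (simp add: unitary_on_def)
        then have "(norm (T t v))\<^sup>2 = (norm v)\<^sup>2" unfolding cinner_self of_real_eq_iff .
        then have "norm (T t v) = norm v" by (simp add: power2_eq_iff_nonneg)
        then show ?thesis
          using contraction_isometric_iff[OF F.bclin[OF t] F.contraction[OF t]] by (simp add: F.V_def)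
      qed
      show "F.V t (T t x) = x" by (rule VW[OF x])
      have "x \<in> T t ` S" using u x by (simp add: unitary_on_def)
      then obtain v where "v \<in> S" "x = T t v" by blast
      then show "T t (F.V t x) = x" using VW by simp
    qed
  qed
qed

lemma \<Omega>\<^sub>U_eq: "\<Omega>\<^sub>U T = F.lim_ops"
  unfolding \<Omega>\<^sub>U_def unitary_subspace_eq
proof (rule F.limit_operators_eq[where \<iota> = "\<lambda>t. t" and j = "\<lambda>t. t" and ?i0.0 = 0])
  show "unitary_group T t = T t \<circ> cproj F.U" if "t \<in> {0..}" for t
    using that by (simp add: unitary_group_def unitary_subspace_eq Let_def)
qed (auto intro: filterlim_ident)

lemma \<Omega>\<^sub>C_eq: "\<Omega>\<^sub>C T = D.lim_ops"
  unfolding \<Omega>\<^sub>C_def unitary_subspace_eq unitary_parts_eq[symmetric]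
proof (rule D.limit_operators_eq[where \<iota> = real_of_int and j = "\<lambda>t. \<lfloor>t\<rfloor>" and ?i0.0 = 0])
  show "unitary_powers T \<lfloor>t\<rfloor> = powers t \<circ> cproj D.U" if "t \<in> \<nat>" for t
    using that by (auto elim!: Nats_cases simp: unitary_powers_def unitary_subspace_eq unitary_parts_eq Let_def powers_of_nat)
  show "real_of_int i \<in> \<nat> \<and> \<lfloor>real_of_int i\<rfloor> = i" if "0 \<le> i" for i
    using that by (metis Nats_1 floor_of_int of_int_of_nat_eq of_nat_in_Nats zero_le_imp_eq_int)
qed (auto intro: filterlim_real_of_int_at_top filterlim_floor_sequentially filterlim_at_top_at_top)

lemma weakly_stable_semigroup_eq: "weakly_stable_semigroup T = F.K"
proof -
  have "x \<in> weakly_stable_semigroup T \<longleftrightarrow> x \<in> F.K" for x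
  proof -
    have "(\<forall>e>0. \<exists>b. \<forall>t\<ge>b. cmod (cinner (T t x) y) < e) \<longleftrightarrow>
        (\<forall>e>0. \<exists>b. \<forall>t\<in>{0..}. b \<le> t \<longrightarrow> cmod (cinner (T t x) y) < e)" for y
      by (meson atLeast_iff max.bounded_iff max.cobounded1 order_trans)
    then show ?thesis
      unfolding weakly_stable_semigroup_def F.K_iff_weakly_stable limitin_weak_topology
      by (simp add: tendsto_iff eventually_at_top_linorder)
  qed
  then show ?thesis by blast
qed

lemma weakly_stable_powers_eq: "weakly_stable_powers C = D.K"
proof -
  have "x \<in> weakly_stable_powers C \<longleftrightarrow> x \<in> D.K" for x
  proof -
    have "(\<forall>e>0. \<exists>b::nat. \<forall>n\<ge>b. cmod (cinner ((C ^^ n) x) y) < e) \<longleftrightarrow>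
        (\<forall>e>0. \<exists>b. \<forall>t\<in>\<nat>. b \<le> t \<longrightarrow> cmod (cinner (powers t x) y) < e)" (is "(\<forall>e>0. ?P e) \<longleftrightarrow> (\<forall>e>0. ?Q e)") for y
    proof -
      have "?P e \<longleftrightarrow> ?Q e" for e
      proof
        assume "?P e"
        then obtain b where "\<forall>n\<ge>b. cmod (cinner ((C ^^ n) x) y) < e" by blast
        then show "?Q e" by (intro exI[of _ "real b"]) (auto elim!: Nats_cases simp: powers_of_nat)
      next
        assume "?Q e"
        then obtain b where b: "\<forall>t\<in>\<nat>. b \<le> t \<longrightarrow> cmod (cinner (powers t x) y) < e" by blast
        obtain m where m: "b \<le> real m" using real_arch_simple by blast
        have "cmod (cinner ((C ^^ n) x) y) < e" if "m \<le> n" for n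
          using b[rule_format, of "real n"] m that by (simp add: powers_of_nat)
        then show "?P e" by blast
      qed
      then show ?thesis by blast
    qed
    then show ?thesis
      unfolding weakly_stable_powers_def D.K_iff_weakly_stable limitin_weak_topology
      by (simp add: tendsto_iff eventually_sequentially)
  qed
  then show ?thesis by blast
qed

lemma family_pairs:
  "contraction_family_pair {0..} T \<nat> powers" "contraction_family_pair \<nat> powers {0..} T"
proof -
  show "contraction_family_pair {0..} T \<nat> powers"
  proof unfold_locales
    fix N :: "('a \<Rightarrow> 'a) set" and t :: real
    assume N: "strongly_closed_algebra N" and T: "\<forall>t\<in>{0..}. T t \<in> N" and t: "t \<in> \<nat>"
    have "C \<in> N" by (rule cogenerator_in_algebra[OF N]) (use T in simp)
    then show "powers t \<in> N" unfolding powers_def by (rule algebra_pow[OF N])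
  qed (rule unitary_parts_eq)
  show "contraction_family_pair \<nat> powers {0..} T"
  proof unfold_locales
    fix N :: "('a \<Rightarrow> 'a) set" and t :: real
    assume N: "strongly_closed_algebra N" and P: "\<forall>t\<in>\<nat>. powers t \<in> N" and t: "t \<in> {0..}"
    have "powers (real 1) \<in> N" using P of_nat_in_Nats by blast
    then have "C \<in> N" unfolding powers_of_nat by simp
    then show "T t \<in> N" using t by (intro semigroup_in_algebra[OF N]) auto
  qed (rule unitary_parts_eq[symmetric])
qed

end

theorem mainTheorem2:
  fixes T :: "real \<Rightarrow> 'a::chilbert_space \<Rightarrow> 'a"
  assumes separable: "separable_space (euclidean :: 'a topology)"
    and semigroup: "C0_contraction_semigroup T"
    and flight: "\<forall>x. flight_vector T x"
  shows "(weakly_stable_semigroup T = weakly_stable_powers (cogenerator T) \<longleftrightarrow>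
            limit_algebra (unitary_subspace T) (\<Omega>\<^sub>U T) =
            limit_algebra (unitary_subspace T) (\<Omega>\<^sub>C T)) \<and>
         (limit_algebra (unitary_subspace T) (\<Omega>\<^sub>U T) =
            limit_algebra (unitary_subspace T) (\<Omega>\<^sub>C T) \<longleftrightarrow>
          entangled (\<Omega>\<^sub>U T) (\<Omega>\<^sub>C T))"
proof -
  interpret separable_contraction_semigroup T
    by unfold_locales (rule semigroup, rule separable)
  show ?thesis
    using limit_algebras_eq_iff_kernels_eq[OF family_pairs]
    unfolding \<Omega>\<^sub>U_eq \<Omega>\<^sub>C_eq weakly_stable_semigroup_eq weakly_stable_powers_eq unitary_subspace_eq
      unitary_parts_eq by simp
qed

end
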